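(* There is a positive function $\eta_0$ with $\eta_0(x)\to0$ as $x\to\infty$ such that the following holds for every positive function $\eta$ with $\eta(x)\to0$ as $x\to\infty$ and $\eta(x)\ge\eta_0(x)$ for all large $x$. Put $$\lambda''=\lambda''(x)=\exp\left(\big(\sqrt2+\eta(x)\big)\sqrt{\log_2 x\,\log_3 x}\right).$$ Fix $c\in(0,1)$ and assume that $\mathcal{A}\subset\mathbb{N}$ satisfies $\mathbf{HL}[\phi,\psi]$ with $\phi(x)=(\log x)^{1+c}$ and $\psi(x)=(\log x)^{c}$. Let $\lambda=\lambda(x)\ge\lambda''(x)$ be a parameter such that $\lambda=(\log x)^{o(1)}$ as $x\to\infty$. Then, for all sufficiently large $x$, $$M_{\mathcal{A}}(x;\lambda\log x)\ge x e^{-\lambda}\exp\left[\lambda\exp\left(-\big(1/\sqrt2+o(1)\big)\sqrt{\log_2 x\,\log_3 x}\right)\right].$$ Moreover, the same lower bound holds with $M_{\mathcal{A}}(x;\lambda\log x)$ replaced by $N_{\mathcal{A}}(x;\lambda\log x,0)$.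
   Context: $\log_1 x=\max\{0,\log x\}$ and $\log_k x=\max\{0,\log(\log_{k-1}x)\}$ for $k\ge2$ (iterated logarithms). For $\mathcal{A}\subset\mathbb{N}$ (a set of positive integers), $M_{\mathcal{A}}(x;y)=|\{n\le x: n\in\mathcal{A}\text{ and }[n+1,n+y]\cap\mathcal{A}=\varnothing\}|$ and $N_{\mathcal{A}}(x;y,k)=|\{n\le x: |[n+1,n+y]\cap\mathcal{A}|=k\}|$, where $n$ runs over positive integers. For a finite set $\mathcal{H}\subset\mathbb{Z}$ the singular series is $\mathfrak{S}(\mathcal{H})=\prod_p\left(1-\frac{|\mathcal{H}\bmod p|}{p}\right)\left(1-\frac1p\right)^{-|\mathcal{H}|}$, the product over all primes $p$, where $|\mathcal H\bmod p|$ is the number of residue classes mod $p$ occupied by $\mathcal H$. Let $\phi,\psi$ be positive real-valued functions. $\mathcal{A}\subset\mathbb{N}$ satisfies $\mathbf{HL}[\phi,\psi]$ if there is a constant $x_0$ such that for all $x\ge x_0$ and all finite sets of integers $\mathcal{H}\subset[0,\phi(x)]$ with $|\mathcal{H}|\le\psi(x)$ (with $x_0$ independent of $\mathcal{H}$), $$|\{n\le x: n+h\in\mathcal{A}\text{ for all }h\in\mathcal{H}\}|=\mathfrak{S}(\mathcal{H})\int_2^x\frac{dt}{\log^{|\mathcal{H}|}t}+E(x,\mathcal{H}),\qquad |E(x,\mathcal{H})|\le x e^{-\psi(x)\log_2 x}.$$ $o(1)$ denotes a function tending to $0$ as $x\to\infty$, for the given $\mathcal{A}$, $c$, $\eta$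 and $\lambda(\cdot)$. *)

theory Defs
  imports "HOL-Analysis.Analysis" "HOL-Computational_Algebra.Primes"
begin

(* Indexed from 0 so that the recursion also produces log_1 x = max{0, log x}.
   Since ln 0 = 0 here, max{0, ln 0} = 0 agrees with the convention log 0 = -infinity. *)
primrec iter_log :: "nat \<Rightarrow> real \<Rightarrow> real" where
  "iter_log 0 x = x"
| "iter_log (Suc k) x = max 0 (ln (iter_log k x))"

definition M_count :: "nat set \<Rightarrow> real \<Rightarrow> real \<Rightarrow> nat" where
  "M_count A x y =
     card {n. 1 \<le> n \<and> real n \<le> x \<and> n \<in> A \<and>
              {m \<in> A. real n + 1 \<le> real m \<and> real m \<le> real n + y} = {}}"

definition N_count :: "nat set \<Rightarrow> real \<Rightarrow> real \<Rightarrow> nat \<Rightarrow> nat" where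
  "N_count A x y k =
     card {n. 1 \<le> n \<and> real n \<le> x \<and>
              card {m \<in> A. real n + 1 \<le> real m \<and> real m \<le> real n + y} = k}"

(* The infinite product of HOL-Analysis allows finitely many vanishing factors, in which case
   its value is 0; this happens when H occupies every residue class modulo some prime. *)
definition singular_series :: "int set \<Rightarrow> real" where
  "singular_series H =
     (\<Prod>p. if prime p
           then (1 - real (card ((\<lambda>h. h mod int p) ` H)) / real p)
                  * (1 - 1 / real p) powi (- int (card H))
           else 1)"

definition HL :: "(real \<Rightarrow> real) \<Rightarrow> (real \<Rightarrow> real) \<Rightarrow> nat set \<Rightarrow> bool" where
  "HL \<phi> \<psi> A \<longleftrightarrow>
     (\<exists>x0. \<forall>x\<ge>x0. \<forall>H :: int set.
        finite H \<and> (\<forall>h\<in>H. 0 \<le> h \<and> real_of_int h \<le> \<phi> x) \<and> real (card H) \<le> \<psi> x \<longrightarrow>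
        \<bar>real (card {n. 1 \<le> n \<and> real n \<le> x \<and> (\<forall>h\<in>H. int n + h \<in> int ` A)})
           - singular_series H * integral {2..x} (\<lambda>t. 1 / ln t ^ card H)\<bar>
          \<le> x * exp (- \<psi> x * iter_log 2 x))"

end

theory Submission
  imports Defs "HOL-Real_Asymp.Real_Asymp" "HOL-Number_Theory.Cong"
begin

text \<open>
  By Bonferroni's inequality and the hypothesis on tuples, the number of \<open>n \<le> x\<close> in \<open>A\<close> followed by a gap
  of length \<open>y\<close> is at least an integral of truncated alternating sums of singular series.  Up to tiny errors
  such a sum is a sieve functional: with \<open>V\<close> the product of \<open>1 - 1/p\<close> over the primes
  \<open>p \<le> Z\<close> and \<open>q = 1 / (V ln t)\<close>, it is \<open>q\<close> times the expectation of \<open>(1 - q)^k\<close>, where \<open>k\<close> counts the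
  survivors in \<open>{1..y}\<close> when one random residue class is removed modulo each prime \<open>p \<le> Z\<close>, and \<open>0\<close> must survive.
  Jensen's inequality alone gives \<open>e\<close> to the power \<open>- y / ln t\<close>.  The gain comes from prescribing the residue
  classes modulo the primes up to \<open>z\<close>, which costs only a factor \<open>exp (- z ln z)\<close>, so that \<open>{1..y}\<close> has a
  proportion \<open>1 - u^(-u)\<close> of the expected number of survivors, \<open>y = z^u\<close>.  The choice
  \<open>ln z = sqrt (ln y ln ln y / 2)\<close> makes \<open>u^(-u)\<close> and \<open>1/z\<close> about equal.

  That such residue classes exist follows from sieving \<open>{1..Y}\<close> only by primes \<open>p\<close> in a narrow range
  \<open>z^(1-\<epsilon>) < p \<le> z\<close>: averaging over blocks and over the remaining primes, a relative deficiency for some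
  \<open>Y\<close> a bit larger than \<open>y\<close> suffices.  The relative deficiency at \<open>Y = e^v\<close> has Mellin transform a constant
  times the product of \<open>1 - p^(s-1)\<close>.  This product is nonnegative at the real point \<open>\<tau>\<close> but is as large as
  \<open>exp (\<Sum> p^(\<tau>-1))\<close> at \<open>\<tau> + i \<pi> / ln z\<close>, where every \<open>p^(s-1)\<close> is close to a negative number.  So the
  positive part of the deficiency has a large integral, and Rankin's trick localises \<open>Y\<close>.
\<close>

section \<open>Mertens' first theorem\<close>

text \<open>The threshold for \<open>lam\<close> is a balance. Put \<open>L = ln (ln x)\<close> and
  \<open>s = sqlog L\<close>. Prescribing classes costs \<open>exp (- z ln z)\<close>, and the
  deficiency then saves \<open>exp (lam / u^u)\<close>. As \<open>z\<close> and \<open>u^u\<close>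
  are both near \<open>exp (s / sqrt 2)\<close>, the saving wins once \<open>lam\<close> exceeds
  their product, about \<open>exp (sqrt 2 * s)\<close>. Two cut-offs carry the error terms: tuples
  are limited to about \<open>lam^2\<close> elements and prime products to about
  \<open>exp (lam^2)\<close>. This is enough to push all errors below \<open>exp (- lam)\<close>.
  Since \<open>lam\<close> is \<open>(ln x)^o(1)\<close>, it is also little enough for the tuple
  hypothesis to apply and for a very crude Mertens product bound, some unspecified power of the
  logarithm, to do. Another obstacle is uniformity: the sieve works at a fixed precision
  \<open>\<epsilon>\<close>, from some \<open>L\<close> on, while \<open>\<eta>0\<close> has to be
  named before \<open>A\<close>, \<open>c\<close> and \<open>lam\<close>. So
  \<open>\<epsilon>\<close> becomes a slowly decreasing function of \<open>L\<close>, found by a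
  diagonal argument from the sieve alone.\<close>

lemma prod_primes_dvd:
  fixes n :: nat
  assumes "finite P" "\<And>p. p \<in> P \<Longrightarrow> prime p" "\<And>p. p \<in> P \<Longrightarrow> p dvd n"
  shows "\<Prod>P dvd n"
  using assms
proof (induction P rule: finite_induct)
  case (insert p P)
  have "coprime p (\<Prod>P)"
    using insert by (intro prod_coprime_right) (metis insertCI primes_coprime)
  then show ?case
    using insert by (auto intro!: divides_mult)
qed simp

text \<open>Chebyshev's bound. The primes in the upper half of \<open>{1..n}\<close> all divide
  \<open>n choose (n div 2)\<close>, which is at most \<open>2 ^ n\<close>; the lower half is the
  induction hypothesis.\<close>

lemma sum_ln_primes_le: "(\<Sum>p | prime p \<and> p \<le> n. ln (real p)) \<le> 4 * ln 2 * real n"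
proof (induction n rule: less_induct)
  case (less n)
  consider "n = 0" | "n = 1" | "n \<ge> 2" by linarith
  then show ?case
  proof cases
    case 3
    define m where "m = n - n div 2"
    define P where "P = {p. prime p \<and> m < p \<and> p \<le> n}"
    have m: "m < n" "n div 2 \<le> m" "2 * m \<le> n + 1" "m \<ge> 1" using 3 by (auto simp: m_def)
    have fin: "finite P" unfolding P_def by (rule finite_subset[of _ "{..n}"]) auto
    have dvd: "p dvd n choose (n div 2)" if "p \<in> P" for p
    proof -
      have p: "prime p" "m < p" "p \<le> n" using that by (auto simp: P_def)
      have "p dvd fact n" using p by (simp add: prime_dvd_fact_iff)
      moreover have "fact (n div 2) * fact m * (n choose (n div 2)) = (fact n :: nat)"
        unfolding m_def by (rule binomial_fact_lemma) auto
      ultimately have "p dvd fact (n div 2) * fact m * (n choose (n div 2))" by simp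
      then show ?thesis using p m by (auto simp: prime_dvd_mult_iff prime_dvd_fact_iff)
    qed
    have "\<Prod>P dvd n choose (n div 2)"
      by (rule prod_primes_dvd) (use fin dvd in \<open>auto simp: P_def\<close>)
    then have "\<Prod>P \<le> n choose (n div 2)" by (rule dvd_imp_le) auto
    also have "\<dots> \<le> 2 ^ n" by (rule binomial_le_pow2)
    finally have "real (\<Prod>P) \<le> 2 ^ n" by (metis of_nat_le_iff of_nat_numeral of_nat_power)
    moreover have pos: "0 < real p" if "p \<in> P" for p using that by (auto simp: P_def prime_gt_0_nat)
    then have "real (\<Prod>P) > 0" unfolding of_nat_prod by (intro prod_pos) auto
    ultimately have "ln (real (\<Prod>P)) \<le> ln (2 ^ n)" by simp
    then have "ln (real (\<Prod>P)) \<le> real n * ln 2" by (simp add: ln_realpow)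
    moreover have "ln (real (\<Prod>P)) = (\<Sum>p\<in>P. ln (real p))"
      unfolding of_nat_prod by (rule ln_prod) (use fin pos in auto)
    moreover have "{p. prime p \<and> p \<le> n} = {p. prime p \<and> p \<le> m} \<union> P"
      using m by (auto simp: P_def)
    moreover have "(\<Sum>p\<in>{p. prime p \<and> p \<le> m} \<union> P. ln (real p))
       = (\<Sum>p | prime p \<and> p \<le> m. ln (real p)) + (\<Sum>p\<in>P. ln (real p))"
      by (rule sum.union_disjoint) (auto simp: P_def)
    ultimately have "(\<Sum>p | prime p \<and> p \<le> n. ln (real p)) \<le> 4 * ln 2 * real m + real n * ln 2"
      using less.IH[OF m(1)] by simp
    also have "\<dots> \<le> 2 * ln 2 * (real n + 1) + real n * ln 2"
    proof -
      have "2 * real m \<le> real n + 1" using m by linarith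
      then have "2 * ln 2 * (2 * real m) \<le> 2 * ln 2 * (real n + 1)" by (intro mult_left_mono) auto
      then show ?thesis by simp
    qed
    also have "\<dots> = ln 2 * (3 * real n + 2)" by (simp add: algebra_simps)
    also have "\<dots> \<le> ln 2 * (4 * real n)" using 3 by (intro mult_left_mono) auto
    finally show ?thesis by (simp add: algebra_simps)
  next
    case 2
    then have "{p. prime p \<and> p \<le> n} = {}" by (auto dest!: prime_gt_1_nat)
    then show ?thesis by (simp only:) simp
  qed (auto intro!: sum.neutral dest: prime_gt_1_nat)
qed

lemma multiplicity_fact_Suc:
  fixes p :: nat
  assumes "prime p"
  shows "multiplicity p (fact (Suc n)) = multiplicity p (Suc n) + multiplicity p (fact n :: nat)"
  using assms by (simp del: mult_Suc add: prime_elem_multiplicity_mult_distrib)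

text \<open>One step of Legendre's formula: of the numbers up to \<open>n\<close> only the multiples
  of \<open>p\<close> matter, and dividing each of them by \<open>p\<close> leaves
  \<open>fact (n div p)\<close>.\<close>

lemma multiplicity_fact:
  fixes p :: nat
  assumes p: "prime p"
  shows "multiplicity p (fact n :: nat) = n div p + multiplicity p (fact (n div p) :: nat)"
proof (induction n)
  case (Suc n)
  show ?case
  proof (cases "p dvd Suc n")
    case True
    then obtain k where k: "Suc n = p * k" by auto
    then have "k \<noteq> 0" by (cases k) auto
    then obtain j where j: "k = Suc j" by (cases k) auto
    have p0: "p > 0" using p prime_gt_0_nat by blast
    have "n = (p - 1) + p * j" using k j p0 by simp
    moreover have "((p - 1) + p * j) div p = j" using p0 by (subst div_mult_self2) auto
    ultimately have nd: "n div p = j" by simp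
    have sd: "Suc n div p = Suc j" using k j p0 by simp
    have "multiplicity p (Suc n) = multiplicity p p + multiplicity p (Suc j)"
      unfolding k j using p p0 by (intro prime_elem_multiplicity_mult_distrib) auto
    also have "multiplicity p p = 1" using p by (simp add: prime_gt_0_nat multiplicity_self)
    finally show ?thesis
      using Suc.IH unfolding sd nd multiplicity_fact_Suc[OF p] by simp
  next
    case False
    then have "multiplicity p (Suc n) = 0" by (rule not_dvd_imp_multiplicity_0)
    moreover have "Suc n div p = n div p" using False by (simp add: div_Suc dvd_eq_mod_eq_0)
    ultimately show ?thesis using Suc.IH unfolding multiplicity_fact_Suc[OF p] by simp
  qed
qed (use p in simp)

text \<open>Iterating Legendre's step gives the geometric series \<open>n/p + n/p^2 + ...\<close>,
  with sum \<open>n / (p - 1)\<close>.\<close>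

lemma multiplicity_fact_le:
  fixes p :: nat
  assumes p: "prime p"
  shows "real (multiplicity p (fact n :: nat)) \<le> real n / real (p - 1)"
proof (induction n rule: less_induct)
  case (less n)
  have p2: "p \<ge> 2" using p by (rule prime_ge_2_nat)
  show ?case
  proof (cases "n = 0")
    case False
    then have "n div p < n" using p2 by simp
    from less.IH[OF this] have
      "real (multiplicity p (fact n :: nat)) \<le> real (n div p) + real (n div p) / real (p - 1)"
      unfolding multiplicity_fact[OF p, of n] by simp
    also have "\<dots> = real (n div p) * (real p / real (p - 1))" using p2 by (simp add: field_simps of_nat_diff)
    also have "\<dots> \<le> (real n / real p) * (real p / real (p - 1))"
      by (intro mult_right_mono) (simp_all add: of_nat_div_le_of_nat)
    also have "\<dots> = real n / real (p - 1)" using p2 by simp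
    finally show ?thesis .
  qed simp
qed

lemma ln_fact_eq_sum_primes:
  "ln (fact n) = (\<Sum>p | prime p \<and> p \<le> n. real (multiplicity p (fact n :: nat)) * ln (real p))"
proof -
  have eq: "prime_factors (fact n) = {p. prime p \<and> p \<le> n}"
    by (auto simp: prime_factors_dvd prime_dvd_fact_iff)
  have "(fact n :: nat) = (\<Prod>p\<in>{p. prime p \<and> p \<le> n}. p ^ multiplicity p (fact n))"
    using prod_prime_factors[of "fact n :: nat"] eq by simp
  then have "real (fact n) = (\<Prod>p\<in>{p. prime p \<and> p \<le> n}. real p ^ multiplicity p (fact n :: nat))"
    by (metis (no_types, lifting) of_nat_power of_nat_prod prod.cong)
  then have "ln (real (fact n)) = (\<Sum>p | prime p \<and> p \<le> n. ln (real p ^ multiplicity p (fact n :: nat)))"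
    by (simp only:, subst ln_prod) (auto intro: prime_gt_0_nat)
  also have "\<dots> = (\<Sum>p | prime p \<and> p \<le> n. real (multiplicity p (fact n :: nat)) * ln (real p))"
    by (intro sum.cong) (auto simp: ln_realpow prime_gt_0_nat)
  finally show ?thesis by simp
qed

lemma ln_fact_ge: "ln (fact n) \<ge> real n * ln (real n) - real n"
proof (induction n)
  case (Suc n)
  show ?case
  proof (cases "n = 0")
    case False
    then have n: "n > 0" by simp
    have "ln (1 + 1 / real n) \<le> 1 / real n" by (rule ln_add_one_self_le_self) simp
    moreover have "1 + 1 / real n = real (Suc n) / real n" using n by (simp add: field_simps)
    ultimately have "ln (real (Suc n)) - ln (real n) \<le> 1 / real n" using n by (simp add: ln_div)
    then have "real n * (ln (real (Suc n)) - ln (real n)) \<le> 1"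
      using n by (simp add: field_simps)
    moreover have "ln (fact (Suc n)) = ln (real (Suc n)) + ln (fact n)"
      using ln_mult[of "real (Suc n)" "fact n"] by simp
    moreover have "real (Suc n) = real n + 1" by simp
    ultimately show ?thesis using Suc.IH by (simp only: algebra_simps)
  qed simp
qed simp

lemma ln_fact_le: "ln (fact n) \<le> real n * ln (real n)"
proof (cases "n = 0")
  case False
  have "(fact n :: real) \<le> real n ^ n" using fact_le_power[of n, where ?'a = real] by simp
  then have "ln (fact n) \<le> ln (real n ^ n)" using False by simp
  then show ?thesis using False by (simp add: ln_realpow)
qed simp

text \<open>Legendre's formula bounds \<open>ln (fact n)\<close> from below by the sum of
  \<open>(n / p - 1) * ln p\<close>; the subtracted \<open>ln p\<close> are summed by Chebyshev's
  bound.\<close>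

lemma mertens_upper:
  assumes "n \<ge> 1"
  shows "(\<Sum>p | prime p \<and> p \<le> n. ln (real p) / real p) \<le> ln (real n) + 4"
proof -
  let ?P = "{p. prime p \<and> p \<le> n}"
  have "real n * (\<Sum>p\<in>?P. ln (real p) / real p) - (\<Sum>p\<in>?P. ln (real p))
      = (\<Sum>p\<in>?P. (real n / real p - 1) * ln (real p))"
    by (simp add: sum_distrib_left sum_subtractf algebra_simps)
  also have "\<dots> \<le> (\<Sum>p\<in>?P. real (multiplicity p (fact n :: nat)) * ln (real p))"
  proof (intro sum_mono mult_right_mono)
    fix p assume p: "p \<in> ?P"
    then have "real n / real p - 1 \<le> real (n div p)" 
      using floor_divide_of_nat_eq[of n p, where ?'a = real] by linarith
    also have "\<dots> \<le> real (multiplicity p (fact n :: nat))" using p multiplicity_fact[of p n] by simp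
    finally show "real n / real p - 1 \<le> real (multiplicity p (fact n :: nat))" .
  qed (use prime_ge_1_nat in \<open>auto\<close>)
  also have "\<dots> \<le> real n * ln (real n)" using ln_fact_le[of n] by (simp add: ln_fact_eq_sum_primes)
  finally have "real n * (\<Sum>p\<in>?P. ln (real p) / real p) \<le> real n * ln (real n) + 4 * ln 2 * real n"
    using sum_ln_primes_le[of n] by linarith
  also have "\<dots> = real n * (ln (real n) + 4 * ln 2)" by (simp add: algebra_simps)
  finally have "(\<Sum>p\<in>?P. ln (real p) / real p) \<le> ln (real n) + 4 * ln 2" using assms by simp
  also have "\<dots> \<le> ln (real n) + 4" using ln_2_less_1 by simp
  finally show ?thesis .
qed

text \<open>Legendre's formula from above has \<open>1 / (p - 1)\<close> in place of
  \<open>1 / p\<close>. The difference, \<open>ln p / (p * (p - 1))\<close>, is dominated by a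
  convergent series whose sum enters the constant.\<close>

lemma mertens_lower:
  obtains C :: real where "\<And>n. n \<ge> 1 \<Longrightarrow>
    ln (real n) - C \<le> (\<Sum>p | prime p \<and> p \<le> n. ln (real p) / real p)"
proof -
  define f where "f = (\<lambda>n::nat. 4 * real n powr (-(3/2)))"
  have sumf: "summable f" unfolding f_def by (intro summable_mult) (simp add: summable_real_powr_iff)
  have main: "ln (real n) - (1 + suminf f) \<le> (\<Sum>p | prime p \<and> p \<le> n. ln (real p) / real p)" if n: "n \<ge> 1" for n
  proof -
    let ?P = "{p. prime p \<and> p \<le> n}"
    have le: "ln (real p) / real (p - 1) \<le> ln (real p) / real p + f p" if "p \<in> ?P" for p
    proof -
      have p2: "p \<ge> 2" using that by (auto intro: prime_ge_2_nat)
      have "ln (real p) / real (p - 1) - ln (real p) / real p = ln (real p) / (real p * (real p - 1))"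
        using p2 by (simp add: field_simps of_nat_diff)
      also have "\<dots> \<le> ln (real p) / (real p * (real p / 2))"
        using p2 by (intro divide_left_mono mult_left_mono mult_pos_pos) auto
      also have "\<dots> = 2 * ln (real p) / real p ^ 2" by (simp add: power2_eq_square)
      also have "\<dots> \<le> 4 * real p powr (1/2) / real p ^ 2"
        using p2 ln_powr_bound[of "real p" "1/2"] by (intro divide_right_mono) auto
      also have "real p ^ 2 = real p powr 2" using p2 by (simp add: powr_numeral)
      also have "4 * real p powr (1/2) / real p powr 2 = f p"
          unfolding f_def using powr_diff[of "real p" "1/2" 2] by simp
      finally show ?thesis by simp
    qed
    have "real n * ln (real n) - real n \<le> (\<Sum>p\<in>?P. real (multiplicity p (fact n :: nat)) * ln (real p))"
      using ln_fact_ge[of n] by (simp add: ln_fact_eq_sum_primes)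
    also have "\<dots> \<le> (\<Sum>p\<in>?P. real n / real (p - 1) * ln (real p))"
      by (intro sum_mono mult_right_mono multiplicity_fact_le) (use prime_ge_1_nat in auto)
    also have "\<dots> = real n * (\<Sum>p\<in>?P. ln (real p) / real (p - 1))" by (simp add: sum_distrib_left)
    finally have "real n * (ln (real n) - 1) \<le> real n * (\<Sum>p\<in>?P. ln (real p) / real (p - 1))"
      by (simp only: right_diff_distrib mult_1_right)
    then have "ln (real n) - 1 \<le> (\<Sum>p\<in>?P. ln (real p) / real (p - 1))"
      using n by (simp only: mult_le_cancel_left_pos of_nat_0_less_iff)
    also have "\<dots> \<le> (\<Sum>p\<in>?P. ln (real p) / real p + f p)" by (intro sum_mono le) auto
    also have "\<dots> = (\<Sum>p\<in>?P. ln (real p) / real p) + sum f ?P" by (simp add: sum.distrib)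
    also have "sum f ?P \<le> suminf f" by (rule sum_le_suminf[OF sumf]) (auto simp: f_def)
    finally show ?thesis by simp
  qed
  show ?thesis by (rule that[OF main])
qed

section \<open>Mertens products and sums of reciprocals of primes\<close>

definition mertens_prod :: "nat \<Rightarrow> real" where
  "mertens_prod n = (\<Prod>p | prime p \<and> p \<le> n. 1 - 1 / real p)"

lemma finite_primes_le [simp]: "finite {p::nat. prime p \<and> p \<le> n}"
  by (rule finite_subset[of _ "{..n}"]) auto

lemma mertens_prod_pos: "mertens_prod n > 0"
  unfolding mertens_prod_def by (intro prod_pos) (auto dest: prime_gt_1_nat)

lemma mertens_prod_le_1: "mertens_prod n \<le> 1"
  unfolding mertens_prod_def by (intro prod_le_1) (auto dest: prime_gt_1_nat)

lemma sum_primes_split: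
  fixes f :: "nat \<Rightarrow> real"
  assumes "m \<le> n"
  shows "(\<Sum>p | prime p \<and> p \<le> n. f p) =
    (\<Sum>p | prime p \<and> p \<le> m. f p) + (\<Sum>p | prime p \<and> m < p \<and> p \<le> n. f p)"
proof -
  have "{p. prime p \<and> p \<le> n} = {p. prime p \<and> p \<le> m} \<union> {p. prime p \<and> m < p \<and> p \<le> n}"
    using assms by auto
  moreover have "finite {p. prime p \<and> m < p \<and> p \<le> n}"
    by (rule finite_subset[of _ "{..n}"]) auto
  ultimately show ?thesis by (simp only:) (subst sum.union_disjoint; auto)
qed

text \<open>For \<open>p > n\<close> one has \<open>1 / p \<le> (ln p / p) / ln n\<close>, and
  Mertens' first theorem up to \<open>n^2\<close> gives about \<open>2 ln n\<close>. So squaring the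
  range adds a constant. Repeated squaring from 2 replaces partial summation and yields a doubly
  logarithmic bound.\<close>

lemma sum_inverse_primes_square:
  assumes "n \<ge> 2"
  shows "(\<Sum>p | prime p \<and> p \<le> n\<^sup>2. 1 / real p) \<le> (\<Sum>p | prime p \<and> p \<le> n. 1 / real p) + 8"
proof -
  have nn: "n \<le> n\<^sup>2" using assms by (simp add: power2_eq_square)
  have n2: "ln (real n) \<ge> 2 / 3"
    using ln_mono[of 2 "real n"] assms ln2_ge_two_thirds by linarith
  let ?I = "{p. prime p \<and> n < p \<and> p \<le> n\<^sup>2}"
  have "ln (real n) * (\<Sum>p\<in>?I. 1 / real p) = (\<Sum>p\<in>?I. ln (real n) / real p)"
    by (simp add: sum_distrib_left)
  also have "\<dots> \<le> (\<Sum>p\<in>?I. ln (real p) / real p)"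
    using assms by (intro sum_mono divide_right_mono) auto
  also have "\<dots> \<le> (\<Sum>p | prime p \<and> p \<le> n\<^sup>2. ln (real p) / real p)"
    by (intro sum_mono2) (auto dest: prime_gt_1_nat)
  also have "\<dots> \<le> ln (real (n\<^sup>2)) + 4" using assms by (intro mertens_upper) simp
  also have "\<dots> = 2 * ln (real n) + 4" using assms by (simp add: ln_realpow)
  also have "\<dots> \<le> ln (real n) * 8" using n2 by simp
  finally have "(\<Sum>p\<in>?I. 1 / real p) \<le> 8" using n2 by (simp only: mult_le_cancel_left_pos)
  then show ?thesis using sum_primes_split[OF nn, of "\<lambda>p. 1 / real p"] by simp
qed

lemma sum_inverse_primes_pow2_pow2:
  "(\<Sum>p | prime p \<and> p \<le> 2 ^ 2 ^ k. 1 / real p) \<le> 1 + 8 * real k"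
proof (induction k)
  case 0
  have "{p::nat. prime p \<and> p \<le> 2} = {2}" by (auto dest: prime_ge_2_nat)
  then show ?case by simp
next
  case (Suc k)
  have "(2::nat) ^ 2 ^ k \<ge> 2 ^ 1" by (intro power_increasing) auto
  from sum_inverse_primes_square[of "2 ^ 2 ^ k"] this show ?case
    using Suc.IH by (simp add: power_mult[symmetric] mult.commute)
qed

lemma sum_inverse_primes_le:
  assumes "n \<ge> 2"
  shows "(\<Sum>p | prime p \<and> p \<le> n. 1 / real p) \<le> 17 + 16 * ln (ln (real n) / ln 2)"
proof -
  define k where "k = nat \<lceil>log 2 (log 2 (real n))\<rceil>"
  have l1: "log 2 (real n) \<ge> 1" using assms by simp
  have "log 2 (log 2 (real n)) \<le> real k" unfolding k_def by linarith
  then have "log 2 (real n) \<le> 2 powr (real k)" using l1 by (subst (asm) log_le_iff) auto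
  then have "log 2 (real n) \<le> real (2 ^ k)" by (simp add: powr_realpow)
  then have "real n \<le> 2 powr (real (2 ^ k))" using assms by (subst (asm) log_le_iff) auto
  then have "real n \<le> 2 ^ 2 ^ k" by (simp only: powr_realpow zero_less_numeral)
  then have n: "n \<le> 2 ^ 2 ^ k" by (metis of_nat_le_iff of_nat_numeral of_nat_power)
  have "(\<Sum>p | prime p \<and> p \<le> n. 1 / real p) \<le> (\<Sum>p | prime p \<and> p \<le> 2 ^ 2 ^ k. 1 / real p)"
    using n by (intro sum_mono2) auto
  also have "\<dots> \<le> 1 + 8 * real k" by (rule sum_inverse_primes_pow2_pow2)
  also have "real k \<le> log 2 (log 2 (real n)) + 1"
    using l1 unfolding k_def by (simp add: of_nat_nat)
  also have "log 2 (log 2 (real n)) \<le> 2 * ln (log 2 (real n))"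
  proof -
    have "ln (log 2 (real n)) * 1 \<le> ln (log 2 (real n)) * (2 * ln 2)"
      using l1 ln2_ge_two_thirds by (intro mult_left_mono) auto
    then show ?thesis by (simp add: log_def[of 2 "log 2 (real n)"] field_simps)
  qed
  finally show ?thesis by (simp add: log_def)
qed

text \<open>A crude form of Mertens' third theorem, with exponent 32 before rounding up. Any fixed
  power of \<open>ln n\<close> is affordable, because it is compared only with \<open>lam\<close>
  and with powers of \<open>ln x\<close>.\<close>

lemma mertens_prod_ge:
  obtains C :: nat where "\<And>n. n \<ge> 3 \<Longrightarrow> 1 / mertens_prod n \<le> real C * ln (real n) ^ C"
proof -
  have main: "1 / mertens_prod n \<le> real (nat \<lceil>exp (50::real)\<rceil>) * ln (real n) ^ nat \<lceil>exp (50::real)\<rceil>" if n: "n \<ge> 3" for n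
  proof -
    let ?P = "{p. prime p \<and> p \<le> n}"
    have l: "ln (real n) \<ge> 1"
    proof -
      have "exp 1 \<le> real n" using n exp_le by linarith
      then show ?thesis using n by (subst ln_ge_iff) auto
    qed
    have "1 / (1 - 1 / real p) \<le> exp (2 * (1 / real p))" if "p \<in> ?P" for p
    proof -
      have p2: "real p \<ge> 2" using that by (auto dest: prime_ge_2_nat)
      have "1 / (1 - 1 / real p) \<le> 1 + 2 * (1 / real p)" using p2 by (simp add: field_simps)
      also have "\<dots> \<le> exp (2 * (1 / real p))" by (rule exp_ge_add_one_self)
      finally show ?thesis .
    qed
    then have "(\<Prod>p\<in>?P. 1 / (1 - 1 / real p)) \<le> (\<Prod>p\<in>?P. exp (2 * (1 / real p)))"
      by (intro prod_mono) (auto dest: prime_gt_1_nat)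
    also have "\<dots> = exp (2 * (\<Sum>p\<in>?P. 1 / real p))"
      by (simp add: exp_sum[symmetric] sum_distrib_left)
    also have "\<dots> \<le> exp (34 + 32 * ln (ln (real n) / ln 2))"
      using sum_inverse_primes_le[of n] n by simp
    also have "\<dots> = exp (34 - 32 * ln (ln 2)) * ln (real n) ^ 32"
      using l by (simp add: ln_div exp_add exp_diff right_diff_distrib exp_of_nat_mult[of 32, simplified])
    \<comment> \<open>\<open>exp 50\<close> dominates both the factor, because
      \<open>- ln (ln 2) \<le> 1/2\<close>, and the exponent 32, so that one number serves for
      both.\<close>
    also have "\<dots> \<le> real (nat \<lceil>exp (50::real)\<rceil>) * ln (real n) ^ nat \<lceil>exp (50::real)\<rceil>"
    proof (intro mult_mono power_increasing l)
      have "ln (1 / ln 2) \<le> 1 / ln 2 - (1::real)" by (intro ln_le_minus_one) simp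
      also have "\<dots> \<le> 1 / (2 / 3) - 1" using ln2_ge_two_thirds by (intro diff_right_mono divide_left_mono) auto
      finally have "- ln (ln 2) \<le> (1/2::real)" by (simp add: ln_div)
      then have "34 - 32 * ln (ln 2) \<le> (50::real)" by simp
      then have "exp (34 - 32 * ln (ln 2)) \<le> exp (50::real)" by simp
      then show "exp (34 - 32 * ln (ln 2)) \<le> real (nat \<lceil>exp (50::real)\<rceil>)" by linarith
      have "(50::real) + 1 \<le> exp 50" using exp_ge_add_one_self[of "50::real"] by simp
      then show "32 \<le> nat \<lceil>exp (50::real)\<rceil>" by linarith
    qed (use l exp_gt_zero[of "50::real"] in \<open>auto simp del: exp_gt_zero intro: less_trans[of "-1" 0]\<close>)
    finally show ?thesis by (simp add: mertens_prod_def prod_dividef)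
  qed
  show ?thesis by (rule that[OF main])
qed

text \<open>Subtracting Mertens' first theorem at the two ends leaves
  \<open>\<epsilon> * ln z + O(1)\<close> for the sum of \<open>ln p / p\<close>, and in this range
  \<open>ln p\<close> stays between \<open>(1 - \<epsilon>) * ln z\<close> and
  \<open>ln z\<close>.\<close>

lemma sum_inverse_primes_interval:
  fixes \<epsilon> :: real
  assumes "0 < \<epsilon>" "\<epsilon> < 1/4"
  shows "\<forall>\<^sub>F z in at_top.
    \<epsilon> / 2 \<le> (\<Sum>p | prime p \<and> z powr (1 - \<epsilon>) < real p \<and> real p \<le> z. 1 / real p) \<and>
    (\<Sum>p | prime p \<and> z powr (1 - \<epsilon>) < real p \<and> real p \<le> z. 1 / real p) \<le> 1"
proof -
  obtain C where C: "\<And>n. n \<ge> 1 \<Longrightarrow>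
    ln (real n) - C \<le> (\<Sum>p | prime p \<and> p \<le> n. ln (real p) / real p)" using mertens_lower by blast
  have ev: "\<forall>\<^sub>F z::real in at_top. z \<ge> 4 \<and> z powr (1 - \<epsilon>) \<ge> 4 \<and>
     ln z - ln 2 - C - (1 - \<epsilon>) * ln z - 4 \<ge> \<epsilon> / 2 * ln z \<and>
     ln z + 4 - ((1 - \<epsilon>) * ln z - ln 2 - C) \<le> (1 - \<epsilon>) * ln z"
    using assms by (intro eventually_conj) real_asymp+
  show ?thesis using ev
  proof (rule eventually_mono)
    fix z :: real
    assume z: "z \<ge> 4 \<and> z powr (1 - \<epsilon>) \<ge> 4 \<and>
     ln z - ln 2 - C - (1 - \<epsilon>) * ln z - 4 \<ge> \<epsilon> / 2 * ln z \<and>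
     ln z + 4 - ((1 - \<epsilon>) * ln z - ln 2 - C) \<le> (1 - \<epsilon>) * ln z"
    define w where "w = z powr (1 - \<epsilon>)"
    define m where "m = nat \<lfloor>w\<rfloor>"
    define n where "n = nat \<lfloor>z\<rfloor>"
    let ?I = "{p. prime p \<and> w < real p \<and> real p \<le> z}"
    have w: "4 \<le> w" "w \<le> z" using z assms powr_mono[of "1 - \<epsilon>" 1 z] by (auto simp: w_def)
    have lw: "ln w = (1 - \<epsilon>) * ln z" using z by (simp add: w_def ln_powr)
    have I: "?I = {p. prime p \<and> m < p \<and> p \<le> n}" using w unfolding m_def n_def by (auto; linarith)
    have mn: "m \<le> n" "m \<ge> 1" using w unfolding m_def n_def by linarith+
    have fl: "ln z - ln 2 \<le> ln (real n)" "ln (real n) \<le> ln z" "ln w - ln 2 \<le> ln (real m)" "ln (real m) \<le> ln w"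
    proof -
      have "z / 2 \<le> real n" "real n \<le> z" "w / 2 \<le> real m" "real m \<le> w" using w unfolding m_def n_def by linarith+
      then have "ln (z / 2) \<le> ln (real n)" "ln (real n) \<le> ln z" "ln (w / 2) \<le> ln (real m)" "ln (real m) \<le> ln w"
        using w mn by (auto intro!: ln_mono)
      then show "ln z - ln 2 \<le> ln (real n)" "ln (real n) \<le> ln z" "ln w - ln 2 \<le> ln (real m)" "ln (real m) \<le> ln w"
        using w by (auto simp: ln_div)
    qed
    define S where "S = (\<lambda>n. \<Sum>p | prime p \<and> p \<le> n. ln (real p) / real p)"
    have split: "(\<Sum>p\<in>?I. ln (real p) / real p) = S n - S m"
      unfolding I S_def using sum_primes_split[OF mn(1), of "\<lambda>p. ln (real p) / real p"] by simp
    have b: "ln (real n) - C \<le> S n" "S n \<le> ln (real n) + 4" "ln (real m) - C \<le> S m" "S m \<le> ln (real m) + 4"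
      unfolding S_def using mn by (auto intro!: C mertens_upper)
    have lz: "ln z > 0" using z by simp
    have "\<epsilon> / 2 * ln z \<le> S n - S m" using b fl z lw by linarith
    also have "\<dots> \<le> (\<Sum>p\<in>?I. ln z * (1 / real p))"
      unfolding split[symmetric] by (intro sum_mono) (auto intro!: divide_right_mono ln_mono dest: prime_gt_0_nat)
    finally have "ln z * (\<epsilon> / 2) \<le> ln z * (\<Sum>p\<in>?I. 1 / real p)"
      by (simp only: sum_distrib_left mult.commute)
    then have 1: "\<epsilon> / 2 \<le> (\<Sum>p\<in>?I. 1 / real p)"
      using lz by (simp only: mult_le_cancel_left_pos)
    have "ln w * (\<Sum>p\<in>?I. 1 / real p) \<le> (\<Sum>p\<in>?I. ln (real p) / real p)"
      unfolding sum_distrib_left using w by (intro sum_mono) (auto intro!: divide_right_mono)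
    also have "\<dots> \<le> (1 - \<epsilon>) * ln z" unfolding split using b fl z lw by linarith
    finally have "ln w * (\<Sum>p\<in>?I. 1 / real p) \<le> ln w * 1" by (simp add: lw)
    then have 2: "(\<Sum>p\<in>?I. 1 / real p) \<le> 1" using w by (simp only: mult_le_cancel_left_pos ln_gt_zero)
    show "\<epsilon> / 2 \<le> (\<Sum>p | prime p \<and> z powr (1 - \<epsilon>) < real p \<and> real p \<le> z. 1 / real p) \<and>
    (\<Sum>p | prime p \<and> z powr (1 - \<epsilon>) < real p \<and> real p \<le> z. 1 / real p) \<le> 1"
      using 1 2 by (simp add: w_def)
  qed
qed

section \<open>Sieving an initial interval\<close>

definition frac_ratio :: "real \<Rightarrow> real" where
  "frac_ratio w = frac w / w"

text \<open>A subset \<open>D\<close> stands for the squarefree number \<open>d\<close> with these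
  prime factors, and the sign for the Moebius function. With \<open>Y = e^v\<close> the sum is
  \<open>1/Y\<close> times the sum of \<open>\<mu>(d) {Y/d}\<close>, the amount per unit length by
  which Legendre's sieve falls short of its main term. Through \<open>frac_ratio\<close> every term
  becomes a translate, in \<open>v\<close>, of one function.\<close>

definition sieve_defect :: "nat set \<Rightarrow> real \<Rightarrow> real" where
  "sieve_defect Q v =
     (\<Sum>D\<in>Pow Q. (-1) ^ card D * (\<Prod>p\<in>D. 1 / real p) * frac_ratio (exp v / real (\<Prod>D)))"

lemma sum_Pow_insert:
  assumes "finite Q" "p \<notin> Q"
  shows "(\<Sum>D\<in>Pow (insert p Q). f D) = (\<Sum>D\<in>Pow Q. f D) + (\<Sum>D\<in>Pow Q. f (insert p D))"
proof -
  have "inj_on (insert p) (Pow Q)" using assms(2) by (auto simp: inj_on_def)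
  then have "(\<Sum>D\<in>insert p ` Pow Q. f D) = (\<Sum>D\<in>Pow Q. f (insert p D))"
    by (simp add: sum.reindex)
  moreover have "(\<Sum>D\<in>Pow Q \<union> insert p ` Pow Q. f D) =
     (\<Sum>D\<in>Pow Q. f D) + (\<Sum>D\<in>insert p ` Pow Q. f D)"
    using assms by (intro sum.union_disjoint) auto
  ultimately show ?thesis by (simp add: Pow_insert)
qed

lemma sum_Pow_sign_prod:
  fixes g :: "'a \<Rightarrow> 'b :: comm_ring_1"
  assumes "finite Q"
  shows "(\<Sum>D\<in>Pow Q. (-1) ^ card D * (\<Prod>p\<in>D. g p)) = (\<Prod>p\<in>Q. 1 - g p)"
  using assms
proof (induction Q rule: finite_induct)
  case (insert p Q)
  have "(\<Sum>D\<in>Pow Q. (-1) ^ card (insert p D) * (\<Prod>p\<in>insert p D. g p)) =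
    (\<Sum>D\<in>Pow Q. - g p * ((-1) ^ card D * (\<Prod>p\<in>D. g p)))"
  proof (intro sum.cong refl)
    fix D assume "D \<in> Pow Q"
    then have "finite D" "p \<notin> D" using insert by (auto intro: finite_subset)
    then show "(-1) ^ card (insert p D) * (\<Prod>p\<in>insert p D. g p) = - g p * ((-1) ^ card D * (\<Prod>p\<in>D. g p))"
      by (simp add: mult_ac)
  qed
  also have "\<dots> = - g p * (\<Sum>D\<in>Pow Q. (-1) ^ card D * (\<Prod>p\<in>D. g p))"
    by (simp only: sum_distrib_left)
  finally show ?case using insert by (simp add: sum_Pow_insert algebra_simps)
qed simp

lemma sum_Pow_prod:
  fixes g :: "'a \<Rightarrow> 'b :: comm_ring_1"
  assumes "finite Q"
  shows "(\<Sum>D\<in>Pow Q. \<Prod>p\<in>D. g p) = (\<Prod>p\<in>Q. 1 + g p)"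
proof -
  have "(\<Prod>p\<in>Q. 1 + g p) = (\<Sum>D\<in>Pow Q. (-1) ^ card D * (\<Prod>p\<in>D. - g p))"
    using sum_Pow_sign_prod[OF assms, of "\<lambda>p. - g p"] by simp
  also have "\<dots> = (\<Sum>D\<in>Pow Q. \<Prod>p\<in>D. g p)"
    by (intro sum.cong refl) (simp add: prod_uminus power_mult_distrib[symmetric] mult.assoc[symmetric])
  finally show ?thesis by simp
qed

text \<open>Legendre's identity: among the survivors of \<open>Q\<close>, those divisible by
  \<open>p\<close> are \<open>p\<close> times the survivors of \<open>Q\<close> up to
  \<open>Y / p\<close>.\<close>

lemma card_sieved:
  fixes Q :: "nat set"
  assumes "finite Q" "\<And>p. p \<in> Q \<Longrightarrow> prime p" "Y \<ge> 0"
  shows "real (card {n. 1 \<le> n \<and> real n \<le> Y \<and> (\<forall>p\<in>Q. \<not> p dvd n)}) =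
    (\<Sum>D\<in>Pow Q. (-1) ^ card D * real_of_int \<lfloor>Y / real (\<Prod>D)\<rfloor>)"
  using assms
proof (induction Q arbitrary: Y rule: finite_induct)
  case empty
  have "{n. 1 \<le> n \<and> real n \<le> Y} = {1..nat \<lfloor>Y\<rfloor>}"
    using empty by (auto simp: le_nat_iff le_floor_iff)
  then show ?case using empty by simp
next
  case (insert p Q)
  let ?S = "\<lambda>Q Y. {n::nat. 1 \<le> n \<and> real n \<le> Y \<and> (\<forall>p\<in>Q. \<not> p dvd n)}"
  have p: "prime p" "p > 0" using insert by (auto intro: prime_gt_0_nat)
  have fin: "finite (?S Q Y)" for Q Y
    by (rule finite_subset[of _ "{..nat \<lfloor>Y\<rfloor>}"]) (auto simp: le_nat_iff le_floor_iff)
  have disj: "\<not> q dvd p * n \<longleftrightarrow> \<not> q dvd n" if "q \<in> Q" for q n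
  proof -
    have "prime q" "q \<noteq> p" using that insert by auto
    then have "\<not> q dvd p" using p(1) primes_dvd_imp_eq by blast
    then show ?thesis using \<open>prime q\<close> by (simp add: prime_dvd_mult_iff)
  qed
  have "?S Q Y = ?S (insert p Q) Y \<union> (\<lambda>n. p * n) ` ?S Q (Y / real p)"
  proof (intro equalityI subsetI)
    fix n assume n: "n \<in> ?S Q Y"
    show "n \<in> ?S (insert p Q) Y \<union> (\<lambda>n. p * n) ` ?S Q (Y / real p)"
    proof (cases "p dvd n")
      case True
      then obtain k where k: "n = p * k" by auto
      have "k \<in> ?S Q (Y / real p)" using n p disj unfolding k by (auto simp: field_simps)
      then show ?thesis using k by auto
    qed (use n in auto)
  next
    fix n assume "n \<in> ?S (insert p Q) Y \<union> (\<lambda>n. p * n) ` ?S Q (Y / real p)"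
    then show "n \<in> ?S Q Y" using p disj by (auto simp: field_simps)
  qed
  then have "card (?S Q Y) = card (?S (insert p Q) Y \<union> (\<lambda>n. p * n) ` ?S Q (Y / real p))" by simp
  also have "\<dots> = card (?S (insert p Q) Y) + card ((\<lambda>n. p * n) ` ?S Q (Y / real p))"
    by (intro card_Un_disjoint finite_imageI fin) auto
  also have "card ((\<lambda>n. p * n) ` ?S Q (Y / real p)) = card (?S Q (Y / real p))"
    using p by (intro card_image) (auto simp: inj_on_def)
  finally have "real (card (?S (insert p Q) Y)) = real (card (?S Q Y)) - real (card (?S Q (Y / real p)))"
    by simp
  also have "real (card (?S Q Y)) = (\<Sum>D\<in>Pow Q. (-1) ^ card D * real_of_int \<lfloor>Y / real (\<Prod>D)\<rfloor>)"
    using insert by blast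
  also have "real (card (?S Q (Y / real p))) =
     (\<Sum>D\<in>Pow Q. (-1) ^ card D * real_of_int \<lfloor>(Y / real p) / real (\<Prod>D)\<rfloor>)"
    using insert by (intro insert.IH) auto
  also have "\<dots> = - (\<Sum>D\<in>Pow Q. (-1) ^ card (insert p D) * real_of_int \<lfloor>Y / real (\<Prod>(insert p D))\<rfloor>)"
    unfolding sum_negf[symmetric]
  proof (intro sum.cong refl)
    fix D assume "D \<in> Pow Q"
    then have "finite D" "p \<notin> D" using insert by (auto intro: finite_subset)
    then show "(-1) ^ card D * real_of_int \<lfloor>(Y / real p) / real (\<Prod>D)\<rfloor> =
       - ((-1) ^ card (insert p D) * real_of_int \<lfloor>Y / real (\<Prod>(insert p D))\<rfloor>)"
      by (simp add: mult.assoc)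
  qed
  finally show ?case using insert by (simp add: sum_Pow_insert)
qed

lemma card_sieved_eq_defect:
  fixes Q :: "nat set"
  assumes "finite Q" "\<And>p. p \<in> Q \<Longrightarrow> prime p"
  shows "real (card {n. 1 \<le> n \<and> real n \<le> exp v \<and> (\<forall>p\<in>Q. \<not> p dvd n)}) =
    exp v * ((\<Prod>p\<in>Q. 1 - 1 / real p) - sieve_defect Q v)"
proof -
  have "(\<Sum>D\<in>Pow Q. (-1) ^ card D * real_of_int \<lfloor>exp v / real (\<Prod>D)\<rfloor>) =
    (\<Sum>D\<in>Pow Q. exp v * ((-1) ^ card D * (\<Prod>p\<in>D. 1 / real p)) -
      exp v * ((-1) ^ card D * (\<Prod>p\<in>D. 1 / real p) * frac_ratio (exp v / real (\<Prod>D))))"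
  proof (intro sum.cong refl)
    fix D assume D: "D \<in> Pow Q"
    have "real (\<Prod>D) > 0" unfolding of_nat_prod using D assms by (intro prod_pos) (auto intro!: prime_gt_0_nat assms(2))
    moreover have "(\<Prod>p\<in>D. 1 / real p) = 1 / real (\<Prod>D)" by (simp add: prod_dividef)
    ultimately show "(-1) ^ card D * real_of_int \<lfloor>exp v / real (\<Prod>D)\<rfloor> =
      exp v * ((-1) ^ card D * (\<Prod>p\<in>D. 1 / real p)) -
      exp v * ((-1) ^ card D * (\<Prod>p\<in>D. 1 / real p) * frac_ratio (exp v / real (\<Prod>D)))"
      by (simp only:) (simp add: frac_ratio_def frac_def field_simps)
  qed
  also have "\<dots> = exp v * (\<Sum>D\<in>Pow Q. (-1) ^ card D * (\<Prod>p\<in>D. 1 / real p)) - exp v * sieve_defect Q v"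
    unfolding sieve_defect_def by (simp only: sum_subtractf sum_distrib_left)
  also have "\<dots> = exp v * ((\<Prod>p\<in>Q. 1 - 1 / real p) - sieve_defect Q v)"
    using assms(1) by (simp add: sum_Pow_sign_prod algebra_simps)
  finally show ?thesis using card_sieved[OF assms, of "exp v"] by simp
qed

lemma frac_ratio_nonneg: "w \<ge> 0 \<Longrightarrow> frac_ratio w \<ge> 0"
  by (simp add: frac_ratio_def)

text \<open>Interpolates between \<open>{w} \<le> w\<close> and \<open>{w} < 1\<close>; the free
  exponent \<open>t\<close> is what Rankin's trick needs.\<close>

lemma frac_ratio_le:
  assumes "w > 0" "0 \<le> t" "t \<le> 1"
  shows "frac_ratio w \<le> w powr (- t)"
proof (cases "w \<le> 1")
  case True
  have "frac w \<le> w" using assms by (simp add: frac_def)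
  then have "frac_ratio w \<le> 1" using assms by (simp add: frac_ratio_def)
  also have "1 = w powr 0" using assms by simp
  also have "\<dots> \<le> w powr (- t)" using True assms by (intro powr_mono') auto
  finally show ?thesis .
next
  case False
  have "frac_ratio w \<le> 1 / w" unfolding frac_ratio_def using assms frac_lt_1[of w] by (intro divide_right_mono) auto
  also have "\<dots> = w powr (- 1)" using assms by (simp add: powr_minus_divide)
  also have "\<dots> \<le> w powr (- t)" using False assms by (intro powr_mono) auto
  finally show ?thesis .
qed

text \<open>Rankin's trick: with the exponent \<open>t\<close> the bound for a term is
  multiplicative in \<open>D\<close>, so the absolute values add up to \<open>exp (- t v)\<close>
  times the product of \<open>1 + p^(t-1)\<close>.\<close>

lemma sieve_defect_bound:
  fixes Q :: "nat set"
  assumes "finite Q" "\<And>p. p \<in> Q \<Longrightarrow> p > 0" "0 \<le> t" "t \<le> 1"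
  shows "\<bar>sieve_defect Q v\<bar> \<le> exp ((\<Sum>p\<in>Q. real p powr (t - 1)) - t * v)"
proof -
  have "\<bar>sieve_defect Q v\<bar> \<le> (\<Sum>D\<in>Pow Q. exp (- t * v) * (\<Prod>p\<in>D. real p powr (t - 1)))"
    unfolding sieve_defect_def
  proof (rule order_trans[OF sum_abs], intro sum_mono)
    fix D assume D: "D \<in> Pow Q"
    have pos: "real (\<Prod>D) > 0" unfolding of_nat_prod using D assms by (intro prod_pos) auto
    have "\<bar>(-1) ^ card D * (\<Prod>p\<in>D. 1 / real p) * frac_ratio (exp v / real (\<Prod>D))\<bar> =
      (\<Prod>p\<in>D. 1 / real p) * frac_ratio (exp v / real (\<Prod>D))"
      using pos by (simp add: abs_mult power_abs frac_ratio_nonneg abs_prod)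
    also have "\<dots> \<le> (\<Prod>p\<in>D. 1 / real p) * (exp v / real (\<Prod>D)) powr (- t)"
      using assms pos by (intro mult_left_mono frac_ratio_le prod_nonneg) auto
    also have "(exp v / real (\<Prod>D)) powr (- t) = exp (- t * v) * (\<Prod>p\<in>D. real p powr t)"
    proof -
      have "(exp v / real (\<Prod>D)) powr (- t) = exp v powr (- t) * real (\<Prod>D) powr t"
        using pos by (simp add: powr_divide powr_minus field_simps)
      also have "real (\<Prod>D) powr t = (\<Prod>p\<in>D. real p powr t)"
        unfolding of_nat_prod by (rule prod_powr_distrib)
      finally show ?thesis by (simp add: powr_def)
    qed
    also have "(\<Prod>p\<in>D. 1 / real p) * (exp (- t * v) * (\<Prod>p\<in>D. real p powr t)) =
       exp (- t * v) * (\<Prod>p\<in>D. 1 / real p * real p powr t)"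
      by (simp only: prod.distrib mult_ac)
    also have "(\<Prod>p\<in>D. 1 / real p * real p powr t) = (\<Prod>p\<in>D. real p powr (t - 1))"
      using D assms by (intro prod.cong) (auto simp: powr_diff)
    finally show "\<bar>(-1) ^ card D * (\<Prod>p\<in>D. 1 / real p) * frac_ratio (exp v / real (\<Prod>D))\<bar> \<le>
      exp (- t * v) * (\<Prod>p\<in>D. real p powr (t - 1))" .
  qed
  also have "\<dots> = exp (- t * v) * (\<Prod>p\<in>Q. 1 + real p powr (t - 1))"
    using assms(1) by (simp add: sum_distrib_left[symmetric] sum_Pow_prod)
  also have "\<dots> \<le> exp (- t * v) * (\<Prod>p\<in>Q. exp (real p powr (t - 1)))"
    by (intro mult_left_mono prod_mono) (auto simp: exp_ge_add_one_self)
  also have "\<dots> = exp ((\<Sum>p\<in>Q. real p powr (t - 1)) - t * v)"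
    using assms(1) by (simp add: exp_sum[symmetric] exp_add[symmetric] algebra_simps exp_diff exp_minus field_simps)
  finally show ?thesis .
qed

lemma has_bochner_integral_exp_atLeast:
  fixes a c :: real
  assumes "a > 0"
  shows "has_bochner_integral lborel (\<lambda>v. indicator {c..} v * exp (- a * v)) (exp (- a * c) / a)"
proof (rule has_bochner_integral_nn_integral)
  have "((\<lambda>v. if v \<in> {c..} then exp (- a * v) else 0) has_integral exp (- a * c) / a) UNIV"
    using has_integral_exp_minus_to_infinity[OF assms, of c] by (simp only: has_integral_restrict_UNIV)
  also have "(\<lambda>v. if v \<in> {c..} then exp (- a * v) else 0) = (\<lambda>v. indicator {c..} v * exp (- a * v))"
    by (auto simp: indicator_def)
  finally have "((\<lambda>v. indicator {c..} v * exp (- a * v)) has_integral exp (- a * c) / a) UNIV" .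
  then show "(\<integral>\<^sup>+ v. ennreal (indicator {c..} v * exp (- a * v)) \<partial>lborel) = ennreal (exp (- a * c) / a)"
    by (intro nn_integral_has_integral_lborel) (auto simp: indicator_def)
qed (use assms in \<open>auto simp: indicator_def\<close>)

lemma has_bochner_integral_exp_atMost:
  fixes a c :: real
  assumes "a > 0"
  shows "has_bochner_integral lborel (\<lambda>v. indicator {..c} v * exp (a * v)) (exp (a * c) / a)"
proof -
  have "has_bochner_integral lborel (\<lambda>v. indicator {-c..} (0 + (-1) * v) * exp (- a * (0 + (-1) * v)))
     ((exp (- a * (- c)) / a) /\<^sub>R \<bar>- 1\<bar>)"
    using has_bochner_integral_exp_atLeast[OF assms, of "-c"]
    by (subst (asm) lborel_has_bochner_integral_real_affine_iff[of "-1" _ _ 0]) auto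
  moreover have "(\<lambda>v. indicator {-c..} (0 + (-1) * v) * exp (- a * (0 + (-1) * v))) =
    (\<lambda>v. indicator {..c} v * exp (a * v) :: real)"
    by (auto simp: indicator_def)
  ultimately show ?thesis by simp
qed

section \<open>The Mellin transform of the sieve defect\<close>

text \<open>With \<open>w = e^v\<close> this is the integral of \<open>{w} w^(s-2)\<close> over the
  positive reals, that is, \<open>- zeta(1 - s) / (1 - s)\<close> for \<open>0 < Re s < 1\<close>.
  What matters below is its pole at \<open>s = 0\<close>.\<close>

definition mellin_frac :: "complex \<Rightarrow> complex" where
  "mellin_frac s = (\<integral>v. of_real (frac_ratio (exp v)) * exp (s * of_real v) \<partial>lborel)"

lemma measurable_frac_ratio [measurable]: "frac_ratio \<in> borel_measurable borel"
  unfolding frac_ratio_def frac_def by measurable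

lemma frac_ratio_exp_ge_0: "frac_ratio (exp v) \<ge> 0"
  by (simp add: frac_ratio_nonneg)

lemma frac_ratio_exp_le: "frac_ratio (exp v) \<le> 1" "frac_ratio (exp v) \<le> exp (- v)"
  using frac_ratio_le[of "exp v" 0] frac_ratio_le[of "exp v" 1] by (auto simp: powr_def)

lemma frac_ratio_exp_neg: "v < 0 \<Longrightarrow> frac_ratio (exp v) = 1"
  by (simp add: frac_ratio_def frac_eq[THEN iffD2])

lemma integrable_mellin_frac:
  assumes "0 < Re s" "Re s < 1"
  shows "integrable lborel (\<lambda>v. of_real (frac_ratio (exp v)) * exp (s * complex_of_real v))"
proof (rule Bochner_Integration.integrable_bound)
  show "integrable lborel (\<lambda>v. indicator {..0} v * exp (Re s * v) + indicator {0..} v * exp (- (1 - Re s) * v) :: real)"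
    using has_bochner_integral_exp_atMost[of "Re s" 0] has_bochner_integral_exp_atLeast[of "1 - Re s" 0] assms
    by (auto intro!: Bochner_Integration.integrable_add simp: has_bochner_integral_iff)
  show "AE v in lborel. norm (of_real (frac_ratio (exp v)) * exp (s * complex_of_real v))
     \<le> norm (indicator {..0} v * exp (Re s * v) + indicator {0..} v * exp (- (1 - Re s) * v) :: real)"
  proof (intro AE_I2)
    fix v :: real
    have "norm (of_real (frac_ratio (exp v)) * exp (s * complex_of_real v)) = frac_ratio (exp v) * exp (Re s * v)"
      by (simp add: norm_mult norm_exp_eq_Re frac_ratio_exp_ge_0)
    also have "\<dots> \<le> indicator {..0} v * exp (Re s * v) + indicator {0..} v * exp (- (1 - Re s) * v)"
    proof (cases "v \<le> 0")
      case True
      have "frac_ratio (exp v) * exp (Re s * v) \<le> 1 * exp (Re s * v)"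
        by (intro mult_right_mono frac_ratio_exp_le) auto
      then show ?thesis using True by (auto simp: indicator_def)
    next
      case False
      have "frac_ratio (exp v) * exp (Re s * v) \<le> exp (- v) * exp (Re s * v)"
        by (intro mult_right_mono frac_ratio_exp_le) auto
      also have "\<dots> = exp (- (1 - Re s) * v)" by (simp add: exp_add[symmetric] algebra_simps)
      finally show ?thesis using False by (auto simp: indicator_def)
    qed
    finally show "norm (of_real (frac_ratio (exp v)) * exp (s * complex_of_real v))
     \<le> norm (indicator {..0} v * exp (Re s * v) + indicator {0..} v * exp (- (1 - Re s) * v) :: real)"
      by simp
  qed
qed measurable

lemma integral_exp_neg_half_line:
  assumes "0 < Re s"
  shows "(\<integral>v. indicator {..<0} v *\<^sub>R exp (s * complex_of_real v) \<partial>lborel) = 1 / s"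
proof -
  have s0: "s \<noteq> 0" using assms by auto
  have int: "set_integrable lborel (einterval (-\<infinity>) 0) (\<lambda>v. exp (s * complex_of_real v))"
    unfolding set_integrable_def
  proof (rule Bochner_Integration.integrable_bound)
    show "integrable lborel (\<lambda>v. indicator {..0} v * exp (Re s * v) :: real)"
      using has_bochner_integral_exp_atMost[OF assms, of 0] by (auto simp: has_bochner_integral_iff)
  qed (auto simp: indicator_def norm_exp_eq_Re einterval_def)
  have "(LBINT v=-\<infinity>..0. exp (s * complex_of_real v)) = 1 / s - 0"
  proof (rule interval_integral_FTC_integrable[where F = "\<lambda>v. exp (s * complex_of_real v) / s"])
    fix x :: real
    show "((\<lambda>v. exp (s * complex_of_real v) / s) has_vector_derivative exp (s * complex_of_real x)) (at x)"
    proof -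
      have "((\<lambda>v. exp (s * v) / s) has_field_derivative exp (s * complex_of_real x)) (at (complex_of_real x))"
        using s0 by (auto intro!: derivative_eq_intros)
      from has_vector_derivative_real_field[OF this] show ?thesis by simp
    qed
    show "isCont (\<lambda>v. exp (s * complex_of_real v)) x" by (intro continuous_intros)
  next
    have "((\<lambda>v. exp (s * complex_of_real v) / s) \<longlongrightarrow> 0) at_bot"
    proof (rule tendsto_norm_zero_cancel)
      have "((\<lambda>v. exp (a * v) / b) \<longlongrightarrow> 0) at_bot" if "a > 0" "b > 0" for a b :: real
        using that by real_asymp
      from this[of "Re s" "norm s"] have "((\<lambda>v. exp (Re s * v) / norm s) \<longlongrightarrow> 0) at_bot"
        using assms s0 by simp
      then show "((\<lambda>v. norm (exp (s * complex_of_real v) / s)) \<longlongrightarrow> 0) at_bot"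
        by (simp add: norm_divide norm_exp_eq_Re)
    qed
    then show "(((\<lambda>v. exp (s * complex_of_real v) / s) \<circ> real_of_ereal) \<longlongrightarrow> 0) (at_right (-\<infinity>))"
      by (simp add: ereal_tendsto_simps)
    have "((\<lambda>v. exp (s * complex_of_real v) / s) \<longlongrightarrow> exp (s * complex_of_real 0) / s) (at_left 0)"
      by (intro tendsto_intros) (use s0 in auto)
    then show "(((\<lambda>v. exp (s * complex_of_real v) / s) \<circ> real_of_ereal) \<longlongrightarrow> 1 / s) (at_left 0)"
      by (simp add: ereal_tendsto_simps zero_ereal_def)
  qed (use int in auto)
  then show ?thesis
    by (simp add: interval_lebesgue_integral_def set_lebesgue_integral_def einterval_def lessThan_def zero_ereal_def)
qed

text \<open>For \<open>v < 0\<close> the integrand is exactly \<open>exp (s v)\<close> and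
  contributes \<open>1 / s\<close>; for \<open>v \<ge> 0\<close> the bound
  \<open>frac_ratio (exp v) \<le> exp (- v)\<close> leaves at most \<open>1 / (1 - Re s)\<close>.
  Near \<open>s = 0\<close> the first part dominates.\<close>

lemma norm_mellin_frac_ge:
  assumes "0 < Re s" "Re s < 1"
  shows "norm (mellin_frac s) \<ge> 1 / norm s - 1 / (1 - Re s)"
proof -
  let ?f = "\<lambda>v. of_real (frac_ratio (exp v)) * exp (s * complex_of_real v)"
  have int: "integrable lborel ?f" by (rule integrable_mellin_frac[OF assms])
  have i1: "integrable lborel (\<lambda>v. indicator {..<0} v *\<^sub>R ?f v)" "integrable lborel (\<lambda>v. indicator {0..} v *\<^sub>R ?f v)"
    using int by (auto intro!: integrable_mult_indicator)
  have "mellin_frac s = (\<integral>v. indicator {..<0} v *\<^sub>R ?f v + indicator {0..} v *\<^sub>R ?f v \<partial>lborel)"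
    unfolding mellin_frac_def by (intro Bochner_Integration.integral_cong) (auto simp: indicator_def)
  also have "\<dots> = (\<integral>v. indicator {..<0} v *\<^sub>R ?f v \<partial>lborel) + (\<integral>v. indicator {0..} v *\<^sub>R ?f v \<partial>lborel)"
    using i1 by (rule Bochner_Integration.integral_add)
  also have "(\<integral>v. indicator {..<0} v *\<^sub>R ?f v \<partial>lborel) = (\<integral>v. indicator {..<0} v *\<^sub>R exp (s * complex_of_real v) \<partial>lborel)"
    by (intro Bochner_Integration.integral_cong) (auto simp: indicator_def frac_ratio_exp_neg)
  also have "\<dots> = 1 / s" by (rule integral_exp_neg_half_line) (rule assms)
  finally have eq: "mellin_frac s = 1 / s + (\<integral>v. indicator {0..} v *\<^sub>R ?f v \<partial>lborel)" .
  have hb: "has_bochner_integral lborel (\<lambda>v. indicator {0..} v * exp (- (1 - Re s) * v)) (1 / (1 - Re s))"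
    using has_bochner_integral_exp_atLeast[of "1 - Re s" 0] assms by simp
  have "norm (\<integral>v. indicator {0..} v *\<^sub>R ?f v \<partial>lborel) \<le> (\<integral>v. norm (indicator {0..} v *\<^sub>R ?f v) \<partial>lborel)"
    by (rule integral_norm_bound)
  also have "\<dots> \<le> (\<integral>v. indicator {0..} v * exp (- (1 - Re s) * v) \<partial>lborel)"
  proof (rule integral_mono)
    fix v :: real
    have "frac_ratio (exp v) * exp (Re s * v) \<le> exp (- v) * exp (Re s * v)"
      by (intro mult_right_mono frac_ratio_exp_le) auto
    also have "\<dots> = exp (- (1 - Re s) * v)" by (simp add: exp_add[symmetric] algebra_simps)
    finally show "norm (indicator {0..} v *\<^sub>R ?f v) \<le> indicator {0..} v * exp (- (1 - Re s) * v)"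
      by (simp add: norm_mult norm_exp_eq_Re frac_ratio_exp_ge_0 indicator_def)
  qed (use integrable_norm[OF i1(2)] hb in \<open>simp_all only: has_bochner_integral_iff\<close>)
  also have "\<dots> = 1 / (1 - Re s)" using hb by (simp add: has_bochner_integral_iff)
  finally have "norm (\<integral>v. indicator {0..} v *\<^sub>R ?f v \<partial>lborel) \<le> 1 / (1 - Re s)" .
  then show ?thesis
    using norm_diff_ineq[of "1 / s" "\<integral>v. indicator {0..} v *\<^sub>R ?f v \<partial>lborel"] eq by (simp add: norm_divide)
qed

lemma mellin_frac_shift:
  assumes "0 < Re s" "Re s < 1" "d > 0"
  shows "has_bochner_integral lborel (\<lambda>v. of_real (frac_ratio (exp v / d)) * exp (s * complex_of_real v))
    (exp (s * of_real (ln d)) * mellin_frac s)"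
proof -
  let ?f = "\<lambda>v. of_real (frac_ratio (exp v)) * exp (s * complex_of_real v)"
  have "has_bochner_integral lborel ?f (mellin_frac s)"
    unfolding mellin_frac_def by (rule has_bochner_integral_integrable) (rule integrable_mellin_frac[OF assms(1,2)])
  then have "has_bochner_integral lborel (\<lambda>v. ?f (- ln d + 1 * v)) (mellin_frac s /\<^sub>R \<bar>1\<bar>)"
    by (subst (asm) lborel_has_bochner_integral_real_affine_iff[of 1 _ _ "- ln d"]) auto
  then have "has_bochner_integral lborel (\<lambda>v. exp (s * of_real (ln d)) * ?f (- ln d + 1 * v))
    (exp (s * of_real (ln d)) * (mellin_frac s /\<^sub>R \<bar>1\<bar>))"
    by (rule has_bochner_integral_mult_right)
  moreover have "exp (s * of_real (ln d)) * ?f (- ln d + 1 * v) = of_real (frac_ratio (exp v / d)) * exp (s * complex_of_real v)" for v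
  proof -
    have "exp (- ln d + 1 * v) = exp v / d" using assms(3) by (simp add: exp_add exp_minus exp_diff field_simps)
    moreover have "exp (s * of_real (ln d)) * exp (s * complex_of_real (- ln d + 1 * v)) = exp (s * complex_of_real v)"
      by (simp add: exp_add[symmetric] algebra_simps)
    ultimately show ?thesis by (metis mult.left_commute)
  qed
  ultimately show ?thesis by simp
qed

text \<open>Each \<open>D\<close> translates the variable by \<open>ln d\<close>, which multiplies
  the transform by \<open>d^s\<close>. Together with the weight \<open>1 / d\<close> this is
  multiplicative, and the signed sum over \<open>Pow Q\<close> becomes an Euler product.\<close>

lemma sieve_defect_mellin:
  fixes Q :: "nat set"
  assumes "finite Q" "\<And>p. p \<in> Q \<Longrightarrow> p > 0" "0 < Re s" "Re s < 1"
  shows "has_bochner_integral lborel (\<lambda>v. of_real (sieve_defect Q v) * exp (s * complex_of_real v))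
    (mellin_frac s * (\<Prod>p\<in>Q. 1 - exp ((s - 1) * of_real (ln (real p)))))"
proof -
  let ?c = "\<lambda>D. (-1) ^ card D * (\<Prod>p\<in>D. 1 / of_nat p) :: complex"
  have "has_bochner_integral lborel (\<lambda>v. \<Sum>D\<in>Pow Q. ?c D * (of_real (frac_ratio (exp v / real (\<Prod>D))) * exp (s * complex_of_real v)))
    (\<Sum>D\<in>Pow Q. ?c D * (exp (s * of_real (ln (real (\<Prod>D)))) * mellin_frac s))"
  proof (intro has_bochner_integral_sum has_bochner_integral_mult_right mellin_frac_shift assms)
    fix D assume "D \<in> Pow Q"
    then show "real (\<Prod>D) > 0" unfolding of_nat_prod using assms by (intro prod_pos) auto
  qed
  moreover have "(\<lambda>v. \<Sum>D\<in>Pow Q. ?c D * (of_real (frac_ratio (exp v / real (\<Prod>D))) * exp (s * complex_of_real v))) =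
     (\<lambda>v. of_real (sieve_defect Q v) * exp (s * complex_of_real v))"
    by (simp add: sieve_defect_def sum_distrib_right mult.assoc)
  moreover have "(\<Sum>D\<in>Pow Q. ?c D * (exp (s * of_real (ln (real (\<Prod>D)))) * mellin_frac s)) =
     mellin_frac s * (\<Sum>D\<in>Pow Q. (-1) ^ card D * (\<Prod>p\<in>D. exp ((s - 1) * of_real (ln (real p)))))"
    unfolding sum_distrib_left
  proof (intro sum.cong refl)
    fix D assume D: "D \<in> Pow Q"
    then have fin: "finite D" using assms by (auto intro: finite_subset)
    have pos: "real p > 0" if "p \<in> D" for p using that D assms by auto
    have "ln (real (\<Prod>D)) = (\<Sum>p\<in>D. ln (real p))"
      unfolding of_nat_prod using fin pos by (intro ln_prod) auto
    then have "exp (s * of_real (ln (real (\<Prod>D)))) = (\<Prod>p\<in>D. exp (s * of_real (ln (real p))))"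
      using fin by (simp add: sum_distrib_left exp_sum)
    then have "(\<Prod>p\<in>D. 1 / of_nat p) * exp (s * of_real (ln (real (\<Prod>D)))) =
      (\<Prod>p\<in>D. 1 / of_nat p * exp (s * of_real (ln (real p))))" by (simp only: prod.distrib)
    also have "\<dots> = (\<Prod>p\<in>D. exp ((s - 1) * of_real (ln (real p))))"
    proof (intro prod.cong refl)
      fix p assume "p \<in> D"
      have "exp (complex_of_real (ln (real p))) = of_nat p"
        using pos[OF \<open>p \<in> D\<close>] by (simp add: exp_of_real)
      then show "1 / of_nat p * exp (s * complex_of_real (ln (real p))) = exp ((s - 1) * of_real (ln (real p)))"
        by (simp add: left_diff_distrib exp_diff)
    qed
    finally have *: "(\<Prod>p\<in>D. 1 / of_nat p) * exp (s * of_real (ln (real (\<Prod>D)))) =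
      (\<Prod>p\<in>D. exp ((s - 1) * of_real (ln (real p))))" .
    have "?c D * (exp (s * of_real (ln (real (\<Prod>D)))) * mellin_frac s) =
      mellin_frac s * ((-1) ^ card D * ((\<Prod>p\<in>D. 1 / of_nat p) * exp (s * of_real (ln (real (\<Prod>D))))))"
      by (simp only: mult_ac)
    then show "?c D * (exp (s * of_real (ln (real (\<Prod>D)))) * mellin_frac s) =
      mellin_frac s * ((-1) ^ card D * (\<Prod>p\<in>D. exp ((s - 1) * of_real (ln (real p)))))"
      unfolding * .
  qed
  ultimately show ?thesis using assms(1) by (simp add: sum_Pow_sign_prod)
qed


text \<open>
  The integral of \<open>F v = sieve_defect Q v * exp (\<tau> v)\<close> is nonnegative, so that of \<open>\<bar>F\<bar> + F\<close>, twice the positive part,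
  is at least the modulus of the transform at \<open>\<tau> + i t\<close>.  Outside \<open>[v1, v2]\<close> Rankin's bound is used with the
  exponents \<open>\<tau> + h\<close> and \<open>\<tau> - h\<close>.
\<close>

lemma sieve_defect_lower:
  fixes Q :: "nat set" and \<tau> t h v1 v2 m :: real
  assumes Q: "finite Q" "\<And>p. p \<in> Q \<Longrightarrow> p > 0"
    and \<tau>: "0 < h" "h \<le> \<tau>" "\<tau> + h < 1" and v: "v1 \<le> v2" and m: "0 \<le> m"
    and le: "\<And>v. v1 \<le> v \<Longrightarrow> v \<le> v2 \<Longrightarrow> sieve_defect Q v \<le> m"
  shows "norm (mellin_frac (Complex \<tau> t)) *
      norm (\<Prod>p\<in>Q. 1 - exp ((Complex \<tau> t - 1) * of_real (ln (real p)))) \<le>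
    2 * exp ((\<Sum>p\<in>Q. real p powr (\<tau> + h - 1)) - h * v2) / h +
    2 * exp ((\<Sum>p\<in>Q. real p powr (\<tau> - h - 1)) + h * v1) / h +
    2 * m * exp (\<tau> * v2) * (v2 - v1)"
proof -
  define F where "F = (\<lambda>v. sieve_defect Q v * exp (\<tau> * v))"
  define A where "A = exp (\<Sum>p\<in>Q. real p powr (\<tau> + h - 1))"
  define B where "B = exp (\<Sum>p\<in>Q. real p powr (\<tau> - h - 1))"
  have \<tau>': "0 < \<tau>" "\<tau> < 1" using \<tau> by auto
  have Re: "Re (Complex \<tau> t) = \<tau>" by simp
  note I1 = sieve_defect_mellin[OF Q, of "of_real \<tau>"]
  note It = sieve_defect_mellin[OF Q, of "Complex \<tau> t"]
  have e1: "of_real (sieve_defect Q v) * exp (of_real \<tau> * complex_of_real v) = of_real (F v)" for v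
    by (simp add: F_def exp_of_real flip: of_real_mult)
  have F: "integrable lborel F"
    using I1 \<tau>' e1 by (simp add: has_bochner_integral_iff complex_of_real_integrable_eq)
  have mf: "mellin_frac (of_real \<tau>) = of_real (\<integral>v. frac_ratio (exp v) * exp (\<tau> * v) \<partial>lborel)"
    unfolding mellin_frac_def by (simp add: exp_of_real flip: of_real_mult integral_of_real)
  have "exp ((complex_of_real \<tau> - 1) * of_real (ln (real p))) = of_real (exp ((\<tau> - 1) * ln (real p)))" for p
    by (simp flip: exp_of_real)
  then have "of_real (\<integral>v. F v \<partial>lborel) = complex_of_real ((\<integral>v. frac_ratio (exp v) * exp (\<tau> * v) \<partial>lborel) *
       (\<Prod>p\<in>Q. 1 - exp ((\<tau> - 1) * ln (real p))))"
    using I1 \<tau>' by (simp add: has_bochner_integral_iff e1 mf)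
  then have "(\<integral>v. F v \<partial>lborel) = (\<integral>v. frac_ratio (exp v) * exp (\<tau> * v) \<partial>lborel) *
       (\<Prod>p\<in>Q. 1 - exp ((\<tau> - 1) * ln (real p)))"
    by (simp only: of_real_eq_iff)
  moreover have "(\<integral>v. frac_ratio (exp v) * exp (\<tau> * v) \<partial>lborel) \<ge> 0"
    by (intro Bochner_Integration.integral_nonneg) (simp add: frac_ratio_exp_ge_0)
  moreover have "(\<Prod>p\<in>Q. 1 - exp ((\<tau> - 1) * ln (real p))) \<ge> 0"
  proof (intro prod_nonneg)
    fix p assume "p \<in> Q"
    then have "ln (real p) \<ge> 0" using Q(2)[of p] by simp
    then have "(\<tau> - 1) * ln (real p) \<le> 0" using \<tau>' by (intro mult_nonpos_nonneg) auto
    then show "0 \<le> 1 - exp ((\<tau> - 1) * ln (real p))" by simp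
  qed
  ultimately have F0: "(\<integral>v. F v \<partial>lborel) \<ge> 0" by simp
  have "norm (mellin_frac (Complex \<tau> t) * (\<Prod>p\<in>Q. 1 - exp ((Complex \<tau> t - 1) * of_real (ln (real p))))) =
    norm (\<integral>v. of_real (sieve_defect Q v) * exp (Complex \<tau> t * complex_of_real v) \<partial>lborel)"
    using It \<tau>' Re by (simp add: has_bochner_integral_iff)
  also have "\<dots> \<le> (\<integral>v. norm (of_real (sieve_defect Q v) * exp (Complex \<tau> t * complex_of_real v)) \<partial>lborel)"
    by (rule integral_norm_bound)
  also have "\<dots> = (\<integral>v. \<bar>F v\<bar> \<partial>lborel)"
    by (intro Bochner_Integration.integral_cong) (auto simp: F_def norm_mult norm_exp_eq_Re abs_mult)
  also have "\<dots> \<le> (\<integral>v. \<bar>F v\<bar> \<partial>lborel) + (\<integral>v. F v \<partial>lborel)" using F0 by simp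
  also have "\<dots> = (\<integral>v. \<bar>F v\<bar> + F v \<partial>lborel)"
    using F by (intro Bochner_Integration.integral_add[symmetric]) auto
  also have "\<dots> \<le> (\<integral>v. 2 * A * (indicator {v2..} v * exp (- h * v)) + 2 * B * (indicator {..v1} v * exp (h * v))
      + 2 * m * exp (\<tau> * v2) * indicator {v1..v2} v \<partial>lborel)"
  proof (rule integral_mono)
    show "integrable lborel (\<lambda>v. \<bar>F v\<bar> + F v)" using F by auto
    show "integrable lborel (\<lambda>v. 2 * A * (indicator {v2..} v * exp (- h * v)) + 2 * B * (indicator {..v1} v * exp (h * v))
      + 2 * m * exp (\<tau> * v2) * indicator {v1..v2} v)"
      using has_bochner_integral_exp_atLeast[OF \<tau>(1), of v2] has_bochner_integral_exp_atMost[OF \<tau>(1), of v1]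
      by (intro Bochner_Integration.integrable_add Bochner_Integration.integrable_mult_right)
         (auto simp: has_bochner_integral_iff emeasure_lborel_Icc_eq intro!: integrable_real_indicator)
    fix v :: real
    have right: "\<bar>F v\<bar> + F v \<le> 2 * A * exp (- h * v)"
    proof -
      have "\<bar>F v\<bar> \<le> exp ((\<Sum>p\<in>Q. real p powr (\<tau> + h - 1)) - (\<tau> + h) * v) * exp (\<tau> * v)"
        unfolding F_def abs_mult using sieve_defect_bound[OF Q, of "\<tau> + h" v] \<tau>
        by (simp add: mult_right_mono)
      also have "\<dots> = A * exp (- h * v)" by (simp add: A_def exp_add[symmetric] algebra_simps)
      finally show ?thesis by simp
    qed
    have left: "\<bar>F v\<bar> + F v \<le> 2 * B * exp (h * v)"
    proof -
      have "\<bar>F v\<bar> \<le> exp ((\<Sum>p\<in>Q. real p powr (\<tau> - h - 1)) - (\<tau> - h) * v) * exp (\<tau> * v)"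
        unfolding F_def abs_mult using sieve_defect_bound[OF Q, of "\<tau> - h" v] \<tau>
        by (simp add: mult_right_mono)
      also have "\<dots> = B * exp (h * v)" by (simp add: B_def exp_add[symmetric] algebra_simps)
      finally show ?thesis by simp
    qed
    have AB: "A > 0" "B > 0" by (auto simp: A_def B_def)
    consider "v < v1" | "v > v2" | "v1 \<le> v" "v \<le> v2" by linarith
    then show "\<bar>F v\<bar> + F v \<le> 2 * A * (indicator {v2..} v * exp (- h * v)) + 2 * B * (indicator {..v1} v * exp (h * v))
      + 2 * m * exp (\<tau> * v2) * indicator {v1..v2} v"
    proof cases
      case 3
      \<comment> \<open>Only an upper bound for \<open>F\<close> is at hand here, and it suffices:
        where \<open>F\<close> is negative, \<open>\<bar>F\<bar> + F\<close> vanishes.\<close>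
      have "\<bar>F v\<bar> + F v \<le> 2 * (m * exp (\<tau> * v2))"
      proof (cases "F v \<ge> 0")
        case True
        have "F v \<le> m * exp (\<tau> * v)" unfolding F_def using le[OF 3] by (intro mult_right_mono) auto
        also have "\<dots> \<le> m * exp (\<tau> * v2)" using 3 \<tau>' m by (intro mult_left_mono) auto
        finally show ?thesis using True by simp
      qed (use m in simp)
      also have "\<dots> \<le> 2 * A * (indicator {v2..} v * exp (- h * v)) + 2 * B * (indicator {..v1} v * exp (h * v))
      + 2 * m * exp (\<tau> * v2) * indicator {v1..v2} v" using 3 AB by simp
      finally show ?thesis .
    qed (use left right v AB in \<open>simp_all\<close>)
  qed
  also have "\<dots> = 2 * A * (exp (- h * v2) / h) + 2 * B * (exp (h * v1) / h) + 2 * m * exp (\<tau> * v2) * (v2 - v1)"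
  proof (rule has_bochner_integral_integral_eq)
    have "has_bochner_integral lborel (indicator {v1..v2} :: real \<Rightarrow> real) (v2 - v1)"
      using v has_bochner_integral_real_indicator[of "{v1..v2}" lborel] by simp
    then show "has_bochner_integral lborel (\<lambda>v. 2 * A * (indicator {v2..} v * exp (- h * v)) + 2 * B * (indicator {..v1} v * exp (h * v))
      + 2 * m * exp (\<tau> * v2) * indicator {v1..v2} v)
      (2 * A * (exp (- h * v2) / h) + 2 * B * (exp (h * v1) / h) + 2 * m * exp (\<tau> * v2) * (v2 - v1))"
      by (intro has_bochner_integral_add has_bochner_integral_mult_right
           has_bochner_integral_exp_atLeast[OF \<tau>(1), of v2] has_bochner_integral_exp_atMost[OF \<tau>(1), of v1])
  qed
  finally show ?thesis by (simp add: norm_mult A_def B_def exp_diff exp_add exp_minus field_simps)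
qed

section \<open>A short interval with few survivors\<close>

lemma cos_ge_quadratic: "cos (x::real) \<ge> 1 - x\<^sup>2 / 2"
proof -
  have "cos x = 1 - 2 * (sin (x / 2))\<^sup>2" using cos_double_sin[of "x/2"] by simp
  moreover have "(sin (x / 2))\<^sup>2 \<le> (x / 2)\<^sup>2" using abs_sin_x_le_abs_x[of "x/2"] by (simp only: abs_le_square_iff)
  ultimately show ?thesis by (simp add: power_divide)
qed

lemma norm_one_minus_cis_ge:
  fixes a \<theta> \<epsilon> :: real
  assumes "a \<ge> 0" "0 \<le> \<epsilon>" "\<epsilon> \<le> 1" "pi * (1 - \<epsilon>) \<le> \<theta>" "\<theta> \<le> pi"
  shows "norm (1 - of_real a * cis \<theta>) \<ge> 1 + a * cos (pi * \<epsilon>)"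
proof -
  have "cos \<theta> \<le> cos (pi * (1 - \<epsilon>))" using assms by (intro cos_monotone_0_pi_le) auto
  also have "pi * (1 - \<epsilon>) = pi - pi * \<epsilon>" by (simp add: algebra_simps)
  finally have "cos \<theta> \<le> - cos (pi * \<epsilon>)" by (simp add: cos_diff)
  then have "a * cos \<theta> \<le> a * - cos (pi * \<epsilon>)" using assms by (intro mult_left_mono) auto
  then have "1 + a * cos (pi * \<epsilon>) \<le> Re (1 - of_real a * cis \<theta>)" by simp
  also have "\<dots> \<le> norm (1 - of_real a * cis \<theta>)" by (rule complex_Re_le_cmod)
  finally show ?thesis .
qed

text \<open>At height \<open>pi / ln z\<close> the phases of all \<open>p\<close> in
  \<open>Q\<close> lie in \<open>[pi (1 - \<epsilon>), pi]\<close>, so each factor is at least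
  \<open>1 + c p^(\<tau>-1)\<close> with \<open>c = cos (pi \<epsilon>)\<close>. The loss
  \<open>1 - c\<close> is quadratic in \<open>\<epsilon>\<close>, at most
  \<open>8 \<epsilon>^2\<close> because \<open>pi < 4\<close>; this lets the product win against
  Rankin's bounds. The hypothesis on squares pays for
  \<open>ln (1 + x) \<ge> x - x^2\<close>.\<close>

lemma norm_mellin_product_ge:
  fixes Q :: "nat set" and \<tau> \<epsilon> z U :: real
  assumes Q: "finite Q" "\<And>p. p \<in> Q \<Longrightarrow> 0 < p \<and> z powr (1 - \<epsilon>) \<le> real p \<and> real p \<le> z"
    and \<epsilon>: "0 < \<epsilon>" "\<epsilon> \<le> 1 / 100" and z: "z > 1" and \<tau>: "\<tau> \<le> 1"
    and U: "(\<Sum>p\<in>Q. real p powr (\<tau> - 1)) = U"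
    and sq: "(\<Sum>p\<in>Q. real p powr (2 * (\<tau> - 1))) \<le> 1"
  shows "exp (U * (1 - 8 * \<epsilon>\<^sup>2) - 1) \<le>
    norm (\<Prod>p\<in>Q. 1 - exp ((Complex \<tau> (pi / ln z) - 1) * of_real (ln (real p))))"
proof -
  define c where "c = cos (pi * \<epsilon>)"
  have U0: "U \<ge> 0" unfolding U[symmetric] by (intro sum_nonneg) auto
  have lz: "ln z > 0" using z by simp
  have "pi\<^sup>2 \<le> 4\<^sup>2" using pi_less_4 by (intro power_mono) auto
  then have "pi\<^sup>2 * \<epsilon>\<^sup>2 \<le> 16 * \<epsilon>\<^sup>2" by (intro mult_right_mono) auto
  then have c8: "1 - 8 * \<epsilon>\<^sup>2 \<le> c" using cos_ge_quadratic[of "pi * \<epsilon>"] by (simp add: c_def power_mult_distrib)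
  have "\<epsilon>\<^sup>2 \<le> (1 / 100)\<^sup>2" using \<epsilon> by (intro power_mono) auto
  then have c01: "0 \<le> c" "c \<le> 1" using c8 by (auto simp: c_def power2_eq_square)
  have fac: "exp (c * real p powr (\<tau> - 1) - real p powr (2 * (\<tau> - 1))) \<le>
     norm (1 - exp ((Complex \<tau> (pi / ln z) - 1) * of_real (ln (real p))))" if p: "p \<in> Q" for p
  proof -
    let ?a = "real p powr (\<tau> - 1)"
    have p1: "real p \<ge> 1" using Q(2)[OF p] by linarith
    have a1: "0 \<le> ?a" "?a \<le> 1" using p1 \<tau> powr_mono[of "\<tau> - 1" 0 "real p"] by auto
    have "Complex \<tau> (pi / ln z) - 1 = of_real (\<tau> - 1) + \<i> * of_real (pi / ln z)"
      by (simp add: complex_eq_iff)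
    then have "exp ((Complex \<tau> (pi / ln z) - 1) * of_real (ln (real p))) =
       exp (of_real ((\<tau> - 1) * ln (real p))) * exp (\<i> * of_real (pi / ln z * ln (real p)))"
      by (simp add: exp_add[symmetric] algebra_simps)
    also have "exp (complex_of_real ((\<tau> - 1) * ln (real p))) = of_real ?a"
      using p1 by (simp only: exp_of_real) (simp add: powr_def)
    finally have e: "exp ((Complex \<tau> (pi / ln z) - 1) * of_real (ln (real p))) = of_real ?a * cis (pi / ln z * ln (real p))"
      by (simp add: cis_conv_exp)
    have "ln (z powr (1 - \<epsilon>)) \<le> ln (real p)" "ln (real p) \<le> ln z" by (rule ln_mono; use Q(2)[OF p] p1 z in simp)+
    then have l: "(1 - \<epsilon>) * ln z \<le> ln (real p)" "ln (real p) \<le> ln z" using z by (auto simp: ln_powr)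
    have "pi * (1 - \<epsilon>) = pi / ln z * ((1 - \<epsilon>) * ln z)" using lz by simp
    also have "\<dots> \<le> pi / ln z * ln (real p)" using lz by (intro mult_left_mono l) auto
    finally have t1: "pi * (1 - \<epsilon>) \<le> pi / ln z * ln (real p)" .
    have "pi / ln z * ln (real p) \<le> pi / ln z * ln z" using lz by (intro mult_left_mono l) auto
    then have t2: "pi / ln z * ln (real p) \<le> pi" using lz by simp
    have "norm (1 - of_real ?a * cis (pi / ln z * ln (real p))) \<ge> 1 + ?a * c"
      unfolding c_def using \<epsilon> a1 t1 t2 by (intro norm_one_minus_cis_ge) auto
    moreover have "exp (c * ?a - real p powr (2 * (\<tau> - 1))) \<le> 1 + ?a * c"
    proof -
      have x: "0 \<le> c * ?a" "c * ?a \<le> 1" using c01 a1 mult_mono[of c 1 ?a 1] by auto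
      have "(c * ?a)\<^sup>2 \<le> (1 * ?a)\<^sup>2" using c01 a1 by (intro power_mono mult_right_mono) auto
      also have "\<dots> = real p powr (2 * (\<tau> - 1))" by (simp add: power2_eq_square powr_add[symmetric])
      finally have "c * ?a - real p powr (2 * (\<tau> - 1)) \<le> c * ?a - (c * ?a)\<^sup>2" by simp
      also have "\<dots> \<le> ln (1 + c * ?a)" by (rule ln_one_plus_pos_lower_bound[OF x])
      finally have "exp (c * ?a - real p powr (2 * (\<tau> - 1))) \<le> exp (ln (1 + c * ?a))" by simp
      also have "exp (ln (1 + c * ?a)) = 1 + c * ?a" using x by (intro exp_ln) linarith
      finally show ?thesis by (simp add: mult.commute)
    qed
    ultimately show ?thesis unfolding e by linarith
  qed
  have "U * (1 - 8 * \<epsilon>\<^sup>2) - 1 \<le> U * c - (\<Sum>p\<in>Q. real p powr (2 * (\<tau> - 1)))"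
    using mult_left_mono[OF c8 U0] sq by linarith
  also have "\<dots> = (\<Sum>p\<in>Q. c * real p powr (\<tau> - 1) - real p powr (2 * (\<tau> - 1)))"
    by (simp add: U[symmetric] sum_subtractf sum_distrib_left mult.commute)
  finally have "exp (U * (1 - 8 * \<epsilon>\<^sup>2) - 1) \<le> exp (\<Sum>p\<in>Q. c * real p powr (\<tau> - 1) - real p powr (2 * (\<tau> - 1)))"
    by simp
  also have "\<dots> = (\<Prod>p\<in>Q. exp (c * real p powr (\<tau> - 1) - real p powr (2 * (\<tau> - 1))))" using Q(1) by (rule exp_sum)
  also have "\<dots> \<le> (\<Prod>p\<in>Q. norm (1 - exp ((Complex \<tau> (pi / ln z) - 1) * of_real (ln (real p)))))"
    using fac by (intro prod_mono) auto
  finally show ?thesis by (simp add: prod_norm)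
qed

text \<open>The exponent \<open>\<Sum> p^(t-1) - t v\<close> in Rankin's bound is stationary at
  \<open>t = \<tau>\<close> when \<open>v\<close> is close to \<open>U ln z\<close>, so that is
  where the deficiency must concentrate. Were it below the claimed size throughout the window, all
  three terms of \<open>sieve_defect_lower\<close> would be small against \<open>X\<close>, the
  lower bound for the Euler product.\<close>

lemma sieve_defect_large:
  fixes Q :: "nat set" and \<tau> \<epsilon> z U :: real
  assumes Q: "finite Q" "\<And>p. p \<in> Q \<Longrightarrow> 0 < p \<and> z powr (1 - \<epsilon>) \<le> real p \<and> real p \<le> z"
    and \<epsilon>: "0 < \<epsilon>" "\<epsilon> \<le> 1 / 100" and z: "z > 1" and \<tau>: "0 < \<tau>" "\<tau> \<le> 1 / 8"
    and U: "(\<Sum>p\<in>Q. real p powr (\<tau> - 1)) = U" "U > 0"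
    and sq: "(\<Sum>p\<in>Q. real p powr (2 * (\<tau> - 1))) \<le> 1"
    and h: "5 * \<epsilon> \<le> \<tau> * ln z" and t: "pi / ln z \<le> 1 / 8"
    and large: "ln z \<le> \<epsilon> * exp (12 * \<epsilon>\<^sup>2 * U - 1)"
  shows "\<exists>v. U * ln z * (1 - 10 * \<epsilon>) \<le> v \<and> v \<le> U * ln z * (1 + 10 * \<epsilon>) \<and>
    sieve_defect Q v \<ge> exp (- \<tau> * (U * ln z * (1 + 10 * \<epsilon>))) / U"
proof (rule ccontr)
  define v1 where "v1 = U * ln z * (1 - 10 * \<epsilon>)"
  define v2 where "v2 = U * ln z * (1 + 10 * \<epsilon>)"
  define m where "m = exp (- \<tau> * v2) / U"
  \<comment> \<open>Moving the exponent by \<open>h\<close> costs \<open>25 \<epsilon>^2 U\<close>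
    to second order, while the edges of the window, at relative distance
    \<open>10 \<epsilon>\<close>, gain \<open>50 \<epsilon>^2 U\<close>. At least
    \<open>20 \<epsilon>^2 U\<close> remains on both sides, more than the
    \<open>8 \<epsilon>^2 U\<close> lost in the Euler product.\<close>
  define h where "h = 5 * \<epsilon> / ln z"
  have lz: "ln z > 0" using z by simp
  assume "\<not> ?thesis"
  then have le: "sieve_defect Q v \<le> m" if "v1 \<le> v" "v \<le> v2" for v
    using that unfolding v1_def v2_def m_def by force
  have hz: "0 < h" "h \<le> \<tau>" "h * ln z = 5 * \<epsilon>" using lz \<epsilon> h by (auto simp: h_def field_simps)
  have v12: "v1 \<le> v2" using U lz \<epsilon> by (auto simp: v1_def v2_def intro!: mult_left_mono)
  have m0: "m \<ge> 0" using U by (simp add: m_def)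
  define X where "X = exp (U * (1 - 8 * \<epsilon>\<^sup>2) - 1)"
  have e2: "\<epsilon>\<^sup>2 \<le> 1 / 10000" using power_mono[of \<epsilon> "1/100" 2] \<epsilon> by (simp add: power2_eq_square)
  have "norm (Complex \<tau> (pi / ln z)) \<le> \<bar>\<tau>\<bar> + \<bar>pi / ln z\<bar>"
    using cmod_le[of "Complex \<tau> (pi / ln z)"] by simp
  also have "\<dots> = \<tau> + pi / ln z" using \<tau> lz by simp
  also have "\<dots> \<le> 1 / 4" using \<tau> t by linarith
  finally have n4: "norm (Complex \<tau> (pi / ln z)) \<le> 1 / 4" .
  have "Complex \<tau> (pi / ln z) \<noteq> 0" using \<tau> by (auto simp: complex_eq_iff)
  then have "1 / norm (Complex \<tau> (pi / ln z)) \<ge> 1 / (1/4)" using n4 by (intro divide_left_mono) auto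
  moreover have "1 / (1 - \<tau>) \<le> 1 / (1 / 2)" using \<tau> by (intro divide_left_mono) auto
  ultimately have "norm (mellin_frac (Complex \<tau> (pi / ln z))) \<ge> 2"
    using norm_mellin_frac_ge[of "Complex \<tau> (pi / ln z)"] \<tau> by simp
  moreover have "X \<le> norm (\<Prod>p\<in>Q. 1 - exp ((Complex \<tau> (pi / ln z) - 1) * of_real (ln (real p))))"
    unfolding X_def by (rule norm_mellin_product_ge[OF Q \<epsilon> z _ U(1) sq]) (use \<tau> in auto)
  ultimately have "2 * X \<le> norm (mellin_frac (Complex \<tau> (pi / ln z))) *
      norm (\<Prod>p\<in>Q. 1 - exp ((Complex \<tau> (pi / ln z) - 1) * of_real (ln (real p))))"
    by (intro mult_mono) (auto simp: X_def)
  also have "\<dots> \<le> 2 * exp ((\<Sum>p\<in>Q. real p powr (\<tau> + h - 1)) - h * v2) / h +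
    2 * exp ((\<Sum>p\<in>Q. real p powr (\<tau> - h - 1)) + h * v1) / h +
    2 * m * exp (\<tau> * v2) * (v2 - v1)"
    using Q hz \<tau> v12 m0 le by (intro sieve_defect_lower) auto
  also have "2 * exp ((\<Sum>p\<in>Q. real p powr (\<tau> + h - 1)) - h * v2) / h \<le> 2 * exp (U * (1 - 20 * \<epsilon>\<^sup>2)) / h"
  proof -
    have "(\<Sum>p\<in>Q. real p powr (\<tau> + h - 1)) \<le> (\<Sum>p\<in>Q. exp (5 * \<epsilon>) * real p powr (\<tau> - 1))"
    proof (intro sum_mono)
      fix p assume p: "p \<in> Q"
      have "real p powr (\<tau> + h - 1) = real p powr h * real p powr (\<tau> - 1)"
        by (simp add: powr_add[symmetric] algebra_simps)
      also have "real p powr h \<le> z powr h" using Q(2)[OF p] hz by (intro powr_mono2) auto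
      also have "z powr h = exp (5 * \<epsilon>)" using z hz by (simp add: powr_def)
      finally show "real p powr (\<tau> + h - 1) \<le> exp (5 * \<epsilon>) * real p powr (\<tau> - 1)"
        by (simp add: mult_right_mono)
    qed
    also have "\<dots> = U * exp (5 * \<epsilon>)" unfolding U(1)[symmetric] sum_distrib_right by (intro sum.cong refl) simp
    also have "\<dots> \<le> U * (1 + 5 * \<epsilon> + (5 * \<epsilon>)\<^sup>2)"
      using U \<epsilon> by (intro mult_left_mono exp_bound) auto
    finally have "(\<Sum>p\<in>Q. real p powr (\<tau> + h - 1)) - h * v2 \<le> U * (1 + 5 * \<epsilon> + (5 * \<epsilon>)\<^sup>2) - U * (h * ln z) * (1 + 10 * \<epsilon>)"
      by (simp add: v2_def mult_ac)
    also have "\<dots> = U * (1 - 25 * \<epsilon>\<^sup>2)" unfolding hz by (simp add: algebra_simps power2_eq_square)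
    also have "\<dots> \<le> U * (1 - 20 * \<epsilon>\<^sup>2)" using U by (intro mult_left_mono) auto
    finally show ?thesis using hz by (intro divide_right_mono) auto
  qed
  also have "2 * exp ((\<Sum>p\<in>Q. real p powr (\<tau> - h - 1)) + h * v1) / h \<le> 2 * exp (U * (1 - 20 * \<epsilon>\<^sup>2)) / h"
  proof -
    \<comment> \<open>A prime of \<open>Q\<close> may be as small as
      \<open>z^(1-\<epsilon>)\<close>, so lowering the exponent by \<open>h\<close> saves only
      \<open>exp (- 5 \<epsilon> (1 - \<epsilon>))\<close> per term.\<close>
    define x where "x = 5 * \<epsilon> * (1 - \<epsilon>)"
    have x: "0 \<le> x" "x \<le> 5 * \<epsilon>" using \<epsilon> by (auto simp: x_def mult_le_cancel_left1)
    have "(\<Sum>p\<in>Q. real p powr (\<tau> - h - 1)) \<le> (\<Sum>p\<in>Q. exp (- x) * real p powr (\<tau> - 1))"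
    proof (intro sum_mono)
      fix p assume p: "p \<in> Q"
      have "real p powr (\<tau> - h - 1) = real p powr (- h) * real p powr (\<tau> - 1)"
        by (simp add: powr_add[symmetric] algebra_simps)
      also have "real p powr (- h) \<le> (z powr (1 - \<epsilon>)) powr (- h)" using Q(2)[OF p] hz z by (intro powr_mono2') auto
      also have "(z powr (1 - \<epsilon>)) powr (- h) = exp (- x)"
        using z hz by (simp add: powr_powr) (simp add: powr_def x_def algebra_simps)
      finally show "real p powr (\<tau> - h - 1) \<le> exp (- x) * real p powr (\<tau> - 1)"
        by (simp add: mult_right_mono)
    qed
    also have "\<dots> = U * exp (- x)" unfolding U(1)[symmetric] sum_distrib_right by (intro sum.cong refl) simp
    also have "\<dots> \<le> U * (1 - x + x\<^sup>2)"
    proof -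
      have "exp (- x) \<le> 1 / (1 + x)" using x exp_ge_add_one_self[of x] by (simp add: exp_minus inverse_eq_divide field_simps)
      also have "\<dots> \<le> 1 - x + x\<^sup>2"
      proof -
        have "(1 - x + x\<^sup>2) * (1 + x) = 1 + x ^ 3" by (simp add: algebra_simps power2_eq_square power3_eq_cube)
        then show ?thesis using x by (simp add: pos_divide_le_eq)
      qed
      finally show ?thesis using U by (intro mult_left_mono) auto
    qed
    also have "\<dots> \<le> U * (1 - x + (5 * \<epsilon>)\<^sup>2)" using U x by (intro mult_left_mono add_left_mono power_mono) auto
    finally have "(\<Sum>p\<in>Q. real p powr (\<tau> - h - 1)) + h * v1 \<le> U * (1 - x + (5 * \<epsilon>)\<^sup>2) + U * (h * ln z) * (1 - 10 * \<epsilon>)"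
      by (simp add: v1_def mult_ac)
    also have "\<dots> = U * (1 - 20 * \<epsilon>\<^sup>2)" unfolding hz x_def by (simp add: algebra_simps power2_eq_square)
    finally show ?thesis using hz by (intro divide_right_mono) auto
  qed
  \<comment> \<open>The surplus \<open>(20 - 8) \<epsilon>^2 U\<close> absorbs the factor
    \<open>1 / h\<close>; this is the role of the hypothesis \<open>large\<close>.\<close>
  also have "2 * exp (U * (1 - 20 * \<epsilon>\<^sup>2)) / h \<le> 2 / 5 * X"
  proof -
    have "2 * exp (U * (1 - 20 * \<epsilon>\<^sup>2)) / h = 2 / (5 * \<epsilon>) * (exp (U * (1 - 20 * \<epsilon>\<^sup>2)) * ln z)" by (simp add: h_def)
    also have "\<dots> \<le> 2 / (5 * \<epsilon>) * (exp (U * (1 - 20 * \<epsilon>\<^sup>2)) * (\<epsilon> * exp (12 * \<epsilon>\<^sup>2 * U - 1)))"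
      using \<epsilon> large by (intro mult_left_mono) auto
    also have "\<dots> = 2 / 5 * exp (U * (1 - 20 * \<epsilon>\<^sup>2) + (12 * \<epsilon>\<^sup>2 * U - 1))" using \<epsilon> by (simp only: exp_add) (simp add: field_simps)
    also have "\<dots> = 2 / 5 * X" unfolding X_def by (simp add: algebra_simps)
    finally show ?thesis .
  qed
  \<comment> \<open>\<open>m\<close> was chosen so that
    \<open>m * exp (\<tau> * v2) = 1 / U\<close>, which cancels the \<open>U\<close> in the width
    \<open>20 \<epsilon> U ln z\<close> of the window.\<close>
  also have "2 * m * exp (\<tau> * v2) * (v2 - v1) \<le> X / 100"
  proof -
    have "m * exp (\<tau> * v2) = 1 / U"
      using exp_add[of "- \<tau> * v2" "\<tau> * v2"] by (simp add: m_def)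
    then have "2 * m * exp (\<tau> * v2) * (v2 - v1) = 2 / U * (v2 - v1)" by (simp add: mult.assoc)
    also have "\<dots> = 40 * \<epsilon> * ln z" using U by (simp add: v1_def v2_def field_simps)
    also have "\<dots> \<le> 40 * \<epsilon> * (\<epsilon> * exp (12 * \<epsilon>\<^sup>2 * U - 1))" using \<epsilon> large by (intro mult_left_mono) auto
    also have "\<dots> = 40 * \<epsilon>\<^sup>2 * exp (12 * \<epsilon>\<^sup>2 * U - 1)" by (simp add: power2_eq_square)
    also have "\<dots> \<le> 1 / 100 * exp (U * (1 - 8 * \<epsilon>\<^sup>2) - 1)"
    proof (intro mult_mono)
      have "12 * \<epsilon>\<^sup>2 * U \<le> (1 - 8 * \<epsilon>\<^sup>2) * U" using U e2 by (intro mult_right_mono) auto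
      then show "exp (12 * \<epsilon>\<^sup>2 * U - 1) \<le> exp (U * (1 - 8 * \<epsilon>\<^sup>2) - 1)" by (simp add: mult.commute)
    qed (use e2 in auto)
    finally show ?thesis by (simp add: X_def)
  qed
  finally have "2 * X \<le> 2 / 5 * X + 2 / 5 * X + X / 100" by simp
  moreover have "X > 0" by (simp add: X_def)
  ultimately show False by simp
qed

section \<open>From a long interval to one short interval, sieved by all small primes\<close>

text \<open>One integer \<open>m\<close> encodes a choice of residue classes, the class removed
  modulo \<open>p\<close> being that of \<open>- m\<close>. For finitely many primes every choice
  arises in this way, by the Chinese remainder theorem.\<close>

definition sift_count :: "nat set \<Rightarrow> nat \<Rightarrow> nat \<Rightarrow> nat" where
  "sift_count P m y = card {h \<in> {1..y}. \<forall>p\<in>P. \<not> p dvd m + h}"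

text \<open>Cut \<open>{1..e^v}\<close> into blocks of length \<open>y\<close>; some block has at
  most the average number of survivors. Incomplete blocks cost a relative
  \<open>\<delta> / 2\<close>, which is why a defect of \<open>2 \<delta>\<close> is asked for and
  \<open>\<delta>\<close> is delivered.\<close>

lemma sift_count_block:
  fixes Q :: "nat set" and \<delta> v :: real
  assumes Q: "finite Q" "\<And>p. p \<in> Q \<Longrightarrow> prime p" and y: "y \<ge> 1" and \<delta>: "0 < \<delta>" "\<delta> < 1"
    and G: "sieve_defect Q v \<ge> 2 * \<delta>" and v: "4 * real y \<le> \<delta> * exp v"
  shows "\<exists>m. real (sift_count Q m y) \<le> (1 - \<delta>) * (\<Prod>p\<in>Q. 1 - 1 / real p) * real y"
proof -
  define Y where "Y = exp v"
  define J where "J = nat \<lfloor>Y\<rfloor> div y"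
  define W where "W = (\<Prod>p\<in>Q. 1 - 1 / real p)"
  define S where "S = {n. 1 \<le> n \<and> real n \<le> Y \<and> (\<forall>p\<in>Q. \<not> p dvd n)}"
  have Y: "Y > 0" "4 * real y \<le> \<delta> * Y" using v by (auto simp: Y_def)
  have p1: "real p > 1" if "p \<in> Q" for p using prime_gt_1_nat[OF Q(2)[OF that]] by simp
  have W: "0 < W" "W \<le> 1"
    unfolding W_def by (intro prod_pos prod_le_1; use p1 in force)+
  have "real (card S) = Y * (W - sieve_defect Q v)"
    unfolding S_def Y_def W_def by (rule card_sieved_eq_defect[OF Q])
  also have "\<dots> \<le> Y * (W - 2 * \<delta> * W)"
  proof (intro mult_left_mono)
    \<comment> \<open>The defect is relative to the length \<open>Y\<close>, not to the main term
      \<open>W * Y\<close>; since \<open>W \<le> 1\<close> it is at least the same fraction of the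
      main term.\<close>
    have "2 * \<delta> * W \<le> 2 * \<delta> * 1" using W \<delta> by (intro mult_left_mono) auto
    then show "W - sieve_defect Q v \<le> W - 2 * \<delta> * W" using G by linarith
  qed (use Y in simp)
  finally have S: "real (card S) \<le> Y * W * (1 - 2 * \<delta>)" by (simp add: algebra_simps)
  have finS: "finite S"
    by (rule finite_subset[of _ "{..nat \<lfloor>Y\<rfloor>}"]) (auto simp: S_def le_nat_iff le_floor_iff)
  have "real y * 4 \<le> \<delta> * Y" using Y by simp
  also have "\<dots> \<le> 1 * Y" using \<delta> Y by (intro mult_right_mono) auto
  finally have yY: "4 * real y \<le> Y" by simp
  have Jy: "Y - 2 * real y \<le> real J * real y"
  proof -
    have "nat \<lfloor>Y\<rfloor> = J * y + nat \<lfloor>Y\<rfloor> mod y" unfolding J_def by simp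
    moreover have "nat \<lfloor>Y\<rfloor> mod y < y" using y by simp
    ultimately have "nat \<lfloor>Y\<rfloor> \<le> J * y + y" by linarith
    then have "real (nat \<lfloor>Y\<rfloor>) \<le> real (J * y + y)" by (simp only: of_nat_le_iff)
    then have "real (nat \<lfloor>Y\<rfloor>) \<le> real J * real y + real y" by simp
    moreover have "Y - 1 \<le> real (nat \<lfloor>Y\<rfloor>)" using Y by linarith
    moreover have "real y \<ge> 1" using y by simp
    ultimately show ?thesis by linarith
  qed
  have J0: "J > 0" using Jy yY y by (cases "J = 0") auto
  let ?T = "\<lambda>i. {h \<in> {1..y}. \<forall>p\<in>Q. \<not> p dvd i * y + h}"
  have "(\<Sum>i<J. sift_count Q (i * y) y) = (\<Sum>i<J. card ((\<lambda>h. i * y + h) ` ?T i))"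
    unfolding sift_count_def by (intro sum.cong refl card_image[symmetric]) (auto simp: inj_on_def)
  also have "\<dots> = card (\<Union>i<J. (\<lambda>h. i * y + h) ` ?T i)"
  proof (rule card_UN_disjoint[symmetric])
    have disj: "(i::nat) = j" if "i * y + h = j * y + k" "1 \<le> h" "h \<le> y" "1 \<le> k" "k \<le> y" for i j h k :: nat
    proof -
      have "(i * y + (h - 1)) div y = i" "(j * y + (k - 1)) div y = j"
        using that y by (subst div_mult_self3; simp)+
      moreover have "i * y + (h - 1) = j * y + (k - 1)" using that by linarith
      ultimately show ?thesis by metis
    qed
    show "\<forall>i\<in>{..<J}. \<forall>j\<in>{..<J}. i \<noteq> j \<longrightarrow> (\<lambda>h. i * y + h) ` ?T i \<inter> (\<lambda>h. j * y + h) ` ?T j = {}"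
    proof (intro ballI impI)
      fix i j :: nat assume "i \<noteq> j"
      then show "(\<lambda>h. i * y + h) ` ?T i \<inter> (\<lambda>h. j * y + h) ` ?T j = {}"
        using disj[of i _ j] by auto
    qed
  qed auto
  also have "\<dots> \<le> card S"
  proof (rule card_mono[OF finS], rule subsetI)
    fix n assume "n \<in> (\<Union>i<J. (\<lambda>h. i * y + h) ` ?T i)"
    then obtain i h where i: "i < J" "n = i * y + h" "1 \<le> h" "h \<le> y" "\<forall>p\<in>Q. \<not> p dvd n" by auto
    have "n \<le> Suc i * y" using i by simp
    also have "\<dots> \<le> J * y" using i by (intro mult_le_mono1) simp
    also have "\<dots> \<le> nat \<lfloor>Y\<rfloor>" unfolding J_def by (rule div_times_less_eq_dividend)
    finally have "real n \<le> Y" using Y(1) by linarith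
    then show "n \<in> S" using i by (auto simp: S_def)
  qed
  finally have sum: "(\<Sum>i<J. sift_count Q (i * y) y) \<le> card S" .
  have "\<exists>i<J. J * sift_count Q (i * y) y \<le> card S"
  proof (rule ccontr)
    assume "\<not> ?thesis"
    then have "(\<Sum>i<J. card S) < (\<Sum>i<J. J * sift_count Q (i * y) y)"
      using J0 by (intro sum_strict_mono) auto
    also have "\<dots> = J * (\<Sum>i<J. sift_count Q (i * y) y)" by (simp add: sum_distrib_left)
    also have "\<dots> \<le> J * card S" using sum by (rule mult_le_mono2)
    finally show False by simp
  qed
  then obtain i where i: "J * sift_count Q (i * y) y \<le> card S" by auto
  define c where "c = real (sift_count Q (i * y) y)"
  have c0: "c \<ge> 0" by (simp add: c_def)
  have "real (J * sift_count Q (i * y) y) \<le> real (card S)" using i by (simp only: of_nat_le_iff)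
  then have Jc: "real J * c \<le> real (card S)" by (simp add: c_def)
  have "Y * (1 - \<delta> / 2) * c \<le> (real J * real y) * c"
    using Jy Y c0 by (intro mult_right_mono) (auto simp: algebra_simps)
  also have "\<dots> = real y * (real J * c)" by simp
  also have "\<dots> \<le> real y * (Y * W * (1 - 2 * \<delta>))"
    using Jc S by (intro mult_left_mono) auto
  also have "\<dots> \<le> real y * (Y * W * ((1 - \<delta>) * (1 - \<delta> / 2)))"
    using Y W \<delta> by (intro mult_left_mono) (auto simp: algebra_simps)
  also have "\<dots> = Y * (1 - \<delta> / 2) * ((1 - \<delta>) * W * real y)" by (simp only: mult_ac)
  finally have "c \<le> (1 - \<delta>) * W * real y"
    using Y \<delta> by (simp only: mult_le_cancel_left_pos mult_pos_pos)
  then show ?thesis unfolding c_def W_def by blast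
qed

text \<open>Replacing \<open>m\<close> by \<open>m + j M\<close> leaves the sieving by
  \<open>P\<close> unchanged, while the class removed modulo \<open>p\<close> runs through all
  classes with \<open>j\<close>. Each survivor is removed by at least one of the \<open>p\<close>
  choices, so some \<open>j\<close> does no worse than the average.\<close>

lemma sift_count_insert:
  assumes M: "coprime p M" "\<And>q. q \<in> P \<Longrightarrow> q dvd M" and p: "p > 0"
  shows "\<exists>j. real (sift_count (insert p P) (m + j * M) y) \<le> (1 - 1 / real p) * real (sift_count P m y)"
proof (rule ccontr)
  let ?S = "{h \<in> {1..y}. \<forall>q\<in>P. \<not> q dvd m + h}"
  let ?T = "\<lambda>j. {h \<in> ?S. \<not> p dvd m + j * M + h}"
  have dvd: "q dvd m + j * M + h \<longleftrightarrow> q dvd m + h" if "q \<in> P" for q j h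
  proof -
    have "m + j * M + h = (m + h) + j * M" by simp
    then show ?thesis using M(2)[OF that] by (metis dvd_add_left_iff dvd_mult)
  qed
  have T: "sift_count (insert p P) (m + j * M) y = card (?T j)" for j
    unfolding sift_count_def using dvd by (intro arg_cong[of _ _ card]) auto
  assume "\<not> ?thesis"
  then have gt: "(1 - 1 / real p) * real (card ?S) < real (card (?T j))" for j
    unfolding T by (auto simp: sift_count_def not_le)
  have one: "real (card {j \<in> {..<p}. \<not> p dvd m + j * M + h}) \<le> real p - 1" for h
  proof -
    obtain j where j: "j < p" "p dvd m + j * M + h"
    proof -
      obtain x where x: "[M * x = 1] (mod p)" using cong_solve_coprime_nat[of M p] M(1) by (auto simp: coprime_commute)
      \<comment> \<open>\<open>k\<close> solves \<open>k M = - (m + h)\<close> modulo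
        \<open>p\<close>, with \<open>x\<close> the inverse of \<open>M\<close> and
        \<open>p - 1\<close> standing for \<open>- 1\<close> in the naturals.\<close>
      define k where "k = (x * ((p - 1) * (m + h)))"
      have "[m + k * M + h = (m + h) + (M * x) * ((p - 1) * (m + h))] (mod p)"
        by (simp add: k_def algebra_simps)
      also have "[(m + h) + (M * x) * ((p - 1) * (m + h)) = (m + h) + 1 * ((p - 1) * (m + h))] (mod p)"
        by (intro cong_add cong_mult x cong_refl)
      also have "(m + h) + 1 * ((p - 1) * (m + h)) = p * (m + h)" using p by (cases p) auto
      also have "[p * (m + h) = 0] (mod p)" by (simp add: cong_def)
      finally have "p dvd m + k * M + h" by (simp add: cong_0_iff)
      moreover have "[m + (k mod p) * M + h = m + k * M + h] (mod p)"
        by (intro cong_add cong_mult cong_refl) (simp add: cong_def)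
      ultimately have "p dvd m + (k mod p) * M + h" using cong_dvd_iff by blast
      then show ?thesis using that[of "k mod p"] p by simp
    qed
    have "card {j \<in> {..<p}. \<not> p dvd m + j * M + h} \<le> card ({..<p} - {j})"
      using j by (intro card_mono) auto
    also have "\<dots> = p - 1" using j by simp
    finally have "card {j \<in> {..<p}. \<not> p dvd m + j * M + h} + 1 \<le> p" using p by linarith
    then show ?thesis by linarith
  qed
  have "real p * ((1 - 1 / real p) * real (card ?S)) = (\<Sum>j<p. (1 - 1 / real p) * real (card ?S))" by simp
  also have "\<dots> < (\<Sum>j<p. real (card (?T j)))" using gt p by (intro sum_strict_mono) auto
  also have "\<dots> = (\<Sum>j<p. \<Sum>h\<in>?S. if \<not> p dvd m + j * M + h then 1 else 0)"
    by (intro sum.cong refl) (simp add: sum.If_cases Int_def)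
  also have "\<dots> = (\<Sum>h\<in>?S. \<Sum>j<p. if \<not> p dvd m + j * M + h then 1 else 0)" by (rule sum.swap)
  also have "\<dots> = (\<Sum>h\<in>?S. real (card {j \<in> {..<p}. \<not> p dvd m + j * M + h}))"
    by (intro sum.cong refl) (simp add: sum.If_cases Int_def)
  also have "\<dots> \<le> (\<Sum>h\<in>?S. real p - 1)" by (intro sum_mono one)
  also have "\<dots> = real p * ((1 - 1 / real p) * real (card ?S))" using p by (simp add: field_simps)
  finally show False by simp
qed

lemma sift_count_extend:
  fixes P R :: "nat set"
  assumes "finite R" "finite P" "P \<inter> R = {}" "\<And>p. p \<in> P \<union> R \<Longrightarrow> prime p"
  shows "\<exists>m. real (sift_count (P \<union> R) m y) \<le> (\<Prod>p\<in>R. 1 - 1 / real p) * real (sift_count P m0 y)"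
  using assms
proof (induction R rule: finite_induct)
  case empty
  then show ?case by (intro exI[of _ m0]) simp
next
  case (insert p R)
  then obtain m where m: "real (sift_count (P \<union> R) m y) \<le> (\<Prod>p\<in>R. 1 - 1 / real p) * real (sift_count P m0 y)"
    by auto
  have p: "prime p" using insert.prems(3) by simp
  then have p1: "p > 1" by (rule prime_gt_1_nat)
  have "coprime p (\<Prod>(P \<union> R))"
    using insert p by (intro prod_coprime_right) (metis Int_iff UnCI UnE empty_iff insertCI primes_coprime)
  then obtain j where "real (sift_count (insert p (P \<union> R)) (m + j * \<Prod>(P \<union> R)) y) \<le>
      (1 - 1 / real p) * real (sift_count (P \<union> R) m y)"
    using sift_count_insert[of p "\<Prod>(P \<union> R)" "P \<union> R" m y] p1 insert by (metis dvd_prodI finite_UnI less_trans zero_less_one)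
  also have "\<dots> \<le> (1 - 1 / real p) * ((\<Prod>p\<in>R. 1 - 1 / real p) * real (sift_count P m0 y))"
    using p1 by (intro mult_left_mono m) simp
  finally show ?case using insert by (intro exI[of _ "m + j * \<Prod>(P \<union> R)"]) (simp add: mult.assoc)
qed

text \<open>Moving the start of the interval down to the nearest survivor adds no survivor to the interval.\<close>

lemma sift_count_coprime_start:
  fixes P :: "nat set"
  assumes P: "finite P" "\<And>p. p \<in> P \<Longrightarrow> prime p"
  shows "\<exists>m'. (\<forall>p\<in>P. \<not> p dvd m') \<and> sift_count P m' y \<le> sift_count P m y"
proof -
  \<comment> \<open>Adding the product of \<open>P\<close> preserves all residues and ensures that a
    survivor exists at or below \<open>M\<close>, namely 1.\<close>
  define M where "M = m + \<Prod>P"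
  have pos: "\<Prod>P > 0" using P by (intro prod_pos) (auto intro: prime_gt_0_nat)
  let ?good = "\<lambda>k. k \<le> M \<and> (\<forall>p\<in>P. \<not> p dvd k)"
  have "?good 1" using pos P(2)[of 1] unfolding M_def by auto
  then obtain k where k: "?good k" "\<And>j. ?good j \<Longrightarrow> j \<le> k"
  proof -
    have "finite {k. ?good k}" "{k. ?good k} \<noteq> {}" using \<open>?good 1\<close> by (auto intro: finite_subset[of _ "{..M}"])
    then show thesis using that[of "Max {k. ?good k}"] Max_in[of "{k. ?good k}"] by auto
  qed
  have dvd: "p dvd M + h \<longleftrightarrow> p dvd m + h" if "p \<in> P" for p h
  proof -
    have "M + h = (m + h) + \<Prod>P" by (simp add: M_def)
    moreover have "p dvd \<Prod>P" using that P(1) by (metis dvd_prodI)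
    ultimately show ?thesis by (metis dvd_add_left_iff)
  qed
  have "sift_count P k y = card ((\<lambda>h. k + h) ` {h \<in> {1..y}. \<forall>p\<in>P. \<not> p dvd k + h})"
    unfolding sift_count_def by (intro card_image[symmetric]) (auto simp: inj_on_def)
  also have "\<dots> \<le> card ((\<lambda>h. M + h) ` {h \<in> {1..y}. \<forall>p\<in>P. \<not> p dvd m + h})"
  proof (intro card_mono subsetI)
    fix n assume "n \<in> (\<lambda>h. k + h) ` {h \<in> {1..y}. \<forall>p\<in>P. \<not> p dvd k + h}"
    then obtain h where h: "n = k + h" "1 \<le> h" "h \<le> y" "\<forall>p\<in>P. \<not> p dvd n" by auto
    \<comment> \<open>\<open>k\<close> is the largest survivor not exceeding \<open>M\<close>, so
      every survivor beyond \<open>k\<close> lies beyond \<open>M\<close>.\<close>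
    have "n > M" using k(2)[of n] h by (cases "n \<le> M") auto
    then have "n = M + (n - M)" "1 \<le> n - M" "n - M \<le> y" using h k(1) by auto
    moreover have "\<forall>p\<in>P. \<not> p dvd m + (n - M)" using dvd h(4) calculation(1) by metis
    ultimately show "n \<in> (\<lambda>h. M + h) ` {h \<in> {1..y}. \<forall>p\<in>P. \<not> p dvd m + h}"
      by (intro image_eqI[of _ _ "n - M"]) auto
  qed auto
  also have "\<dots> = sift_count P m y"
    unfolding sift_count_def by (intro card_image) (auto simp: inj_on_def)
  finally show ?thesis using k(1) by blast
qed

section \<open>Choice of the sieve parameters\<close>

text \<open>At \<open>L = ln (ln x)\<close>, for large \<open>x\<close>, this is the square root in
  the theorem.\<close>

definition sqlog :: "real \<Rightarrow> real" where
  "sqlog L = sqrt (L * ln L)"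

lemma sum_prime_powr_bounds:
  fixes Q :: "nat set"
  assumes Q: "finite Q" "\<And>p. p \<in> Q \<Longrightarrow> 0 < p \<and> w \<le> real p \<and> real p \<le> z" and t: "0 \<le> t" and w: "0 < w"
  shows "w powr t * (\<Sum>p\<in>Q. 1 / real p) \<le> (\<Sum>p\<in>Q. real p powr (t - 1))"
    and "(\<Sum>p\<in>Q. real p powr (t - 1)) \<le> z powr t * (\<Sum>p\<in>Q. 1 / real p)"
proof -
  have eq: "real p powr (t - 1) = real p powr t * (1 / real p)" if "p \<in> Q" for p
    using Q(2)[OF that] by (simp add: powr_diff)
  show "w powr t * (\<Sum>p\<in>Q. 1 / real p) \<le> (\<Sum>p\<in>Q. real p powr (t - 1))"
    unfolding sum_distrib_left using Q t w
    by (intro sum_mono, subst eq) (auto intro!: mult_right_mono powr_mono2 simp del: times_divide_eq_right)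
  show "(\<Sum>p\<in>Q. real p powr (t - 1)) \<le> z powr t * (\<Sum>p\<in>Q. 1 / real p)"
    unfolding sum_distrib_left using Q t w
    by (intro sum_mono, subst eq) (auto intro!: mult_right_mono powr_mono2 simp del: times_divide_eq_right)
qed

text \<open>The outcome of the short interval sieve at a fixed precision \<open>\<epsilon>\<close>,
  made a predicate so that a diagonal argument can vary \<open>\<epsilon>\<close> with
  \<open>L\<close>. \<open>N\<close> is \<open>z\<close> rounded down. That no prime divides
  \<open>m\<close> means that 0 survives, as it must because a gap is to start at an element of
  \<open>A\<close>.\<close>

definition sieve_config :: "real \<Rightarrow> real \<Rightarrow> bool" where
  "sieve_config \<epsilon> L \<longleftrightarrow> (\<forall>y N. 1 \<le> y \<longrightarrow> ln (real y) \<le> (1 + \<epsilon>) * L \<longrightarrow>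
     N = nat \<lfloor>exp ((1 / sqrt 2 + 25 * \<epsilon>) * sqlog L)\<rfloor> \<longrightarrow>
     (\<exists>m. (\<forall>p. prime p \<and> p \<le> N \<longrightarrow> \<not> p dvd m) \<and>
        real (sift_count {p. prime p \<and> p \<le> N} m y) \<le>
          (1 - exp (- (1 / sqrt 2 + 24 * \<epsilon>) * sqlog L)) * mertens_prod N * real y))"

text \<open>Wanted is a deficiency at some \<open>v \<ge> (1 + 3 \<epsilon>) L\<close>, slightly
  beyond \<open>ln y\<close>. Stationarity asks for \<open>v\<close> near \<open>U ln z\<close>, so
  \<open>U\<close> is about \<open>L / ln z\<close>, and \<open>\<tau>\<close> is then defined by
  \<open>\<Sum> p^(\<tau>-1) = U\<close>. This forces \<open>\<tau> ln z\<close> to be about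
  \<open>ln U\<close>, so that \<open>exp (- \<tau> v)\<close> is about
  \<open>U^(- U)\<close>.\<close>

lemma short_interval_sieve:
  fixes \<epsilon> :: real
  assumes \<epsilon>: "0 < \<epsilon>" "\<epsilon> \<le> 1 / 100"
  shows "\<forall>\<^sub>F L in at_top. sieve_config \<epsilon> L"
proof -
  define \<zeta> where "\<zeta> = 1 / sqrt 2 + 25 * \<epsilon>"
  \<comment> \<open>With \<open>U = k L / s\<close> the lower end
    \<open>U ln z (1 - 10 \<epsilon>)\<close> of the window equals
    \<open>(1 + 3 \<epsilon>) L\<close>. The excess of \<open>2 \<epsilon> L\<close> over
    \<open>ln y\<close> leaves room for many blocks.\<close>
  define k where "k = (1 + 3 * \<epsilon>) / ((1 - 10 * \<epsilon>) * \<zeta>)"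
  have \<zeta>: "\<zeta> > 0" "1 / sqrt 2 \<le> \<zeta>" using \<epsilon> by (auto simp: \<zeta>_def intro: add_pos_pos)
  have k: "k > 0" using \<zeta> \<epsilon> by (auto simp: k_def intro!: divide_pos_pos mult_pos_pos)
  define z where "z = (\<lambda>L. exp (\<zeta> * sqlog L))"
  define Q where "Q = (\<lambda>L. {p. prime p \<and> z L powr (1 - \<epsilon>) < real p \<and> real p \<le> z L})"
  define \<sigma> where "\<sigma> = (\<lambda>L. \<Sum>p\<in>Q L. 1 / real p)"
  have "filterlim z at_top at_top" unfolding z_def sqlog_def using \<zeta> by real_asymp
  from eventually_compose_filterlim[OF sum_inverse_primes_interval[of \<epsilon>] this]
  have "\<forall>\<^sub>F L in at_top. \<epsilon> / 2 \<le> \<sigma> L \<and> \<sigma> L \<le> 1" using \<epsilon> by (simp add: \<sigma>_def Q_def)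
  \<comment> \<open>\<open>U\<close> is of order \<open>sqrt (L / ln L)\<close>, so even
    \<open>2 U / \<epsilon>\<close> stays below \<open>sqrt L\<close>. Hence the factor
    \<open>1/2\<close> in \<open>\<tau>_up\<close>, and in the end the constant
    \<open>1 / sqrt 2\<close>.\<close>
  moreover have "\<forall>\<^sub>F L::real in at_top. 2 * (k * L / sqrt (L * ln L)) / \<epsilon> \<le> sqrt L" using k \<epsilon> by real_asymp
  moreover have "\<forall>\<^sub>F L::real in at_top. 1/2 * ln L \<le> (\<zeta> / 16) * sqrt (L * ln L)" using \<zeta> by real_asymp
  moreover have "\<forall>\<^sub>F L::real in at_top. 1/2 * ln L \<le> \<epsilon> * sqrt (L * ln L)" using \<epsilon> by real_asymp
  moreover have "\<forall>\<^sub>F L::real in at_top. k * L / sqrt (L * ln L) \<ge> exp 1" using k by real_asymp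
  moreover have "\<forall>\<^sub>F L::real in at_top. pi / (\<zeta> * sqrt (L * ln L)) \<le> 1/8" using \<zeta> by real_asymp
  moreover have "0 < 12 * \<epsilon>\<^sup>2" using \<epsilon> by simp
  then have "\<forall>\<^sub>F L::real in at_top. \<zeta> * sqrt (L * ln L) \<le> \<epsilon> * exp (12 * \<epsilon>\<^sup>2 * (k * L / sqrt (L * ln L)) - 1)"
    using \<zeta> k \<epsilon> by real_asymp
  moreover have "0 < 1 / sqrt 2 + 24 * \<epsilon>" "0 < 2 * \<epsilon>" using \<epsilon> by (auto intro: add_pos_pos)
  then have "\<forall>\<^sub>F L::real in at_top. ln 4 + (1 / sqrt 2 + 24 * \<epsilon>) * sqrt (L * ln L) \<le> 2 * \<epsilon> * L" by real_asymp
  moreover have "\<forall>\<^sub>F L::real in at_top. L \<ge> exp 1" by (rule eventually_ge_at_top)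
  ultimately show ?thesis
  proof eventually_elim
    case (elim L)
    define s where "s = sqlog L"
    define U where "U = k * L / s"
    define \<delta> where "\<delta> = exp (- (1 / sqrt 2 + 24 * \<epsilon>) * s)"
    have L: "L \<ge> exp 1" "L \<ge> 1" "ln L \<ge> 1" "L > 0"
      using elim(9) exp_ge_add_one_self[of "1::real"] by (auto simp: ln_ge_iff)
    have "0 < ln L" using L by linarith
    then have "L * ln L > 0" using L(4) by (rule mult_pos_pos[rotated])
    then have s2: "s * s = L * ln L" and s: "s > 0" unfolding s_def sqlog_def by simp_all
    note el = elim[folded sqlog_def, folded s_def, folded U_def]
    define zz where "zz = z L"
    have lz: "ln zz = \<zeta> * s" and zz: "zz > 1" using \<zeta> s by (auto simp: zz_def z_def s_def)
    have U: "U \<ge> exp 1" using el(5) .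
    then have U1: "U > 1" using exp_ge_add_one_self[of "1::real"] by linarith
    have finQ: "finite (Q L)"
      by (rule finite_subset[of _ "{..nat \<lfloor>z L\<rfloor>}"]) (auto simp: Q_def le_nat_iff le_floor_iff)
    have Qp: "0 < p \<and> zz powr (1 - \<epsilon>) \<le> real p \<and> real p \<le> zz" if "p \<in> Q L" for p
      using that by (auto simp: Q_def zz_def prime_gt_0_nat)
    have lnU: "ln (2 * U / \<epsilon>) \<le> 1 / 2 * ln L"
    proof -
      have "ln (2 * U / \<epsilon>) \<le> ln (sqrt L)" using el(2) U1 \<epsilon> by (intro ln_mono) (auto simp: mult_ac)
      then show ?thesis using L by (simp add: ln_sqrt)
    qed
    have w: "0 < zz powr (1 - \<epsilon>)" using zz by simp
    define A where "A = (\<lambda>t. \<Sum>p\<in>Q L. real p powr (t - 1))"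
    have A_low: "(zz powr (1 - \<epsilon>)) powr t * (\<epsilon> / 2) \<le> A t" if "t \<ge> 0" for t
    proof -
      have "(zz powr (1 - \<epsilon>)) powr t * (\<epsilon> / 2) \<le> (zz powr (1 - \<epsilon>)) powr t * \<sigma> L"
        using el(1) by (intro mult_left_mono) auto
      also have "\<dots> \<le> A t" unfolding \<sigma>_def A_def using that w Qp
        by (intro sum_prime_powr_bounds(1)[OF finQ]) auto
      finally show ?thesis .
    qed
    have A_up: "A t \<le> zz powr t" if "t \<ge> 0" for t
    proof -
      have "A t \<le> zz powr t * \<sigma> L" unfolding \<sigma>_def A_def using that w Qp
        by (intro sum_prime_powr_bounds(2)[OF finQ]) auto
      also have "\<dots> \<le> zz powr t * 1" using el(1) by (intro mult_left_mono) auto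
      finally show ?thesis by simp
    qed
    have zpow: "(zz powr (1 - \<epsilon>)) powr t = exp ((1 - \<epsilon>) * t * (\<zeta> * s))" for t
      using zz lz by (simp add: powr_powr) (simp add: powr_def)
    \<comment> \<open>At 0 the sum is at most 1 by Mertens, while at \<open>1/8\<close> it exceeds
      \<open>U\<close>, because a fixed power of \<open>z\<close> dwarfs
      \<open>sqrt L\<close>.\<close>
    have "\<exists>t\<ge>0. t \<le> 1 / 8 \<and> A t = U"
    proof (rule IVT')
      show "A 0 \<le> U" using A_up[of 0] U1 zz by simp
      have "ln (2 * U / \<epsilon>) \<le> \<zeta> / 16 * s" using lnU el(3) by linarith
      also have "\<dots> \<le> (1 - \<epsilon>) * (1 / 8) * (\<zeta> * s)"
      proof -
        have "1 / 16 * (\<zeta> * s) \<le> (1 - \<epsilon>) * (1 / 8) * (\<zeta> * s)" using \<epsilon> \<zeta> s by (intro mult_right_mono) auto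
        then show ?thesis by simp
      qed
      finally have "exp (ln (2 * U / \<epsilon>)) \<le> (zz powr (1 - \<epsilon>)) powr (1/8)" unfolding zpow by simp
      then have "2 * U / \<epsilon> \<le> (zz powr (1 - \<epsilon>)) powr (1/8)" using U1 \<epsilon> by simp
      then have "U \<le> (zz powr (1 - \<epsilon>)) powr (1/8) * (\<epsilon> / 2)" using \<epsilon> by (simp add: field_simps)
      also have "\<dots> \<le> A (1/8)" by (rule A_low) simp
      finally show "U \<le> A (1 / 8)" .
      show "continuous_on {0..1 / 8} A" unfolding A_def
        using Qp by (intro continuous_intros) auto
    qed simp
    then obtain \<tau> where \<tau>: "0 \<le> \<tau>" "\<tau> \<le> 1 / 8" "A \<tau> = U" by auto
    have "\<tau> \<noteq> 0" using A_up[of 0] U1 zz \<tau> by auto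
    then have \<tau>0: "\<tau> > 0" using \<tau> by simp
    have \<tau>_up: "(1 - \<epsilon>) * \<tau> * (\<zeta> * s) \<le> 1 / 2 * ln L"
    proof -
      have "(zz powr (1 - \<epsilon>)) powr \<tau> \<le> 2 * U / \<epsilon>" using A_low[of \<tau>] \<tau> \<epsilon> by (simp add: field_simps)
      then have "exp ((1 - \<epsilon>) * \<tau> * (\<zeta> * s)) \<le> exp (ln (2 * U / \<epsilon>))" unfolding zpow using U1 \<epsilon> by simp
      then have "(1 - \<epsilon>) * \<tau> * (\<zeta> * s) \<le> ln (2 * U / \<epsilon>)" by (simp only: exp_le_cancel_iff)
      then show ?thesis using lnU by linarith
    qed
    have \<tau>_low: "5 * \<epsilon> \<le> \<tau> * ln zz"
    proof -
      have "exp 1 \<le> zz powr \<tau>" using A_up[of \<tau>] \<tau> U by linarith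
      then have "1 \<le> \<tau> * ln zz" using zz by (simp add: powr_def)
      then show ?thesis using \<epsilon> by linarith
    qed
    \<comment> \<open>One factor \<open>p^(\<tau>-1)\<close> is at most \<open>1 / sqrt L\<close>,
      by the size of the primes in \<open>Q L\<close>; the other sums to
      \<open>U \<le> sqrt L\<close>.\<close>
    have sq: "(\<Sum>p\<in>Q L. real p powr (2 * (\<tau> - 1))) \<le> 1"
    proof -
      have "(\<Sum>p\<in>Q L. real p powr (2 * (\<tau> - 1))) \<le> (\<Sum>p\<in>Q L. (zz powr (1 - \<epsilon>)) powr (\<tau> - 1) * real p powr (\<tau> - 1))"
      proof (intro sum_mono)
        fix p assume p: "p \<in> Q L"
        have "real p powr (2 * (\<tau> - 1)) = real p powr (\<tau> - 1) * real p powr (\<tau> - 1)"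
          by (simp flip: powr_add)
        also have "\<dots> \<le> (zz powr (1 - \<epsilon>)) powr (\<tau> - 1) * real p powr (\<tau> - 1)"
          using Qp[OF p] w \<tau> by (intro mult_right_mono powr_mono2') auto
        finally show "real p powr (2 * (\<tau> - 1)) \<le> (zz powr (1 - \<epsilon>)) powr (\<tau> - 1) * real p powr (\<tau> - 1)" .
      qed
      also have "\<dots> = (zz powr (1 - \<epsilon>)) powr (\<tau> - 1) * U"
        unfolding \<tau>(3)[symmetric] A_def by (simp add: sum_distrib_left)
      also have "\<dots> \<le> exp (- (1/2 * ln L)) * exp (1/2 * ln L)"
      proof (intro mult_mono)
        have "1 / 2 * ln L \<le> 1 / 16 * (\<zeta> * s)" using el(3) by simp
        also have "\<dots> \<le> (1 - \<epsilon>) * (1 - \<tau>) * (\<zeta> * s)"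
        proof (intro mult_right_mono)
          have "(1/2) * (1/2) \<le> (1 - \<epsilon>) * (1 - \<tau>)" using \<epsilon> \<tau> by (intro mult_mono) auto
          then show "1 / 16 \<le> (1 - \<epsilon>) * (1 - \<tau>)" by simp
        qed (use \<zeta> s in auto)
        also have "\<dots> = - ((1 - \<epsilon>) * (\<tau> - 1) * (\<zeta> * s))" by (simp add: algebra_simps)
        finally show "(zz powr (1 - \<epsilon>)) powr (\<tau> - 1) \<le> exp (- (1/2 * ln L))" unfolding zpow by simp
        have "U \<le> 2 * U / \<epsilon>" using U1 \<epsilon> by (simp add: field_simps)
        then have "U \<le> exp (ln (2 * U / \<epsilon>))" using U1 \<epsilon> by simp
        also have "\<dots> \<le> exp (1/2 * ln L)" using lnU by simp
        finally show "U \<le> exp (1/2 * ln L)" .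
      qed (use U1 in auto)
      also have "\<dots> = 1" by (simp flip: exp_add)
      finally show ?thesis .
    qed
    have "\<exists>v. U * ln zz * (1 - 10 * \<epsilon>) \<le> v \<and> v \<le> U * ln zz * (1 + 10 * \<epsilon>) \<and>
      sieve_defect (Q L) v \<ge> exp (- \<tau> * (U * ln zz * (1 + 10 * \<epsilon>))) / U"
    proof (rule sieve_defect_large[OF finQ Qp \<epsilon> zz \<tau>0 \<tau>(2) _ _ sq \<tau>_low])
      show "(\<Sum>p\<in>Q L. real p powr (\<tau> - 1)) = U" using \<tau>(3) by (simp add: A_def)
      show "pi / ln zz \<le> 1 / 8" using el(6) by (simp add: lz)
      show "ln zz \<le> \<epsilon> * exp (12 * \<epsilon>\<^sup>2 * U - 1)" using el(7) by (simp add: lz)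
      show "0 < U" using U1 by linarith
    qed
    then obtain v where v: "U * ln zz * (1 - 10 * \<epsilon>) \<le> v"
      "sieve_defect (Q L) v \<ge> exp (- \<tau> * (U * ln zz * (1 + 10 * \<epsilon>))) / U" by auto
    have "U * ln zz * (1 - 10 * \<epsilon>) = (1 + 3 * \<epsilon>) * L"
    proof -
      have "1 - 10 * \<epsilon> \<noteq> 0" using \<epsilon> by simp
      then show ?thesis using \<zeta> s by (simp add: U_def lz k_def field_simps)
    qed
    then have v1: "(1 + 3 * \<epsilon>) * L \<le> v" using v(1) by simp
    \<comment> \<open>The left side is at most \<open>(ln L) / 2\<close> times
      \<open>U (1 + 10 \<epsilon>) / (1 - \<epsilon>)\<close>, and \<open>L ln L / s = s\<close>. As
      \<open>\<zeta> \<ge> 1 / sqrt 2\<close>, this is at most \<open>s / sqrt 2\<close> times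
      \<open>1 + 32 \<epsilon>\<close>, and \<open>32 / sqrt 2 < 23\<close>.\<close>
    have exponent: "\<tau> * (U * ln zz * (1 + 10 * \<epsilon>)) \<le> (1 / sqrt 2 + 23 * \<epsilon>) * s"
    proof -
      have "\<tau> * (U * ln zz * (1 + 10 * \<epsilon>)) = ((1 - \<epsilon>) * \<tau> * (\<zeta> * s)) * (U * (1 + 10 * \<epsilon>) / (1 - \<epsilon>))"
        using \<epsilon> by (simp add: lz)
      also have "\<dots> \<le> (1 / 2 * ln L) * (U * (1 + 10 * \<epsilon>) / (1 - \<epsilon>))"
        using \<tau>_up U1 \<epsilon> by (intro mult_right_mono) auto
      also have "\<dots> = (L * ln L / s) / 2 / \<zeta> * ((1 + 3 * \<epsilon>) * (1 + 10 * \<epsilon>) / ((1 - 10 * \<epsilon>) * (1 - \<epsilon>)))"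
        by (simp add: U_def k_def mult_ac)
      also have "L * ln L / s = s" using s2 s by (simp add: field_simps)
      also have "s / 2 / \<zeta> * ((1 + 3 * \<epsilon>) * (1 + 10 * \<epsilon>) / ((1 - 10 * \<epsilon>) * (1 - \<epsilon>))) \<le>
        s / 2 / (1 / sqrt 2) * (1 + 32 * \<epsilon>)"
      proof (intro mult_mono divide_left_mono)
        have "(1 + 3 * \<epsilon>) * (1 + 10 * \<epsilon>) \<le> (1 + 32 * \<epsilon>) * ((1 - 10 * \<epsilon>) * (1 - \<epsilon>))"
        proof -
          have "(1 + 32 * \<epsilon>) * ((1 - 10 * \<epsilon>) * (1 - \<epsilon>)) - (1 + 3 * \<epsilon>) * (1 + 10 * \<epsilon>) =
             \<epsilon> * (8 - 372 * \<epsilon> + 320 * \<epsilon>\<^sup>2)" by (simp add: algebra_simps power2_eq_square)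
          moreover have "\<epsilon> * (8 - 372 * \<epsilon> + 320 * \<epsilon>\<^sup>2) \<ge> 0" using \<epsilon> by (intro mult_nonneg_nonneg add_nonneg_nonneg) auto
          ultimately show ?thesis by linarith
        qed
        moreover have "(1 - 10 * \<epsilon>) * (1 - \<epsilon>) > 0" using \<epsilon> by (intro mult_pos_pos) auto
        ultimately show "(1 + 3 * \<epsilon>) * (1 + 10 * \<epsilon>) / ((1 - 10 * \<epsilon>) * (1 - \<epsilon>)) \<le> 1 + 32 * \<epsilon>"
          by (simp add: pos_divide_le_eq)
      qed (use \<zeta> s \<epsilon> in \<open>auto intro!: divide_nonneg_nonneg mult_nonneg_nonneg\<close>)
      also have "\<dots> = (sqrt 2 / 2 + 32 * \<epsilon> * (sqrt 2 / 2)) * s" by (simp add: algebra_simps)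
      also have "\<dots> \<le> (1 / sqrt 2 + 23 * \<epsilon>) * s"
      proof -
        have "sqrt 2 \<le> sqrt ((1.43)\<^sup>2)" by (intro real_sqrt_le_mono) (simp add: power2_eq_square)
        then have "sqrt 2 \<le> (1.43::real)" by simp
        then have "\<epsilon> * (32 * (sqrt 2 / 2)) \<le> \<epsilon> * 23" using \<epsilon> by (intro mult_left_mono) auto
        moreover have "sqrt 2 / 2 = 1 / sqrt (2::real)" by (simp add: real_div_sqrt field_simps)
        ultimately have "sqrt 2 / 2 + 32 * \<epsilon> * (sqrt 2 / 2) \<le> 1 / sqrt 2 + 23 * \<epsilon>" by linarith
        then show ?thesis using s by (intro mult_right_mono) auto
      qed
      finally show ?thesis .
    qed
    \<comment> \<open>Passing from 23 to 24 buys \<open>exp (\<epsilon> s)\<close>, which covers the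
      factors \<open>U\<close> and 2.\<close>
    have \<delta>2: "2 * \<delta> \<le> sieve_defect (Q L) v"
    proof -
      have "2 * U \<le> 2 * U / \<epsilon>" using U1 \<epsilon> by (simp add: field_simps)
      then have "2 * U \<le> exp (ln (2 * U / \<epsilon>))" using U1 \<epsilon> by simp
      also have "\<dots> \<le> exp (\<epsilon> * s)" using lnU el(4) by simp
      finally have U2: "2 * U \<le> exp (\<epsilon> * s)" .
      have "2 * \<delta> = exp (- ((1 / sqrt 2 + 23 * \<epsilon>) * s)) * (2 * exp (- (\<epsilon> * s)))"
        by (simp add: \<delta>_def algebra_simps flip: exp_add)
      also have "\<dots> \<le> exp (- ((1 / sqrt 2 + 23 * \<epsilon>) * s)) * (1 / U)"
        using U2 U1 by (intro mult_left_mono) (auto simp: exp_minus field_simps)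
      also have "\<dots> \<le> exp (- (\<tau> * (U * ln zz * (1 + 10 * \<epsilon>)))) * (1 / U)"
        using exponent U1 by (intro mult_right_mono) auto
      also have "\<dots> \<le> sieve_defect (Q L) v" using v(2) by simp
      finally show ?thesis .
    qed
    show ?case
      unfolding sieve_config_def
    proof (intro allI impI)
      fix y N :: nat
      assume y: "1 \<le> y" "ln (real y) \<le> (1 + \<epsilon>) * L" 
        and N: "N = nat \<lfloor>exp ((1 / sqrt 2 + 25 * \<epsilon>) * sqlog L)\<rfloor>"
      have Nz: "real p \<le> zz \<longleftrightarrow> p \<le> N" for p
        unfolding N zz_def z_def \<zeta>_def by (simp add: le_nat_iff le_floor_iff)
      let ?P = "{p. prime p \<and> p \<le> N}"
      have "(1 / sqrt 2 + 24 * \<epsilon>) * s > 0" using s \<epsilon> by (intro mult_pos_pos add_pos_pos) auto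
      then have \<delta>: "0 < \<delta>" "\<delta> < 1" by (auto simp: \<delta>_def algebra_simps)
      have "real y = exp (ln (real y))" using y by simp
      also have "\<dots> \<le> exp ((1 + \<epsilon>) * L)" using y(2) by (simp only: exp_le_cancel_iff)
      finally have "4 * real y \<le> exp (ln 4) * exp ((1 + \<epsilon>) * L)" by simp
      also have "\<dots> = exp (ln 4 + (1 + \<epsilon>) * L)" by (rule exp_add[symmetric])
      \<comment> \<open>The surplus \<open>2 \<epsilon> L\<close> of \<open>v\<close> over
        \<open>ln y\<close> outweighs \<open>ln 4\<close> and
        \<open>ln (1 / \<delta>)\<close>.\<close>
      also have "\<dots> \<le> exp (- (1 / sqrt 2 + 24 * \<epsilon>) * s + (1 + 3 * \<epsilon>) * L)"
        using el(8) by (simp add: algebra_simps)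
      also have "\<dots> \<le> exp (- (1 / sqrt 2 + 24 * \<epsilon>) * s + v)" using v1 by simp
      also have "\<dots> = \<delta> * exp v" unfolding \<delta>_def by (rule exp_add)
      finally have yv: "4 * real y \<le> \<delta> * exp v" .
      have "\<exists>m. real (sift_count (Q L) m y) \<le> (1 - \<delta>) * (\<Prod>p\<in>Q L. 1 - 1 / real p) * real y"
        by (rule sift_count_block[OF finQ _ y(1) \<delta> \<delta>2 yv]) (simp add: Q_def)
      then obtain m0 where m0: "real (sift_count (Q L) m0 y) \<le> (1 - \<delta>) * (\<Prod>p\<in>Q L. 1 - 1 / real p) * real y" ..
      have QP: "Q L \<subseteq> ?P" using Nz by (auto simp: Q_def zz_def)
      have "\<exists>m. real (sift_count (Q L \<union> (?P - Q L)) m y) \<le> (\<Prod>p\<in>?P - Q L. 1 - 1 / real p) * real (sift_count (Q L) m0 y)"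
        by (rule sift_count_extend) (use QP finQ in auto)
      then obtain m1 where m1: "real (sift_count ?P m1 y) \<le> (\<Prod>p\<in>?P - Q L. 1 - 1 / real p) * real (sift_count (Q L) m0 y)"
        using QP by (auto simp: Un_absorb1)
      obtain m where m: "\<forall>p\<in>?P. \<not> p dvd m" "sift_count ?P m y \<le> sift_count ?P m1 y"
        using sift_count_coprime_start[OF finite_primes_le, of N y m1] by blast
      have "real (sift_count ?P m y) \<le> (\<Prod>p\<in>?P - Q L. 1 - 1 / real p) * real (sift_count (Q L) m0 y)"
        using m m1 by linarith
      also have "\<dots> \<le> (\<Prod>p\<in>?P - Q L. 1 - 1 / real p) * ((1 - \<delta>) * (\<Prod>p\<in>Q L. 1 - 1 / real p) * real y)"
        by (intro mult_left_mono m0 prod_nonneg) (auto dest: prime_gt_1_nat)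
      also have "\<dots> = (1 - \<delta>) * ((\<Prod>p\<in>?P - Q L. 1 - 1 / real p) * (\<Prod>p\<in>Q L. 1 - 1 / real p)) * real y"
        by (simp only: mult_ac)
      also have "(\<Prod>p\<in>?P - Q L. 1 - 1 / real p) * (\<Prod>p\<in>Q L. 1 - 1 / real p) = mertens_prod N"
        unfolding mertens_prod_def by (rule prod.subset_diff[symmetric]) (use QP in auto)
      finally show "\<exists>m. (\<forall>p. prime p \<and> p \<le> N \<longrightarrow> \<not> p dvd m) \<and>
        real (sift_count ?P m y) \<le> (1 - exp (- (1 / sqrt 2 + 24 * \<epsilon>) * sqlog L)) * mertens_prod N * real y"
        using m(1) by (intro exI[of _ m]) (auto simp: \<delta>_def s_def)
    qed
  qed
qed

section \<open>The sieve functional\<close>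

text \<open>The shift 0 is always included: gaps are counted from starting points in
  \<open>A\<close>, so the tuple attached to \<open>H\<close> is
  \<open>{0} \<union> H\<close>.\<close>

definition occupied :: "nat \<Rightarrow> nat set \<Rightarrow> nat" where
  "occupied p H = card ((\<lambda>h. h mod p) ` insert 0 H)"

text \<open>
  The expectation of \<open>(1 - q)^k\<close> on the event that \<open>0\<close> survives, where \<open>k\<close> is the number of survivors in \<open>B\<close>
  after removing a random residue class modulo each \<open>p \<in> P\<close>.
\<close>

definition sieve_sum :: "nat set \<Rightarrow> real \<Rightarrow> nat set \<Rightarrow> real" where
  "sieve_sum P q B =
     (\<Sum>H\<in>Pow B. (- q) ^ card H * (\<Prod>p\<in>P. 1 - real (occupied p H) / real p))"

text \<open>The right side is the probability that a uniform class modulo \<open>p\<close> avoids 0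
  and all of \<open>H\<close>; avoiding 0 restricts \<open>a\<close> to
  \<open>{1..<p}\<close>.\<close>

lemma one_minus_occupied:
  assumes "p > 0" "finite H"
  shows "1 - real (occupied p H) / real p =
    1 / real p * (\<Sum>a\<in>{1..<p}. if \<forall>h\<in>H. h mod p \<noteq> a then 1 else 0)"
proof -
  let ?I = "(\<lambda>h. h mod p) ` insert 0 H"
  have sub: "?I \<subseteq> {..<p}" using assms by auto
  have fin: "finite ?I" using assms by simp
  have "{..<p} - ?I = {a \<in> {1..<p}. \<forall>h\<in>H. h mod p \<noteq> a}"
    using assms by (auto simp: image_iff Suc_le_eq)
  then have "(\<Sum>a\<in>{1..<p}. if \<forall>h\<in>H. h mod p \<noteq> a then 1 else 0) = real (card ({..<p} - ?I))"
    by (simp add: sum.If_cases Int_def)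
  also have "\<dots> = real p - real (occupied p H)"
    using card_mono[OF _ sub] sub fin by (simp add: card_Diff_subset occupied_def of_nat_diff)
  finally show ?thesis using assms by (simp add: field_simps)
qed

lemma sieve_sum_empty: "finite B \<Longrightarrow> sieve_sum {} q B = (1 - q) ^ card B"
  using sum_Pow_prod[of B "\<lambda>_. - q"] by (simp add: sieve_sum_def)

text \<open>Conditioning on the class removed modulo \<open>p\<close>. This recursion turns
  nonnegativity, the restriction to prescribed classes and the Jensen bound into inductions over the
  primes, with no probability space.\<close>

lemma sieve_sum_insert:
  assumes "finite P" "p \<notin> P" "p > 0" "finite B"
  shows "sieve_sum (insert p P) q B = 1 / real p * (\<Sum>a\<in>{1..<p}. sieve_sum P q {h \<in> B. h mod p \<noteq> a})"
proof -
  let ?w = "\<lambda>H. (- q) ^ card H * (\<Prod>p\<in>P. 1 - real (occupied p H) / real p)"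
  have "sieve_sum (insert p P) q B = (\<Sum>H\<in>Pow B. \<Sum>a\<in>{1..<p}. 1 / real p * (if \<forall>h\<in>H. h mod p \<noteq> a then ?w H else 0))"
    unfolding sieve_sum_def
  proof (intro sum.cong refl)
    fix H assume "H \<in> Pow B"
    then have "finite H" using assms by (auto intro: finite_subset)
    have "(- q) ^ card H * (\<Prod>p\<in>insert p P. 1 - real (occupied p H) / real p) = 
      ?w H * (1 / real p * (\<Sum>a\<in>{1..<p}. if \<forall>h\<in>H. h mod p \<noteq> a then 1 else 0))"
      unfolding prod.insert[OF assms(1,2)] one_minus_occupied[OF assms(3) \<open>finite H\<close>] by (simp only: mult_ac)
    also have "\<dots> = (\<Sum>a\<in>{1..<p}. 1 / real p * (if \<forall>h\<in>H. h mod p \<noteq> a then ?w H else 0))"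
      unfolding sum_distrib_left by (intro sum.cong refl) auto
    finally show "(- q) ^ card H * (\<Prod>p\<in>insert p P. 1 - real (occupied p H) / real p) =
      (\<Sum>a\<in>{1..<p}. 1 / real p * (if \<forall>h\<in>H. h mod p \<noteq> a then ?w H else 0))" .
  qed
  also have "\<dots> = (\<Sum>a\<in>{1..<p}. \<Sum>H\<in>Pow B. 1 / real p * (if \<forall>h\<in>H. h mod p \<noteq> a then ?w H else 0))"
    by (rule sum.swap)
  also have "\<dots> = 1 / real p * (\<Sum>a\<in>{1..<p}. \<Sum>H\<in>Pow B. if \<forall>h\<in>H. h mod p \<noteq> a then ?w H else 0)"
    by (simp only: sum_distrib_left)
  also have "(\<Sum>a\<in>{1..<p}. \<Sum>H\<in>Pow B. if \<forall>h\<in>H. h mod p \<noteq> a then ?w H else 0) =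
    (\<Sum>a\<in>{1..<p}. sieve_sum P q {h \<in> B. h mod p \<noteq> a})"
  proof (intro sum.cong refl)
    fix a
    have "{H \<in> Pow B. \<forall>h\<in>H. h mod p \<noteq> a} = Pow {h \<in> B. h mod p \<noteq> a}" by auto
    then show "(\<Sum>H\<in>Pow B. if \<forall>h\<in>H. h mod p \<noteq> a then ?w H else 0) = sieve_sum P q {h \<in> B. h mod p \<noteq> a}"
      unfolding sieve_sum_def using assms by (simp add: sum.inter_filter[symmetric])
  qed
  finally show ?thesis .
qed

lemma sieve_sum_nonneg:
  assumes "finite P" "finite B" "\<And>p. p \<in> P \<Longrightarrow> p > 0" "q \<le> 1"
  shows "sieve_sum P q B \<ge> 0"
  using assms
proof (induction P arbitrary: B rule: finite_induct)
  case (insert p P)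
  have "(\<Sum>a\<in>{1..<p}. sieve_sum P q {h \<in> B. h mod p \<noteq> a}) \<ge> 0"
    by (intro sum_nonneg insert.IH) (use insert.prems in auto)
  then show ?case
    using insert by (simp add: sieve_sum_insert)
qed (simp add: sieve_sum_empty)

text \<open>For each \<open>p\<close> in \<open>P\<close> only the class of \<open>- m\<close> is
  kept in the recursion; the other terms are nonnegative. This costs the probability
  \<open>1 / p\<close> per prime.\<close>

lemma sieve_sum_restrict:
  assumes "finite P" "finite R" "P \<inter> R = {}" "finite B" "\<And>p. p \<in> P \<union> R \<Longrightarrow> p > 0" "q \<le> 1"
    and m: "\<And>p. p \<in> P \<Longrightarrow> \<not> p dvd m"
  shows "sieve_sum (P \<union> R) q B \<ge> (\<Prod>p\<in>P. 1 / real p) * sieve_sum R q {h \<in> B. \<forall>p\<in>P. \<not> p dvd m + h}"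
  using assms
proof (induction P arbitrary: B rule: finite_induct)
  case (insert p P)
  let ?B = "{h \<in> B. \<not> p dvd m + h}"
  have p: "p > 0" using insert by auto
  define a where "a = p - m mod p"
  have "m mod p \<noteq> 0" using insert.prems(6)[of p] by (simp add: dvd_eq_mod_eq_0)
  moreover have "m mod p < p" using p by simp
  ultimately have a: "a \<in> {1..<p}" unfolding a_def by auto
  have a_eq: "p dvd m + h \<longleftrightarrow> h mod p = a" for h
  proof -
    have lt: "m mod p < p" "h mod p < p" using p by simp_all
    have "p dvd m + h \<longleftrightarrow> p dvd m mod p + h mod p"
      by (simp only: dvd_eq_mod_eq_0 mod_add_eq)
    also have "\<dots> \<longleftrightarrow> m mod p + h mod p = p"
    proof
      assume "p dvd m mod p + h mod p"
      then obtain c where c: "m mod p + h mod p = p * c" by auto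
      have "p * 0 < p * c" "p * c < p * 2" using c lt \<open>m mod p \<noteq> 0\<close> by linarith+
      then have "0 < c" "c < 2" by (simp_all only: mult_less_cancel1)
      then have "c = 1" by linarith
      then show "m mod p + h mod p = p" using c by simp
    qed simp
    also have "\<dots> \<longleftrightarrow> h mod p = a" using lt unfolding a_def by linarith
    finally show ?thesis .
  qed
  have "(\<Prod>p\<in>insert p P. 1 / real p) * sieve_sum R q {h \<in> B. \<forall>p\<in>insert p P. \<not> p dvd m + h} =
     1 / real p * ((\<Prod>p\<in>P. 1 / real p) * sieve_sum R q {h \<in> ?B. \<forall>p\<in>P. \<not> p dvd m + h})"
  proof -
    have "{h \<in> B. \<forall>p\<in>insert p P. \<not> p dvd m + h} = {h \<in> ?B. \<forall>p\<in>P. \<not> p dvd m + h}" by auto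
    then show ?thesis by (simp only: prod.insert[OF insert.hyps(1,2)] mult.assoc)
  qed
  also have "\<dots> \<le> 1 / real p * sieve_sum (P \<union> R) q ?B"
    using insert by (intro mult_left_mono insert.IH) auto
  also have "\<dots> \<le> 1 / real p * (\<Sum>a\<in>{1..<p}. sieve_sum (P \<union> R) q {h \<in> B. h mod p \<noteq> a})"
  proof (intro mult_left_mono)
    show "sieve_sum (P \<union> R) q ?B \<le> (\<Sum>a\<in>{1..<p}. sieve_sum (P \<union> R) q {h \<in> B. h mod p \<noteq> a})"
    proof -
      have "?B = {h \<in> B. h mod p \<noteq> a}" by (simp only: a_eq)
      moreover have "sieve_sum (P \<union> R) q {h \<in> B. h mod p \<noteq> b} \<ge> 0" for b
        by (rule sieve_sum_nonneg) (use insert in auto)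
      ultimately show ?thesis
        by (simp only:) (rule member_le_sum[OF a]; simp)
    qed
  qed simp
  also have "\<dots> = sieve_sum (insert p P \<union> R) q B"
    using insert p by (simp add: sieve_sum_insert)
  finally show ?case .
qed simp

text \<open>Jensen's inequality for \<open>exp\<close>, from the tangent at the mean.\<close>

lemma sum_exp_ge_exp_avg:
  fixes f :: "'a \<Rightarrow> real"
  assumes "finite A" "A \<noteq> {}"
  shows "(\<Sum>a\<in>A. exp (f a)) \<ge> real (card A) * exp ((\<Sum>a\<in>A. f a) / real (card A))"
proof -
  define m where "m = (\<Sum>a\<in>A. f a) / real (card A)"
  have c: "real (card A) > 0" using assms by (simp add: card_gt_0_iff)
  have "real (card A) * exp m = (\<Sum>a\<in>A. exp m * (1 + (f a - m)))"
    using c by (simp add: sum.distrib sum_subtractf sum_distrib_left[symmetric] m_def)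
  also have "\<dots> \<le> (\<Sum>a\<in>A. exp m * exp (f a - m))"
    by (intro sum_mono mult_left_mono exp_ge_add_one_self) auto
  also have "\<dots> = (\<Sum>a\<in>A. exp (f a))" by (simp flip: exp_add)
  finally show ?thesis unfolding m_def .
qed

text \<open>The probability that \<open>h\<close> avoids a random residue class modulo each \<open>p \<in> P\<close>, given that \<open>0\<close> does.\<close>

definition survival :: "nat set \<Rightarrow> nat \<Rightarrow> real" where
  "survival P h = (\<Prod>p\<in>P. 1 - (if p dvd h then 0 else 1 / (real p - 1)))"

text \<open>With \<open>1 - q = exp (- c)\<close> the quantity averaged is
  \<open>exp (- c k)\<close>, convex in the number \<open>k\<close> of survivors. Given that 0
  survives, \<open>p - 1\<close> classes are equally likely: a multiple of \<open>p\<close> is never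
  removed, any other \<open>h\<close> with probability \<open>1 / (p - 1)\<close>. The factors
  \<open>1 - 1/p\<close> are the probability that 0 survives.\<close>

lemma sieve_sum_jensen:
  assumes "finite P" "finite B" "\<And>p. p \<in> P \<Longrightarrow> p \<ge> 2" "c \<ge> 0"
  shows "sieve_sum P (1 - exp (- c)) B \<ge> (\<Prod>p\<in>P. 1 - 1 / real p) * exp (- c * (\<Sum>h\<in>B. survival P h))"
  using assms
proof (induction P arbitrary: B rule: finite_induct)
  case empty
  then show ?case by (simp add: sieve_sum_empty survival_def exp_of_nat_mult[symmetric] mult.commute)
next
  case (insert p P)
  have p: "p \<ge> 2" using insert by auto
  let ?V = "\<Prod>p\<in>P. 1 - 1 / real p"
  let ?e = "\<lambda>a. \<Sum>h | h \<in> B \<and> h mod p \<noteq> a. survival P h"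
  have V: "?V \<ge> 0"
  proof (intro prod_nonneg)
    fix r assume "r \<in> P"
    then have "r \<ge> 2" using insert by auto
    then show "0 \<le> 1 - 1 / real r" by simp
  qed
  have card: "(\<Sum>a\<in>{1..<p}. if h mod p \<noteq> a then 1 else 0) = real p - 1 - (if p dvd h then 0 else 1)" for h
  proof -
    have "(\<Sum>a\<in>{1..<p}. if h mod p \<noteq> a then 1 else (0::real)) = (\<Sum>a\<in>{1..<p}. 1 - (if a = h mod p then 1 else 0))"
      by (intro sum.cong) auto
    also have "\<dots> = real (p - 1) - (if h mod p \<in> {1..<p} then 1 else 0)"
      by (simp add: sum_subtractf)
    also have "h mod p \<in> {1..<p} \<longleftrightarrow> \<not> p dvd h" using p by (auto simp: dvd_eq_mod_eq_0 Suc_le_eq)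
    finally show ?thesis using p by (simp add: of_nat_diff)
  qed
  have "(\<Sum>a\<in>{1..<p}. ?e a) = (\<Sum>a\<in>{1..<p}. \<Sum>h\<in>B. (if h mod p \<noteq> a then 1 else 0) * survival P h)"
  proof (rule sum.cong[OF refl])
    fix a
    have "?e a = (\<Sum>h\<in>B. if h mod p \<noteq> a then survival P h else 0)"
      using insert.prems(1) by (rule sum.inter_filter)
    also have "\<dots> = (\<Sum>h\<in>B. (if h mod p \<noteq> a then 1 else 0) * survival P h)" by (intro sum.cong) auto
    finally show "?e a = (\<Sum>h\<in>B. (if h mod p \<noteq> a then 1 else 0) * survival P h)" .
  qed
  also have "\<dots> = (\<Sum>h\<in>B. \<Sum>a\<in>{1..<p}. (if h mod p \<noteq> a then 1 else 0) * survival P h)" by (rule sum.swap)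
  also have "\<dots> = (\<Sum>h\<in>B. (real p - 1 - (if p dvd h then 0 else 1)) * survival P h)"
    by (simp only: sum_distrib_right[symmetric] card)
  also have "\<dots> = (\<Sum>h\<in>B. (real p - 1) * survival (insert p P) h)"
  proof (rule sum.cong[OF refl])
    fix h
    have "real p - 1 - (if p dvd h then 0 else 1) = (real p - 1) * (1 - (if p dvd h then 0 else 1 / (real p - 1)))"
      using p by (simp add: field_simps)
    then show "(real p - 1 - (if p dvd h then 0 else 1)) * survival P h = (real p - 1) * survival (insert p P) h"
      unfolding survival_def prod.insert[OF insert.hyps(1,2)] by (simp only: mult.assoc)
  qed
  finally have avg: "(\<Sum>a\<in>{1..<p}. ?e a) = (real p - 1) * (\<Sum>h\<in>B. survival (insert p P) h)"
    by (simp only: sum_distrib_left)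
  have "(\<Prod>p\<in>insert p P. 1 - 1 / real p) * exp (- c * (\<Sum>h\<in>B. survival (insert p P) h)) =
    1 / real p * (?V * ((real p - 1) * exp (- c * (\<Sum>h\<in>B. survival (insert p P) h))))"
  proof -
    have "1 - 1 / real p = 1 / real p * (real p - 1)" using p by (simp add: field_simps)
    then show ?thesis unfolding prod.insert[OF insert.hyps(1,2)] by (simp only: mult_ac)
  qed
  also have "\<dots> \<le> 1 / real p * (?V * (\<Sum>a\<in>{1..<p}. exp (- c * ?e a)))"
  proof (intro mult_left_mono V)
    have "real (card {1..<p}) * exp ((\<Sum>a\<in>{1..<p}. - c * ?e a) / real (card {1..<p})) \<le> (\<Sum>a\<in>{1..<p}. exp (- c * ?e a))"
      using p by (intro sum_exp_ge_exp_avg) auto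
    moreover have "(\<Sum>a\<in>{1..<p}. - c * ?e a) = - c * ((real p - 1) * (\<Sum>h\<in>B. survival (insert p P) h))"
      by (simp only: sum_distrib_left[symmetric] avg)
    moreover have "real (card {1..<p}) = real p - 1" using p by (simp add: of_nat_diff)
    ultimately show "(real p - 1) * exp (- c * (\<Sum>h\<in>B. survival (insert p P) h)) \<le> (\<Sum>a\<in>{1..<p}. exp (- c * ?e a))"
      using p by simp
  qed (use p in auto)
  also have "\<dots> = 1 / real p * (\<Sum>a\<in>{1..<p}. ?V * exp (- c * ?e a))" by (simp only: sum_distrib_left)
  also have "\<dots> \<le> 1 / real p * (\<Sum>a\<in>{1..<p}. sieve_sum P (1 - exp (- c)) {h \<in> B. h mod p \<noteq> a})"
    using insert by (intro mult_left_mono sum_mono insert.IH) auto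
  also have "\<dots> = sieve_sum (insert p P) (1 - exp (- c)) B"
    by (rule sieve_sum_insert[symmetric]) (use insert.hyps insert.prems(1) p in simp_all)
  finally have *: "(\<Prod>p\<in>insert p P. 1 - 1 / real p) * exp (- c * (\<Sum>h\<in>B. survival (insert p P) h))
    \<le> sieve_sum (insert p P) (1 - exp (- c)) B" .
  show ?case using * by simp
qed

section \<open>Bonferroni's inequality\<close>

lemma alternating_binomial_partial_sum:
  assumes "n > 0"
  shows "(\<Sum>k\<le>K. (-1) ^ k * real (n choose k)) = (-1) ^ K * real ((n - 1) choose K)"
proof (induction K)
  case (Suc K)
  have "n choose Suc K = ((n - 1) choose K) + ((n - 1) choose Suc K)"
    using assms by (cases n) auto
  then show ?case using Suc by (simp add: algebra_simps)
qed simp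

lemma sum_Pow_card:
  assumes "finite B"
  shows "(\<Sum>H | H \<subseteq> B \<and> card H \<le> K. f (card H)) = (\<Sum>k\<le>K. real (card B choose k) * f k)"
proof -
  have fin: "finite {H. H \<subseteq> B \<and> card H \<le> K}" using assms by (auto intro: finite_subset[of _ "Pow B"])
  have "(\<Sum>H | H \<subseteq> B \<and> card H \<le> K. f (card H)) =
    (\<Sum>k\<le>K. \<Sum>H | H \<in> {H. H \<subseteq> B \<and> card H \<le> K} \<and> card H = k. f (card H))"
    using fin by (intro sum.group[symmetric]) auto
  also have "\<dots> = (\<Sum>k\<le>K. real (card {H. H \<subseteq> B \<and> card H = k}) * f k)"
  proof (intro sum.cong refl)
    fix k assume "k \<in> {..K}"
    then have "{H \<in> {H. H \<subseteq> B \<and> card H \<le> K}. card H = k} = {H. H \<subseteq> B \<and> card H = k}" by auto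
    then show "(\<Sum>H | H \<in> {H. H \<subseteq> B \<and> card H \<le> K} \<and> card H = k. f (card H)) = real (card {H. H \<subseteq> B \<and> card H = k}) * f k"
      by simp
  qed
  finally show ?thesis using assms by (simp add: n_subsets)
qed

text \<open>For \<open>n\<close> in \<open>A\<close> with set \<open>T\<close> of occupied shifts,
  the truncated alternating sum over subsets of \<open>T\<close> is 1 if \<open>T\<close> is empty,
  and otherwise \<open>(-1)^K\<close> times \<open>(card T - 1) choose K\<close>, which is at most 0
  for odd \<open>K\<close>.\<close>

lemma bonferroni_count:
  fixes X A B :: "nat set"
  assumes "finite X" "finite B" "odd K"
  shows "(\<Sum>H | H \<subseteq> B \<and> card H \<le> K. (-1) ^ card H * real (card {n \<in> X. \<forall>h\<in>insert 0 H. n + h \<in> A}))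
    \<le> real (card {n \<in> X. n \<in> A \<and> (\<forall>h\<in>B. n + h \<notin> A)})"
proof -
  let ?T = "\<lambda>n. {h \<in> B. n + h \<in> A}"
  let ?F = "{H. H \<subseteq> B \<and> card H \<le> K}"
  have finF: "finite ?F" using assms by (auto intro: finite_subset[of _ "Pow B"])
  have "(\<Sum>H\<in>?F. (-1) ^ card H * real (card {n \<in> X. \<forall>h\<in>insert 0 H. n + h \<in> A})) =
    (\<Sum>H\<in>?F. \<Sum>n\<in>{n \<in> X. n \<in> A}. if H \<subseteq> ?T n then (-1) ^ card H else 0)"
  proof (intro sum.cong refl)
    fix H assume "H \<in> ?F"
    then have "{n \<in> X. \<forall>h\<in>insert 0 H. n + h \<in> A} = {n \<in> {n \<in> X. n \<in> A}. H \<subseteq> ?T n}" by auto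
    then show "(-1) ^ card H * real (card {n \<in> X. \<forall>h\<in>insert 0 H. n + h \<in> A}) =
      (\<Sum>n\<in>{n \<in> X. n \<in> A}. if H \<subseteq> ?T n then (-1) ^ card H else 0)"
      using assms by (subst sum.inter_filter[symmetric]) auto
  qed
  also have "\<dots> = (\<Sum>n\<in>{n \<in> X. n \<in> A}. \<Sum>H\<in>?F. if H \<subseteq> ?T n then (-1) ^ card H else 0)" by (rule sum.swap)
  also have "\<dots> \<le> (\<Sum>n\<in>{n \<in> X. n \<in> A}. if ?T n = {} then 1 else 0)"
  proof (intro sum_mono)
    fix n
    have fT: "finite (?T n)" using assms by simp
    have "(\<Sum>H\<in>?F. if H \<subseteq> ?T n then (-1) ^ card H else 0) = (\<Sum>H | H \<in> ?F \<and> H \<subseteq> ?T n. (-1) ^ card H)"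
      by (rule sum.inter_filter[symmetric]) (rule finF)
    also have "{H. H \<in> ?F \<and> H \<subseteq> ?T n} = {H. H \<subseteq> ?T n \<and> card H \<le> K}" by auto
    also have "(\<Sum>H | H \<subseteq> ?T n \<and> card H \<le> K. (-1) ^ card H) = (\<Sum>k\<le>K. real (card (?T n) choose k) * (-1) ^ k)"
      by (rule sum_Pow_card[OF fT])
    also have "\<dots> \<le> (if ?T n = {} then 1 else (0::real))"
    proof (cases "?T n = {}")
      case True
      have "(\<Sum>k\<le>K. real (card (?T n) choose k) * (-1) ^ k) = (\<Sum>k\<le>K. if k = 0 then 1 else (0::real))"
        unfolding True by (intro sum.cong) auto
      also have "\<dots> = 1" by simp
      finally show ?thesis unfolding if_P[OF True] by (rule eq_refl)
    next
      case False
      then have "card (?T n) > 0" using fT by (simp only: card_gt_0_iff) auto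
      from alternating_binomial_partial_sum[OF this, of K] show ?thesis
        using False assms(3) by (simp add: mult.commute)
    qed
    finally show "(\<Sum>H\<in>?F. if H \<subseteq> ?T n then (-1) ^ card H else 0) \<le> (if ?T n = {} then 1 else (0::real))" .
  qed
  also have "\<dots> = real (card {n \<in> {n \<in> X. n \<in> A}. ?T n = {}})"
    using assms by (subst sum.inter_filter[symmetric]) auto
  also have "{n \<in> {n \<in> X. n \<in> A}. ?T n = {}} = {n \<in> X. n \<in> A \<and> (\<forall>h\<in>B. n + h \<notin> A)}" by auto
  finally show ?thesis .
qed

section \<open>Singular series\<close>

text \<open>The singular series of \<open>{0} \<union> H\<close> cut at \<open>N\<close>, with the
  local factors gathered so that the numerator is the weight occurring in
  \<open>sieve_sum\<close>.\<close>

definition partial_series :: "nat \<Rightarrow> nat set \<Rightarrow> real" where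
  "partial_series N H =
     (\<Prod>p | prime p \<and> p \<le> N. 1 - real (occupied p H) / real p) / mertens_prod N ^ Suc (card H)"

lemma occupied_le: "p > 0 \<Longrightarrow> occupied p H \<le> p"
proof -
  assume "p > 0"
  then have "(\<lambda>h. h mod p) ` insert 0 H \<subseteq> {..<p}" by auto
  from card_mono[OF _ this] show ?thesis by (simp only: occupied_def finite_lessThan card_lessThan)
qed

lemma occupied_eq:
  assumes "H \<subseteq> {1..y}" "y < p"
  shows "occupied p H = Suc (card H)"
proof -
  have "h mod p = h" if "h \<in> insert 0 H" for h using that assms by (intro mod_less) auto
  then have "inj_on (\<lambda>h. h mod p) (insert 0 H)" by (simp only: inj_on_def) metis
  then have "occupied p H = card (insert 0 H)" unfolding occupied_def by (rule card_image)
  moreover have "finite H" "0 \<notin> H" using assms finite_subset by auto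
  ultimately show ?thesis by simp
qed

text \<open>Bernoulli's inequality twice: for \<open>(1 - 1/p)^k\<close>, and for
  \<open>(1 + 1/p)^k\<close>, which is at most the inverse of \<open>(1 - 1/p)^k\<close>.\<close>

lemma series_factor_bounds:
  fixes k p :: nat
  assumes "k \<le> p" "p \<ge> 2"
  shows "1 - (real k)\<^sup>2 / (real p)\<^sup>2 \<le> (1 - real k / real p) / (1 - 1 / real p) ^ k"
    and "(1 - real k / real p) / (1 - 1 / real p) ^ k \<le> 1"
proof -
  have p: "0 < 1 - 1 / real p" "real k / real p \<le> 1" using assms by auto
  then have pw: "0 < (1 - 1 / real p) ^ k" by simp
  have "1 + real k * (- (1 / real p)) \<le> (1 + (- (1 / real p))) ^ k"
    using assms by (intro Bernoulli_inequality) auto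
  then show "(1 - real k / real p) / (1 - 1 / real p) ^ k \<le> 1" using pw by simp
  have "1 + real k * (1 / real p) \<le> (1 + 1 / real p) ^ k"
    by (intro Bernoulli_inequality) (auto intro: order_trans[of _ 0])
  moreover have "(1 + 1 / real p) ^ k * (1 - 1 / real p) ^ k \<le> 1"
  proof -
    have "(1 + 1 / real p) * (1 - 1 / real p) \<le> 1" by (simp add: algebra_simps)
    then show ?thesis unfolding power_mult_distrib[symmetric] using p assms
      by (intro power_le_one) auto
  qed
  then have "(1 + 1 / real p) ^ k \<le> 1 / (1 - 1 / real p) ^ k" using pw by (simp add: field_simps)
  ultimately have "1 + real k / real p \<le> 1 / (1 - 1 / real p) ^ k" by simp
  then have "(1 - real k / real p) * (1 + real k / real p) \<le> (1 - real k / real p) * (1 / (1 - 1 / real p) ^ k)"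
    using p by (intro mult_left_mono) auto
  then show "1 - (real k)\<^sup>2 / (real p)\<^sup>2 \<le> (1 - real k / real p) / (1 - 1 / real p) ^ k"
    by (simp add: algebra_simps power2_eq_square)
qed

lemma prod_one_minus_ge:
  fixes a :: "'a \<Rightarrow> real"
  assumes "finite A" "\<And>i. i \<in> A \<Longrightarrow> 0 \<le> a i \<and> a i \<le> 1"
  shows "(\<Prod>i\<in>A. 1 - a i) \<ge> 1 - (\<Sum>i\<in>A. a i)"
  using assms
proof (induction A rule: finite_induct)
  case (insert i A)
  have P: "0 \<le> (\<Prod>i\<in>A. 1 - a i)" "(\<Prod>i\<in>A. 1 - a i) \<le> 1"
    using insert by (auto intro!: prod_nonneg prod_le_1)
  then have "a i * (\<Prod>i\<in>A. 1 - a i) \<le> a i * 1" using insert by (intro mult_left_mono) auto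
  then show ?case using insert by (simp add: algebra_simps)
qed simp

lemma sum_inverse_squares_tail:
  assumes "1 \<le> N" "N \<le> n"
  shows "(\<Sum>i\<in>{N<..n}. 1 / (real i)\<^sup>2) \<le> 1 / real N - 1 / real n"
  using assms(2)
proof (induction n rule: dec_induct)
  case (step n)
  have n: "real n \<ge> 1" using step assms by simp
  have "1 / (real (Suc n))\<^sup>2 \<le> 1 / (real n * real (Suc n))"
    using n by (intro divide_left_mono) (auto simp: power2_eq_square)
  also have "\<dots> = 1 / real n - 1 / real (Suc n)" using n by (simp add: field_simps)
  finally have "1 / (real (Suc n))\<^sup>2 \<le> 1 / real n - 1 / real (Suc n)" .
  moreover have "{N<..Suc n} = insert (Suc n) {N<..n}" using step by auto
  ultimately show ?case using step.IH by simp
qed simp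

lemma partial_series_nonneg: "partial_series N H \<ge> 0"
  unfolding partial_series_def using mertens_prod_pos[of N]
  by (intro divide_nonneg_nonneg prod_nonneg)
     (auto simp: divide_le_eq_1 occupied_le prime_gt_0_nat)

text \<open>A prime above \<open>y\<close> separates the elements of \<open>{0} \<union> H\<close>,
  so its local factor lies between \<open>1 - k^2 / p^2\<close> and 1; the sum of
  \<open>1 / p^2\<close> beyond \<open>N\<close> is at most \<open>1 / N\<close>.\<close>

lemma partial_series_extend:
  assumes H: "H \<subseteq> {1..y}" and N: "y \<le> N" "1 \<le> N" "N \<le> n"
  shows "partial_series n H \<le> partial_series N H"
    and "partial_series N H * (1 - real (Suc (card H))^2 / real N) \<le> partial_series n H"
proof -
  let ?k = "Suc (card H)"
  let ?I = "{p. prime p \<and> N < p \<and> p \<le> n}"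
  let ?f = "\<lambda>p. (1 - real ?k / real p) / (1 - 1 / real p) ^ ?k"
  have card: "card H \<le> y" using card_mono[OF _ H] by simp
  have finI: "finite ?I" by (rule finite_subset[of _ "{..n}"]) auto
  have set: "{p. prime p \<and> p \<le> n} = {p. prime p \<and> p \<le> N} \<union> ?I" using N by auto
  have "(\<Prod>p | prime p \<and> p \<le> n. 1 - real (occupied p H) / real p) =
     (\<Prod>p | prime p \<and> p \<le> N. 1 - real (occupied p H) / real p) * (\<Prod>p\<in>?I. 1 - real (occupied p H) / real p)"
    unfolding set by (rule prod.union_disjoint) (use finI in auto)
  moreover have "(\<Prod>p\<in>?I. 1 - real (occupied p H) / real p) = (\<Prod>p\<in>?I. 1 - real ?k / real p)"
    using N by (intro prod.cong refl) (simp add: occupied_eq[OF H])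
  moreover have "mertens_prod n = mertens_prod N * (\<Prod>p\<in>?I. 1 - 1 / real p)"
    unfolding mertens_prod_def set by (rule prod.union_disjoint) (use finI in auto)
  ultimately have eq: "partial_series n H = partial_series N H * (\<Prod>p\<in>?I. ?f p)"
    by (simp only: partial_series_def prod_dividef power_mult_distrib prod_power_distrib times_divide_times_eq)
  have kp: "?k \<le> p" "p \<ge> 2" if "p \<in> ?I" for p using that N card by (auto dest: prime_ge_2_nat)
  note fb = series_factor_bounds[OF kp]
  have f0: "0 \<le> 1 - (real ?k)\<^sup>2 / (real p)\<^sup>2" if "p \<in> ?I" for p
  proof -
    have "(real ?k)\<^sup>2 \<le> (real p)\<^sup>2" using kp[OF that] by (intro power_mono) (simp_all only: of_nat_le_iff of_nat_0_le_iff)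
    then show ?thesis using kp[OF that] by simp
  qed
  have "(\<Prod>p\<in>?I. ?f p) \<le> 1"
    using fb f0 by (intro prod_le_1) (auto intro: order_trans)
  then show "partial_series n H \<le> partial_series N H"
    unfolding eq using partial_series_nonneg[of N H] by (simp add: mult_left_le)
  have "(\<Sum>p\<in>?I. 1 / (real p)\<^sup>2) \<le> (\<Sum>p\<in>{N<..n}. 1 / (real p)\<^sup>2)" by (intro sum_mono2) auto
  also have "\<dots> \<le> 1 / real N - 1 / real n" using N by (intro sum_inverse_squares_tail) auto
  also have "\<dots> \<le> 1 / real N" by simp
  finally have "(real ?k)\<^sup>2 * (\<Sum>p\<in>?I. 1 / (real p)\<^sup>2) \<le> (real ?k)\<^sup>2 * (1 / real N)" by (intro mult_left_mono) auto
  then have "1 - (real ?k)\<^sup>2 / real N \<le> 1 - (\<Sum>p\<in>?I. (real ?k)\<^sup>2 / (real p)\<^sup>2)"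
    by (simp add: sum_distrib_left)
  also have "\<dots> \<le> (\<Prod>p\<in>?I. 1 - (real ?k)\<^sup>2 / (real p)\<^sup>2)"
    using f0 finI by (intro prod_one_minus_ge) auto
  also have "\<dots> \<le> (\<Prod>p\<in>?I. ?f p)" using fb f0 by (intro prod_mono) auto
  finally show "partial_series N H * (1 - real ?k ^ 2 / real N) \<le> partial_series n H"
    unfolding eq using partial_series_nonneg[of N H] by (intro mult_left_mono) auto
qed

text \<open>Cut at \<open>y\<close> and bound the numerator by 1. Each element of the tuple thus
  costs \<open>1 / mertens_prod y\<close>, at most a power of \<open>ln y\<close>, which is
  affordable because \<open>lam\<close> is larger.\<close>

lemma partial_series_le_power:
  assumes "H \<subseteq> {1..y}" "y \<le> N" "1 \<le> y"
  shows "partial_series N H \<le> (1 / mertens_prod y) ^ Suc (card H)"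
proof -
  have "partial_series N H \<le> partial_series y H" by (rule partial_series_extend[where y = y]) (use assms in auto)
  also have "\<dots> \<le> 1 / mertens_prod y ^ Suc (card H)"
    unfolding partial_series_def using mertens_prod_pos[of y]
    by (intro divide_right_mono prod_le_1) (auto simp: divide_le_eq_1 occupied_le prime_gt_0_nat)
  finally show ?thesis by (simp add: power_divide)
qed

text \<open>The local factors at \<open>p > y\<close> are \<open>1 + O(k^2 / p^2)\<close>, so the
  product converges absolutely; zero factors at small primes are compatible with
  \<open>convergent_prod\<close>.\<close>

lemma partial_series_tendsto:
  assumes H: "H \<subseteq> {1..y}"
  shows "(\<lambda>n. partial_series n H) \<longlonglongrightarrow> singular_series (insert 0 (int ` H))"
proof -
  let ?k = "Suc (card H)"
  define g where "g = (\<lambda>p::nat. if prime p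
       then (1 - real (card ((\<lambda>h. h mod int p) ` insert 0 (int ` H))) / real p)
           * (1 - 1 / real p) powi (- int (card (insert 0 (int ` H)))) else 1)"
  have finH: "finite H" "0 \<notin> H" using H finite_subset by auto
  have "0 \<notin> int ` H" using finH by auto
  then have ck: "card (insert 0 (int ` H)) = ?k" using finH by (simp add: card_image)
  have "(\<lambda>h. h mod int p) ` insert 0 (int ` H) = int ` ((\<lambda>h. h mod p) ` insert 0 H)" for p
    by (auto simp: image_image zmod_int)
  then have occ: "card ((\<lambda>h. h mod int p) ` insert 0 (int ` H)) = occupied p H" for p
    unfolding occupied_def by (simp only: card_image[OF inj_on_of_nat])
  have g: "g p = (if prime p then (1 - real (occupied p H) / real p) / (1 - 1 / real p) ^ ?k else 1)" for p
    unfolding g_def occ ck by (simp only: power_int_minus power_int_of_nat divide_inverse)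
  have card: "card H \<le> y" using card_mono[OF _ H] by simp
  have bound: "norm (g p - 1) \<le> (real ?k)\<^sup>2 * (1 / (real p)\<^sup>2)" if "p > y" for p
  proof (cases "prime p")
    case True
    then have "p \<ge> 2" by (rule prime_ge_2_nat)
    then show ?thesis
      using series_factor_bounds[of ?k p] True that card by (simp add: g occupied_eq[OF H])
  qed (simp add: g)
  have "summable (\<lambda>p. norm (g p - 1))"
  proof (rule summable_comparison_test_ev)
    show "\<forall>\<^sub>F p in sequentially. norm (norm (g p - 1)) \<le> (real ?k)\<^sup>2 * (1 / (real p)\<^sup>2)"
      using eventually_gt_at_top[of y] by eventually_elim (use bound in simp)
    show "summable (\<lambda>p. (real ?k)\<^sup>2 * (1 / (real p)\<^sup>2))"
      using inverse_power_summable[of 2, where ?'a = real] by (intro summable_mult) (simp add: inverse_eq_divide)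
  qed
  then have "convergent_prod g"
    by (intro abs_convergent_prod_imp_convergent_prod) (simp add: abs_convergent_prod_conv_summable)
  then have "(\<lambda>n. \<Prod>i\<le>n. g i) \<longlonglongrightarrow> prodinf g" by (rule convergent_prod_LIMSEQ)
  moreover have "(\<Prod>i\<le>n. g i) = partial_series n H" for n
  proof -
    have "(\<Prod>i\<le>n. g i) = (\<Prod>i | i \<in> {..n} \<and> prime i. (1 - real (occupied i H) / real i) / (1 - 1 / real i) ^ ?k)"
      unfolding g by (rule prod.inter_filter[symmetric]) simp
    also have "{i. i \<in> {..n} \<and> prime i} = {p. prime p \<and> p \<le> n}" by auto
    finally show ?thesis by (simp only: partial_series_def mertens_prod_def prod_dividef prod_power_distrib)
  qed
  ultimately show ?thesis by (simp add: singular_series_def g_def)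
qed

lemma singular_series_bounds:
  assumes "H \<subseteq> {1..y}" "y \<le> N" "1 \<le> N"
  shows "singular_series (insert 0 (int ` H)) \<le> partial_series N H"
    and "partial_series N H * (1 - real (Suc (card H))^2 / real N) \<le> singular_series (insert 0 (int ` H))"
proof -
  have "\<forall>\<^sub>F n in sequentially. partial_series n H \<le> partial_series N H"
    using eventually_ge_at_top[of N] by eventually_elim (use assms in \<open>rule partial_series_extend(1)\<close>)
  then show "singular_series (insert 0 (int ` H)) \<le> partial_series N H"
    by (rule tendsto_upperbound[OF partial_series_tendsto[OF assms(1)]]) simp
  have "\<forall>\<^sub>F n in sequentially. partial_series N H * (1 - real (Suc (card H))^2 / real N) \<le> partial_series n H"
    using eventually_ge_at_top[of N] by eventually_elim (use assms in \<open>rule partial_series_extend(2)\<close>)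
  then show "partial_series N H * (1 - real (Suc (card H))^2 / real N) \<le> singular_series (insert 0 (int ` H))"
    by (rule tendsto_lowerbound[OF partial_series_tendsto[OF assms(1)]]) simp
qed

section \<open>Truncated sums of singular series\<close>

text \<open>At \<open>u = 1 / ln t\<close> this is the density near \<open>t\<close> that the tuple
  hypothesis predicts for the Bonferroni sum of order \<open>K\<close>.\<close>

definition trunc_series :: "nat \<Rightarrow> nat \<Rightarrow> real \<Rightarrow> real" where
  "trunc_series K y u = (\<Sum>H | H \<subseteq> {1..y} \<and> card H \<le> K.
     (-1) ^ card H * singular_series (insert 0 (int ` H)) * u ^ Suc (card H))"

lemma finite_bounded_subsets [simp]: "finite {H. H \<subseteq> {1..y::nat} \<and> card H \<le> K}"
  by (rule finite_subset[of _ "Pow {1..y}"]) auto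

lemma sum_Pow_power_card:
  fixes w :: real
  assumes "finite B"
  shows "(\<Sum>H\<in>Pow B. w ^ card H) = (1 + w) ^ card B"
  using sum_Pow_prod[OF assms, of "\<lambda>_. w"] by simp

lemma one_plus_power_le_exp:
  fixes w :: real
  assumes "w \<ge> 0"
  shows "(1 + w) ^ n \<le> exp (w * real n)"
proof -
  have "(1 + w) ^ n \<le> exp w ^ n" using assms by (intro power_mono exp_ge_add_one_self) auto
  then show ?thesis by (simp add: exp_of_nat_mult[symmetric] mult.commute)
qed

text \<open>Each \<open>H\<close> is charged \<open>y^(K - card H) \<ge> 1\<close>; by the binomial
  theorem the charges of all subsets add up to \<open>y^K (1 + 1/y)^y\<close>.\<close>

lemma card_bounded_subsets:
  assumes "y \<ge> 1"
  shows "real (card {H. H \<subseteq> {1..y} \<and> card H \<le> K}) \<le> exp 1 * real y ^ K"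
proof -
  have y: "real y > 0" using assms by simp
  have "real (card {H. H \<subseteq> {1..y} \<and> card H \<le> K}) = (\<Sum>H | H \<subseteq> {1..y} \<and> card H \<le> K. 1)" by simp
  also have "\<dots> \<le> (\<Sum>H | H \<subseteq> {1..y} \<and> card H \<le> K. real y ^ K * (1 / real y) ^ card H)"
  proof (intro sum_mono)
    fix H assume "H \<in> {H. H \<subseteq> {1..y} \<and> card H \<le> K}"
    then have "real y ^ card H \<le> real y ^ K" using assms by (intro power_increasing) auto
    then show "1 \<le> real y ^ K * (1 / real y) ^ card H" using y by (simp add: power_divide)
  qed
  also have "\<dots> \<le> (\<Sum>H\<in>Pow {1..y}. real y ^ K * (1 / real y) ^ card H)"
    by (intro sum_mono2) auto
  also have "\<dots> = real y ^ K * (1 + 1 / real y) ^ y"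
    using sum_Pow_power_card[of "{1..y}" "1 / real y"] by (simp only: sum_distrib_left[symmetric]) simp
  also have "\<dots> \<le> real y ^ K * exp (1 / real y * real y)"
    by (intro mult_left_mono one_plus_power_le_exp) auto
  finally show ?thesis using y by (simp add: mult.commute)
qed

lemma singular_series_le:
  assumes "H \<subseteq> {1..y}" "1 \<le> y"
  shows "0 \<le> singular_series (insert 0 (int ` H))"
    and "singular_series (insert 0 (int ` H)) \<le> (1 / mertens_prod y) ^ Suc (card H)"
proof -
  show "0 \<le> singular_series (insert 0 (int ` H))"
    by (rule tendsto_lowerbound[OF partial_series_tendsto[OF assms(1)]]) (simp_all add: partial_series_nonneg)
  have "singular_series (insert 0 (int ` H)) \<le> partial_series y H"
    by (rule singular_series_bounds[OF assms(1)]) (use assms in auto)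
  also have "\<dots> \<le> (1 / mertens_prod y) ^ Suc (card H)"
    by (rule partial_series_le_power[OF assms(1)]) (use assms in auto)
  finally show "singular_series (insert 0 (int ` H)) \<le> (1 / mertens_prod y) ^ Suc (card H)" .
qed

text \<open>A trivial bound, meant for the short range of small \<open>t\<close>, where
  \<open>1 / ln t\<close> is not small.\<close>

lemma abs_trunc_series_le:
  assumes "1 \<le> y" "0 \<le> u" "u / mertens_prod y \<le> W" "1 \<le> W"
  shows "\<bar>trunc_series K y u\<bar> \<le> exp 1 * real y ^ K * W ^ Suc K"
proof -
  have "\<bar>trunc_series K y u\<bar> \<le> (\<Sum>H | H \<subseteq> {1..y} \<and> card H \<le> K. W ^ Suc K)"
    unfolding trunc_series_def
  proof (rule order_trans[OF sum_abs], intro sum_mono)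
    fix H assume H: "H \<in> {H. H \<subseteq> {1..y} \<and> card H \<le> K}"
    then have sub: "H \<subseteq> {1..y}" by simp
    have "\<bar>(-1) ^ card H * singular_series (insert 0 (int ` H)) * u ^ Suc (card H)\<bar> =
       singular_series (insert 0 (int ` H)) * u ^ Suc (card H)"
      using assms singular_series_le(1)[OF sub assms(1)] by (simp add: abs_mult power_abs)
    also have "\<dots> \<le> (1 / mertens_prod y) ^ Suc (card H) * u ^ Suc (card H)"
      using assms by (intro mult_right_mono singular_series_le(2)[OF sub]) auto
    also have "\<dots> = (u / mertens_prod y) ^ Suc (card H)" by (simp add: power_mult_distrib[symmetric])
    also have "\<dots> \<le> W ^ Suc (card H)" using assms mertens_prod_pos[of y] by (intro power_mono) auto
    also have "\<dots> \<le> W ^ Suc K" using assms H by (intro power_increasing) auto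
    finally show "\<bar>(-1) ^ card H * singular_series (insert 0 (int ` H)) * u ^ Suc (card H)\<bar> \<le> W ^ Suc K" .
  qed
  also have "\<dots> = real (card {H. H \<subseteq> {1..y} \<and> card H \<le> K}) * W ^ Suc K" by simp
  also have "\<dots> \<le> exp 1 * real y ^ K * W ^ Suc K"
    using assms by (intro mult_right_mono card_bounded_subsets) auto
  finally show ?thesis .
qed

text \<open>Extended to all subsets, and with \<open>partial_series Z\<close> for the singular
  series, the sum is exactly the sieve functional; \<open>w\<close> bounds the weight per element.
  Cutting the product costs a relative \<open>(K+1)^2 / Z\<close> of the absolute sum, which is at
  most \<open>exp (w y)\<close>. Subsets with more than \<open>K\<close> elements are charged
  \<open>exp (card H - K)\<close>.\<close>

lemma trunc_series_lower:
  assumes y: "1 \<le> y" "y \<le> Z" and u: "0 \<le> u" and w: "w = u / mertens_prod y" "w \<le> 1"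
  shows "trunc_series K y u \<ge> u / mertens_prod Z * sieve_sum {p. prime p \<and> p \<le> Z} (u / mertens_prod Z) {1..y}
     - (real (Suc K)^2 / real Z * exp (w * real y) + exp (- real K) * exp (exp 1 * w * real y))"
proof -
  let ?F = "{H. H \<subseteq> {1..y} \<and> card H \<le> K}"
  let ?G = "Pow {1..y} - ?F"
  have w0: "w \<ge> 0" using u mertens_prod_pos[of y] w by simp
  have Z: "real Z > 0" using y by simp
  have split: "Pow {1..y} = ?F \<union> ?G" by auto
  have PSu: "partial_series Z H * u ^ Suc (card H) \<le> w ^ Suc (card H)" if "H \<subseteq> {1..y}" for H
  proof -
    have "partial_series Z H * u ^ Suc (card H) \<le> (1 / mertens_prod y) ^ Suc (card H) * u ^ Suc (card H)"
      using y u by (intro mult_right_mono partial_series_le_power that) auto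
    also have "\<dots> = (1 / mertens_prod y * u) ^ Suc (card H)" by (simp only: power_mult_distrib)
    finally show ?thesis by (simp add: w)
  qed
  have "u / mertens_prod Z * sieve_sum {p. prime p \<and> p \<le> Z} (u / mertens_prod Z) {1..y} =
     (\<Sum>H\<in>Pow {1..y}. (-1) ^ card H * partial_series Z H * u ^ Suc (card H))"
    unfolding sieve_sum_def sum_distrib_left
  proof (intro sum.cong refl)
    fix H
    let ?c = "(\<Prod>p | prime p \<and> p \<le> Z. 1 - real (occupied p H) / real p)"
    have "(- (u / mertens_prod Z)) ^ card H = (-1) ^ card H * (u / mertens_prod Z) ^ card H"
      by (metis power_minus)
    then have "u / mertens_prod Z * ((- (u / mertens_prod Z)) ^ card H * ?c) =
      (-1) ^ card H * (u / mertens_prod Z) ^ Suc (card H) * ?c" by simp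
    then show "u / mertens_prod Z * ((- (u / mertens_prod Z)) ^ card H * ?c) =
      (-1) ^ card H * partial_series Z H * u ^ Suc (card H)"
      by (simp add: partial_series_def power_divide)
  qed
  also have "\<dots> = (\<Sum>H\<in>?F. (-1) ^ card H * partial_series Z H * u ^ Suc (card H)) +
     (\<Sum>H\<in>?G. (-1) ^ card H * partial_series Z H * u ^ Suc (card H))"
    by (subst split, rule sum.union_disjoint) auto
  finally have total: "u / mertens_prod Z * sieve_sum {p. prime p \<and> p \<le> Z} (u / mertens_prod Z) {1..y} =
     (\<Sum>H\<in>?F. (-1) ^ card H * partial_series Z H * u ^ Suc (card H)) +
     (\<Sum>H\<in>?G. (-1) ^ card H * partial_series Z H * u ^ Suc (card H))" .
  have "(\<Sum>H\<in>?F. (-1) ^ card H * partial_series Z H * u ^ Suc (card H)) \<le>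
     (\<Sum>H\<in>?F. (-1) ^ card H * singular_series (insert 0 (int ` H)) * u ^ Suc (card H)
        + real (Suc K)^2 / real Z * w ^ Suc (card H))"
  proof (intro sum_mono)
    fix H assume H: "H \<in> ?F"
    let ?S = "singular_series (insert 0 (int ` H))" and ?P = "partial_series Z H"
    have sub: "H \<subseteq> {1..y}" using H by simp
    have b: "?S \<le> ?P" "?P * (1 - real (Suc (card H))^2 / real Z) \<le> ?S"
      by (rule singular_series_bounds[OF sub]; use y in simp)+
    have "real (Suc (card H))^2 \<le> real (Suc K)^2" using H by (intro power_mono) auto
    then have "real (Suc (card H))^2 / real Z \<le> real (Suc K)^2 / real Z" by (intro divide_right_mono) auto
    then have "?P * (real (Suc (card H))^2 / real Z) \<le> ?P * (real (Suc K)^2 / real Z)"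
      using partial_series_nonneg by (intro mult_left_mono)
    moreover have "?P - ?S \<le> ?P * (real (Suc (card H))^2 / real Z)" using b(2) by (simp only: algebra_simps)
    ultimately have "\<bar>?P - ?S\<bar> \<le> ?P * (real (Suc K)^2 / real Z)" using b(1) by linarith
    then have "(-1) ^ card H * (?P - ?S) \<le> ?P * (real (Suc K)^2 / real Z)"
      by (cases "even (card H)") auto
    then have "((-1) ^ card H * (?P - ?S)) * u ^ Suc (card H) \<le> ?P * (real (Suc K)^2 / real Z) * u ^ Suc (card H)"
      using u by (intro mult_right_mono) auto
    also have "\<dots> = real (Suc K)^2 / real Z * (?P * u ^ Suc (card H))" by simp
    also have "\<dots> \<le> real (Suc K)^2 / real Z * w ^ Suc (card H)"
      by (intro mult_left_mono PSu sub) auto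
    finally show "(-1) ^ card H * ?P * u ^ Suc (card H) \<le> (-1) ^ card H * ?S * u ^ Suc (card H)
        + real (Suc K)^2 / real Z * w ^ Suc (card H)" by (simp only: algebra_simps)
  qed
  also have "\<dots> = trunc_series K y u + real (Suc K)^2 / real Z * (\<Sum>H\<in>?F. w ^ Suc (card H))"
    by (simp only: trunc_series_def sum.distrib sum_distrib_left)
  finally have small: "(\<Sum>H\<in>?F. (-1) ^ card H * partial_series Z H * u ^ Suc (card H)) \<le>
     trunc_series K y u + real (Suc K)^2 / real Z * (\<Sum>H\<in>?F. w ^ Suc (card H))" .
  have "(\<Sum>H\<in>?F. w ^ Suc (card H)) \<le> (\<Sum>H\<in>Pow {1..y}. w ^ card H)"
  proof -
    have "(\<Sum>H\<in>?F. w ^ Suc (card H)) \<le> (\<Sum>H\<in>?F. w ^ card H)"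
      using w0 w by (intro sum_mono power_decreasing) auto
    also have "\<dots> \<le> (\<Sum>H\<in>Pow {1..y}. w ^ card H)" using w0 by (intro sum_mono2) auto
    finally show ?thesis .
  qed
  also have "\<dots> = (1 + w) ^ y" by (subst sum_Pow_power_card) auto
  also have "\<dots> \<le> exp (w * real y)" by (rule one_plus_power_le_exp[OF w0])
  finally have "real (Suc K)^2 / real Z * (\<Sum>H\<in>?F. w ^ Suc (card H)) \<le> real (Suc K)^2 / real Z * exp (w * real y)"
    by (intro mult_left_mono) auto
  moreover have "(\<Sum>H\<in>?G. (-1) ^ card H * partial_series Z H * u ^ Suc (card H)) \<le>
     exp (- real K) * exp (exp 1 * w * real y)"
  proof -
  have "(\<Sum>H\<in>?G. (-1) ^ card H * partial_series Z H * u ^ Suc (card H)) \<le>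
     (\<Sum>H\<in>?G. exp (- real K) * (exp 1 * w) ^ card H)"
  proof (intro sum_mono)
    fix H assume H: "H \<in> ?G"
    then have sub: "H \<subseteq> {1..y}" and K: "K \<le> card H" by auto
    have "(-1) ^ card H * partial_series Z H * u ^ Suc (card H) \<le> partial_series Z H * u ^ Suc (card H)"
      using partial_series_nonneg[of Z H] u by (cases "even (card H)") (auto simp: mult_nonneg_nonneg)
    also have "\<dots> \<le> w ^ Suc (card H)" by (rule PSu[OF sub])
    also have "\<dots> \<le> w ^ card H" using w0 w by (intro power_decreasing) auto
    also have "\<dots> \<le> exp (real (card H) - real K) * w ^ card H"
      using K w0 mult_right_mono[of 1 "exp (real (card H) - real K)" "w ^ card H"] by simp
    also have "\<dots> = exp (- real K) * (exp 1 * w) ^ card H"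
      by (simp add: power_mult_distrib exp_diff exp_minus exp_of_nat_mult[of _ 1, simplified] field_simps)
    finally show "(-1) ^ card H * partial_series Z H * u ^ Suc (card H) \<le> exp (- real K) * (exp 1 * w) ^ card H" .
  qed
  also have "\<dots> \<le> (\<Sum>H\<in>Pow {1..y}. exp (- real K) * (exp 1 * w) ^ card H)"
    using w0 by (intro sum_mono2) auto
  also have "\<dots> = exp (- real K) * (1 + exp 1 * w) ^ y"
    by (simp only: sum_distrib_left[symmetric], subst sum_Pow_power_card) auto
  also have "\<dots> \<le> exp (- real K) * exp (exp 1 * w * real y)"
    using w0 by (intro mult_left_mono one_plus_power_le_exp) auto
  finally show ?thesis .
  qed
  ultimately show ?thesis using total small by linarith
qed

lemma survival_nonneg:
  assumes "\<And>p. p \<in> P \<Longrightarrow> p \<ge> 2"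
  shows "survival P h \<ge> 0"
  unfolding survival_def
proof (intro prod_nonneg)
  fix p assume "p \<in> P"
  then have "real p - 1 \<ge> 1" using assms[of p] by simp
  then show "0 \<le> 1 - (if p dvd h then 0 else 1 / (real p - 1))" by simp
qed

text \<open>A prime not dividing \<open>h\<close> has the factor
  \<open>1 - 1/(p-1) \<le> 1 - 1/p\<close>. A prime dividing \<open>h\<close> contributes 1 instead,
  an excess of at most \<open>exp (2 / N)\<close>, and at most \<open>2 ln y\<close> primes divide
  \<open>h\<close>.\<close>

lemma survival_le:
  assumes "N \<ge> 2" "1 \<le> h" "h \<le> y"
  shows "survival {p. prime p \<and> N < p \<and> p \<le> Z} h \<le>
    (\<Prod>p | prime p \<and> N < p \<and> p \<le> Z. 1 - 1 / real p) * exp (4 * ln (real y) / real N)"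
proof -
  let ?R = "{p. prime p \<and> N < p \<and> p \<le> Z}"
  let ?D = "{p \<in> ?R. p dvd h}"
  have fin: "finite ?R" by (rule finite_subset[of _ "{..Z}"]) auto
  have "survival ?R h \<le> (\<Prod>p\<in>?R. (1 - 1 / real p) * (if p dvd h then exp (2 / real N) else 1))"
    unfolding survival_def
  proof (intro prod_mono conjI)
    fix p assume p: "p \<in> ?R"
    have p2: "real p \<ge> 3" "real N < real p" using p assms by auto
    show "0 \<le> 1 - (if p dvd h then 0 else 1 / (real p - 1))" using p2 by auto
    show "1 - (if p dvd h then 0 else 1 / (real p - 1)) \<le> (1 - 1 / real p) * (if p dvd h then exp (2 / real N) else 1)"
    proof (cases "p dvd h")
      case True
      have "1 \<le> (1 - 1 / real p) * (1 + 2 / real p)" using p2 by (simp add: field_simps)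
      also have "\<dots> \<le> (1 - 1 / real p) * exp (2 / real N)"
      proof (intro mult_left_mono)
        have "1 + 2 / real p \<le> 1 + 2 / real N" using p2 assms by (intro add_left_mono divide_left_mono) auto
        also have "\<dots> \<le> exp (2 / real N)" by (rule exp_ge_add_one_self)
        finally show "1 + 2 / real p \<le> exp (2 / real N)" .
      qed (use p2 in auto)
      finally show ?thesis using True by simp
    next
      case False
      have "1 / real p \<le> 1 / (real p - 1)" using p2 by (intro divide_left_mono) auto
      then show ?thesis using False by simp
    qed
  qed
  also have "\<dots> = (\<Prod>p\<in>?R. 1 - 1 / real p) * exp (2 / real N) ^ card ?D"
    using fin by (simp add: prod.distrib prod.inter_filter[symmetric])
  finally have 1: "survival ?R h \<le> (\<Prod>p\<in>?R. 1 - 1 / real p) * exp (2 / real N) ^ card ?D" .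
  have 2: "exp (2 / real N) ^ card ?D \<le> exp (4 * ln (real y) / real N)"
  proof -
    have "2 ^ card ?D = (\<Prod>p\<in>?D. 2::nat)" by simp
    also have "\<dots> \<le> \<Prod>?D" by (intro prod_mono) (auto dest: prime_ge_2_nat)
    also have "\<dots> \<le> h" using fin assms by (intro dvd_imp_le prod_primes_dvd) auto
    finally have "2 ^ card ?D \<le> y" using assms by simp
    then have "real (2 ^ card ?D) \<le> real y" by (simp only: of_nat_le_iff)
    then have "ln (2 ^ card ?D) \<le> ln (real y)" by (intro ln_mono) auto
    then have "real (card ?D) * ln 2 \<le> ln (real y)" by (simp add: ln_realpow)
    moreover have "real (card ?D) * (1/2) \<le> real (card ?D) * ln 2"
      using ln2_ge_two_thirds by (intro mult_left_mono) auto
    ultimately have "real (card ?D) \<le> 2 * ln (real y)" by simp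
    then have "real (card ?D) * (2 / real N) \<le> 2 * ln (real y) * (2 / real N)" by (intro mult_right_mono) auto
    then show ?thesis by (simp add: exp_of_nat_mult[symmetric])
  qed
  have 3: "0 \<le> (\<Prod>p\<in>?R. 1 - 1 / real p)" using assms by (intro prod_nonneg) auto
  show ?thesis by (rule order_trans[OF 1 mult_left_mono[OF 2 3]])
qed

text \<open>The primes up to \<open>N\<close> get prescribed classes, an event of probability at
  least \<open>N^(- N)\<close>, and Jensen handles the others. The expected number of survivors is
  then about \<open>(1 - \<delta>) * mertens_prod Z * y\<close>; as
  \<open>q * mertens_prod Z = u\<close>, the main term does not depend on \<open>Z\<close>.\<close>

lemma sieve_sum_lower:
  fixes u q \<delta> :: real
  assumes N: "2 \<le> N" "N \<le> Z" and y: "1 \<le> y" and u: "0 < u"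
    and q: "q = u / mertens_prod Z" "q \<le> 1 / 2" and \<delta>: "\<delta> \<le> 1"
    and m: "\<And>p. prime p \<Longrightarrow> p \<le> N \<Longrightarrow> \<not> p dvd m"
    and sift: "real (sift_count {p. prime p \<and> p \<le> N} m y) \<le> (1 - \<delta>) * mertens_prod N * real y"
  shows "q * sieve_sum {p. prime p \<and> p \<le> Z} q {1..y} \<ge>
    u * exp (- real N * ln (real N)) * exp (- ((1 + 2 * q) * (1 - \<delta>) * (u * real y) * exp (4 * ln (real y) / real N)))"
proof -
  let ?P = "{p. prime p \<and> p \<le> N}"
  let ?R = "{p. prime p \<and> N < p \<and> p \<le> Z}"
  let ?B = "{h \<in> {1..y}. \<forall>p\<in>?P. \<not> p dvd m + h}"
  define V where "V = (\<Prod>p\<in>?R. 1 - 1 / real p)"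
  define E where "E = exp (4 * ln (real y) / real N)"
  have fin: "finite ?R" by (rule finite_subset[of _ "{..Z}"]) auto
  have set: "{p. prime p \<and> p \<le> Z} = ?P \<union> ?R" using N by auto
  have MZ: "mertens_prod Z = mertens_prod N * V"
    unfolding mertens_prod_def V_def set by (rule prod.union_disjoint) (use fin in auto)
  have M: "0 < mertens_prod N" "mertens_prod N \<le> 1" "0 < mertens_prod Z" by (auto simp: mertens_prod_pos mertens_prod_le_1)
  then have V: "V > 0" using MZ by (metis zero_less_mult_pos)
  then have MV: "mertens_prod Z \<le> V" unfolding MZ using M by (simp add: mult_le_cancel_right1)
  have q0: "0 < q" using u q M by simp
  \<comment> \<open>Jensen needs \<open>(1 - q)^k\<close> as an exponential; the price is
    \<open>c \<le> q (1 + 2 q)\<close> in place of \<open>q\<close>.\<close>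
  define c where "c = - ln (1 - q)"
  have c: "0 \<le> c" "1 - exp (- c) = q" using q0 q(2) by (auto simp: c_def)
  have cq: "c \<le> q * (1 + 2 * q)"
    using ln_one_minus_pos_lower_bound[of q] q0 q(2) by (simp add: c_def algebra_simps power2_eq_square)
  have "(\<Sum>h\<in>?B. survival ?R h) \<le> (\<Sum>h\<in>?B. V * E)"
    unfolding V_def E_def using N by (intro sum_mono survival_le) auto
  also have "\<dots> = real (sift_count ?P m y) * (V * E)" by (simp add: sift_count_def)
  also have "\<dots> \<le> ((1 - \<delta>) * mertens_prod N * real y) * (V * E)"
    using sift V by (intro mult_right_mono) (auto simp: E_def)
  finally have surv: "(\<Sum>h\<in>?B. survival ?R h) \<le> (1 - \<delta>) * mertens_prod Z * real y * E" by (simp add: MZ mult_ac)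
  have "c * (\<Sum>h\<in>?B. survival ?R h) \<le> q * (1 + 2 * q) * ((1 - \<delta>) * mertens_prod Z * real y * E)"
    using cq surv c N by (intro mult_mono' sum_nonneg survival_nonneg) auto
  also have "\<dots> = (1 + 2 * q) * (1 - \<delta>) * (u * real y) * E" using M by (simp add: q(1))
  finally have expo: "c * (\<Sum>h\<in>?B. survival ?R h) \<le> (1 + 2 * q) * (1 - \<delta>) * (u * real y) * E" .
  \<comment> \<open>The number of primes is bounded by \<open>N\<close> itself; the lost logarithm
    is later covered by a factor \<open>exp (2 \<epsilon> s)\<close>.\<close>
  have prodN: "exp (- real N * ln (real N)) \<le> (\<Prod>p\<in>?P. 1 / real p)"
  proof -
    have "?P \<subseteq> {1..N}" using prime_ge_1_nat by auto
    then have "card ?P \<le> card {1..N}" by (intro card_mono) auto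
    then have cardP: "card ?P \<le> N" by simp
    have "exp (- real N * ln (real N)) = (1 / real N) ^ N"
      using N by (simp add: exp_minus power_divide inverse_eq_divide exp_of_nat_mult)
    also have "\<dots> \<le> (1 / real N) ^ card ?P" using N cardP by (intro power_decreasing) auto
    also have "\<dots> = (\<Prod>p\<in>?P. 1 / real N)" by simp
    also have "\<dots> \<le> (\<Prod>p\<in>?P. 1 / real p)"
      using N by (intro prod_mono) (auto intro!: divide_left_mono mult_pos_pos dest: prime_gt_0_nat)
    finally show ?thesis .
  qed
  have "u * exp (- real N * ln (real N)) * exp (- ((1 + 2 * q) * (1 - \<delta>) * (u * real y) * E)) \<le>
    u * exp (- real N * ln (real N)) * exp (- (c * (\<Sum>h\<in>?B. survival ?R h)))"
    using expo u by (intro mult_left_mono) auto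
  also have "\<dots> \<le> (q * V) * (\<Prod>p\<in>?P. 1 / real p) * exp (- (c * (\<Sum>h\<in>?B. survival ?R h)))"
  proof (intro mult_right_mono mult_mono prodN)
    have "u = q * mertens_prod Z" using q M by simp
    also have "\<dots> \<le> q * V" using MV q0 by (intro mult_left_mono) auto
    finally show "u \<le> q * V" .
  qed (use q0 V in auto)
  also have "\<dots> = q * ((\<Prod>p\<in>?P. 1 / real p) * (V * exp (- c * (\<Sum>h\<in>?B. survival ?R h))))" by (simp add: mult_ac)
  also have "\<dots> \<le> q * ((\<Prod>p\<in>?P. 1 / real p) * sieve_sum ?R q ?B)"
  proof (intro mult_left_mono)
    have "V * exp (- c * (\<Sum>h\<in>?B. survival ?R h)) \<le> sieve_sum ?R (1 - exp (- c)) ?B"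
      unfolding V_def using fin c by (intro sieve_sum_jensen) (auto dest: prime_ge_2_nat)
    then show "V * exp (- c * (\<Sum>h\<in>?B. survival ?R h)) \<le> sieve_sum ?R q ?B" by (simp only: c(2))
  qed (use q0 in \<open>auto intro!: prod_nonneg\<close>)
  also have "\<dots> \<le> q * sieve_sum (?P \<union> ?R) q {1..y}"
    using q0 q(2) fin m by (intro mult_left_mono sieve_sum_restrict) (auto dest: prime_gt_0_nat)
  finally show ?thesis unfolding set E_def .
qed

section \<open>Counting gaps\<close>

lemma integral_ge_const:
  fixes f :: "real \<Rightarrow> real"
  assumes "continuous_on {a..b} f" "a \<le> b" "\<And>t. a \<le> t \<Longrightarrow> t \<le> b \<Longrightarrow> c \<le> f t"
  shows "(b - a) * c \<le> integral {a..b} f"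
proof -
  have "integral {a..b} (\<lambda>_. c) \<le> integral {a..b} f"
    using assms by (intro integral_le integrable_continuous_real) auto
  then show ?thesis using assms(2) by simp
qed

lemma integral_ge_piecewise:
  fixes f :: "real \<Rightarrow> real"
  assumes cont: "continuous_on {2..x} f" and ab: "2 \<le> a" "a \<le> b" "b \<le> x"
    and E: "0 \<le> E1" "0 \<le> E2"
    and f1: "\<And>t. 2 \<le> t \<Longrightarrow> t \<le> a \<Longrightarrow> - E1 \<le> f t"
    and f2: "\<And>t. a \<le> t \<Longrightarrow> t \<le> b \<Longrightarrow> - E2 \<le> f t"
    and f3: "\<And>t. b \<le> t \<Longrightarrow> t \<le> x \<Longrightarrow> D - E2 \<le> f t"
  shows "(x - b) * D - a * E1 - x * E2 \<le> integral {2..x} f"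
proof -
  have c: "continuous_on {2..a} f" "continuous_on {a..b} f" "continuous_on {b..x} f" "continuous_on {a..x} f"
    using ab by (auto intro!: continuous_on_subset[OF cont])
  have "integral {2..x} f = integral {2..a} f + integral {a..x} f"
    using ab by (intro Henstock_Kurzweil_Integration.integral_combine[symmetric] integrable_continuous_real cont) auto
  also have "integral {a..x} f = integral {a..b} f + integral {b..x} f"
    using ab by (intro Henstock_Kurzweil_Integration.integral_combine[symmetric] integrable_continuous_real c) auto
  finally have eq: "integral {2..x} f = integral {2..a} f + (integral {a..b} f + integral {b..x} f)" .
  have "(a - 2) * - E1 \<le> integral {2..a} f" by (rule integral_ge_const[OF c(1) ab(1) f1])
  moreover have "(b - a) * - E2 \<le> integral {a..b} f" by (rule integral_ge_const[OF c(2) ab(2) f2])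
  moreover have "(x - b) * (D - E2) \<le> integral {b..x} f" by (rule integral_ge_const[OF c(3) ab(3) f3])
  moreover have "(x - b) * D - a * E1 - x * E2 \<le> (a - 2) * - E1 + ((b - a) * - E2 + (x - b) * (D - E2))"
  proof -
    have "(a - 2) * - E1 + ((b - a) * - E2 + (x - b) * (D - E2)) - ((x - b) * D - a * E1 - x * E2) = 2 * E1 + a * E2"
      by (simp add: algebra_simps)
    moreover have "0 \<le> 2 * E1 + a * E2" using E ab by (intro add_nonneg_nonneg mult_nonneg_nonneg) auto
    ultimately show ?thesis by linarith
  qed
  ultimately show ?thesis using eq by linarith
qed

lemma M_count_le_N_count: "M_count A x y \<le> N_count A x y 0"
  unfolding M_count_def N_count_def
proof (rule card_mono)
  show "finite {n. 1 \<le> n \<and> real n \<le> x \<and> card {m \<in> A. real n + 1 \<le> real m \<and> real m \<le> real n + y} = 0}"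
    by (rule finite_subset[of _ "{..nat \<lfloor>x\<rfloor>}"]) (auto simp: le_nat_iff le_floor_iff)
  have "card {m \<in> A. real n + 1 \<le> real m \<and> real m \<le> real n + y} = 0"
    if "{m \<in> A. real n + 1 \<le> real m \<and> real m \<le> real n + y} = {}" for n
    unfolding that by simp
  then show "{n. 1 \<le> n \<and> real n \<le> x \<and> n \<in> A \<and> {m \<in> A. real n + 1 \<le> real m \<and> real m \<le> real n + y} = {}}
    \<subseteq> {n. 1 \<le> n \<and> real n \<le> x \<and> card {m \<in> A. real n + 1 \<le> real m \<and> real m \<le> real n + y} = 0}"
    by blast
qed

lemma M_count_eq:
  assumes "yr \<ge> 0"
  shows "M_count A x yr = card {n \<in> {n. 1 \<le> n \<and> real n \<le> x}. n \<in> A \<and> (\<forall>h\<in>{1..nat \<lfloor>yr\<rfloor>}. n + h \<notin> A)}"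
proof -
  have "{m \<in> A. real n + 1 \<le> real m \<and> real m \<le> real n + yr} = {} \<longleftrightarrow> (\<forall>h\<in>{1..nat \<lfloor>yr\<rfloor>}. n + h \<notin> A)" for n
  proof
    assume *: "{m \<in> A. real n + 1 \<le> real m \<and> real m \<le> real n + yr} = {}"
    show "\<forall>h\<in>{1..nat \<lfloor>yr\<rfloor>}. n + h \<notin> A"
    proof
      fix h assume "h \<in> {1..nat \<lfloor>yr\<rfloor>}"
      then have "1 \<le> h" "real h \<le> yr" using assms by (auto simp: le_nat_iff le_floor_iff)
      then have "real n + 1 \<le> real (n + h)" "real (n + h) \<le> real n + yr" by auto
      then show "n + h \<notin> A" using * by blast
    qed
  next
    assume *: "\<forall>h\<in>{1..nat \<lfloor>yr\<rfloor>}. n + h \<notin> A"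
    have False if "m \<in> A" "real n + 1 \<le> real m" "real m \<le> real n + yr" for m
    proof -
      have "n + 1 \<le> m" using that(2) by linarith
      moreover have "real (m - n) \<le> yr" using that calculation by (simp add: of_nat_diff)
      ultimately have "m - n \<in> {1..nat \<lfloor>yr\<rfloor>}" by (auto simp: le_nat_iff le_floor_iff)
      then have "n + (m - n) \<notin> A" using * by blast
      then show False using that \<open>n + 1 \<le> m\<close> by simp
    qed
    then show "{m \<in> A. real n + 1 \<le> real m \<and> real m \<le> real n + yr} = {}" by auto
  qed
  then show ?thesis unfolding M_count_def by (intro arg_cong[of _ _ card]) auto
qed

lemma continuous_on_trunc_series:
  assumes "S \<subseteq> {1<..}"
  shows "continuous_on S (\<lambda>t. trunc_series K y (1 / ln t))"
  unfolding trunc_series_def using assms by (intro continuous_intros) (auto dest!: subsetD)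

text \<open>Bonferroni with the tuple hypothesis for each \<open>{0} \<union> H\<close>, a set of
  size at most \<open>K + 1 \<le> \<psi>\<close> within \<open>[0, \<phi>]\<close>. The error is
  paid once for each of at most \<open>e y^K\<close> tuples.\<close>

lemma M_count_ge_integral:
  fixes A :: "nat set" and x yr \<phi> \<psi> Err :: real
  assumes HL: "\<And>H :: int set. finite H \<Longrightarrow> (\<forall>h\<in>H. 0 \<le> h \<and> real_of_int h \<le> \<phi>) \<Longrightarrow> real (card H) \<le> \<psi> \<Longrightarrow>
      \<bar>real (card {n. 1 \<le> n \<and> real n \<le> x \<and> (\<forall>h\<in>H. int n + h \<in> int ` A)})
           - singular_series H * integral {2..x} (\<lambda>t. 1 / ln t ^ card H)\<bar> \<le> Err"
    and yr: "1 \<le> yr" "yr \<le> \<phi>" and K: "odd K" "real K + 1 \<le> \<psi>" and Err: "0 \<le> Err" and y: "y = nat \<lfloor>yr\<rfloor>"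
  shows "integral {2..x} (\<lambda>t. trunc_series K y (1 / ln t)) - exp 1 * real y ^ K * Err \<le> real (M_count A x yr)"
proof -
  let ?F = "{H. H \<subseteq> {1..y} \<and> card H \<le> K}"
  let ?X = "{n. 1 \<le> n \<and> real n \<le> x}"
  let ?S = "\<lambda>H. singular_series (insert 0 (int ` H))"
  let ?I = "\<lambda>H. integral {2..x} (\<lambda>t. 1 / ln t ^ Suc (card H))"
  have y1: "1 \<le> y" using yr unfolding y by linarith
  have yyr: "real y \<le> yr" using yr unfolding y by linarith
  have finX: "finite ?X" by (rule finite_subset[of _ "{..nat \<lfloor>x\<rfloor>}"]) (auto simp: le_nat_iff le_floor_iff)
  have integrable: "(\<lambda>t. 1 / ln t ^ k) integrable_on {2..x}" for k
    by (intro integrable_continuous_real continuous_intros) auto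
  have "integral {2..x} (\<lambda>t. trunc_series K y (1 / ln t)) =
    integral {2..x} (\<lambda>t. \<Sum>H\<in>?F. ((-1) ^ card H * ?S H) * (1 / ln t ^ Suc (card H)))"
    by (simp only: trunc_series_def power_one_over)
  also have "\<dots> = (\<Sum>H\<in>?F. integral {2..x} (\<lambda>t. ((-1) ^ card H * ?S H) * (1 / ln t ^ Suc (card H))))"
    by (intro integral_sum finite_bounded_subsets integrable_on_mult_right integrable)
  also have "\<dots> = (\<Sum>H\<in>?F. (-1) ^ card H * (?S H * ?I H))"
    by (simp only: integral_mult_right mult.assoc)
  finally have eq: "integral {2..x} (\<lambda>t. trunc_series K y (1 / ln t)) = (\<Sum>H\<in>?F. (-1) ^ card H * (?S H * ?I H))" .
  have "(\<Sum>H\<in>?F. (-1) ^ card H * (?S H * ?I H)) - (\<Sum>H\<in>?F. Err) \<le>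
    (\<Sum>H\<in>?F. (-1) ^ card H * real (card {n \<in> ?X. \<forall>h\<in>insert 0 H. n + h \<in> A}))"
    unfolding sum_subtractf[symmetric]
  proof (intro sum_mono)
    fix H assume H: "H \<in> ?F"
    have finH: "finite H" "0 \<notin> H" using H finite_subset by auto
    have "0 \<notin> int ` H" using finH by auto
    then have ck: "card (insert 0 (int ` H)) = Suc (card H)" using finH by (simp add: card_image)
    have "real_of_int h \<le> \<phi> \<and> 0 \<le> h" if "h \<in> insert 0 (int ` H)" for h
    proof -
      have "0 \<le> h \<and> h \<le> int y" using that H by auto
      then show ?thesis using yyr yr by linarith
    qed
    moreover have "real (card (insert 0 (int ` H))) \<le> \<psi>" unfolding ck using H K by simp
    ultimately have "\<bar>real (card {n. 1 \<le> n \<and> real n \<le> x \<and> (\<forall>h\<in>insert 0 (int ` H). int n + h \<in> int ` A)}) - ?S H * ?I H\<bar> \<le> Err"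
      using HL[of "insert 0 (int ` H)"] finH by (simp only: ck) auto
    moreover have "{n. 1 \<le> n \<and> real n \<le> x \<and> (\<forall>h\<in>insert 0 (int ` H). int n + h \<in> int ` A)} =
      {n \<in> ?X. \<forall>h\<in>insert 0 H. n + h \<in> A}"
    proof -
      have "int n + int h \<in> int ` A \<longleftrightarrow> n + h \<in> A" for n h
        by (metis inj_image_mem_iff inj_of_nat of_nat_add)
      from this this[of _ 0] show ?thesis by auto
    qed
    ultimately have d: "\<bar>real (card {n \<in> ?X. \<forall>h\<in>insert 0 H. n + h \<in> A}) - ?S H * ?I H\<bar> \<le> Err" by (simp only:)
    show "(-1) ^ card H * (?S H * ?I H) - Err \<le> (-1) ^ card H * real (card {n \<in> ?X. \<forall>h\<in>insert 0 H. n + h \<in> A})"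
    proof (cases "even (card H)")
      case True
      then show ?thesis using d by (simp only: neg_one_even_power mult_1_left; linarith)
    next
      case False
      then have "(-1::real) ^ card H = -1" by (rule neg_one_odd_power)
      then show ?thesis using d by (simp only:; linarith)
    qed
  qed
  also have "\<dots> \<le> real (card {n \<in> ?X. n \<in> A \<and> (\<forall>h\<in>{1..y}. n + h \<notin> A)})"
    using finX K(1) by (intro bonferroni_count) auto
  also have "\<dots> = real (M_count A x yr)" unfolding y using yr by (subst M_count_eq) auto
  finally have "(\<Sum>H\<in>?F. (-1) ^ card H * (?S H * ?I H)) - (\<Sum>H\<in>?F. Err) \<le> real (M_count A x yr)" .
  moreover have "(\<Sum>H\<in>?F. Err) \<le> exp 1 * real y ^ K * Err"
    using card_bounded_subsets[OF y1, of K] Err by (simp add: mult_right_mono)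
  ultimately show ?thesis unfolding eq by linarith
qed

text \<open>The integral is split at \<open>sqrt x\<close> and \<open>x / 2\<close>. Below
  \<open>sqrt x\<close> the trivial bound will do, the range being short; up to \<open>x / 2\<close>
  the sieve functional is taken as merely nonnegative; beyond that \<open>ln t\<close> is within 1
  of \<open>ln x\<close>, so the main term is nearly constant.\<close>

lemma M_count_core:
  fixes A :: "nat set" and x yr \<phi> \<psi> Err \<delta> R q :: real
  assumes HL: "\<And>H :: int set. finite H \<Longrightarrow> (\<forall>h\<in>H. 0 \<le> h \<and> real_of_int h \<le> \<phi>) \<Longrightarrow> real (card H) \<le> \<psi> \<Longrightarrow>
      \<bar>real (card {n. 1 \<le> n \<and> real n \<le> x \<and> (\<forall>h\<in>H. int n + h \<in> int ` A)})
           - singular_series H * integral {2..x} (\<lambda>t. 1 / ln t ^ card H)\<bar> \<le> Err"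
    and yr: "1 \<le> yr" "yr \<le> \<phi>" and K: "odd K" "real K + 1 \<le> \<psi>" and Err: "0 \<le> Err" and y: "y = nat \<lfloor>yr\<rfloor>"
    and x: "16 \<le> x" and N: "2 \<le> N" "N \<le> Z" and yZ: "y \<le> Z"
    and R: "1 / mertens_prod y \<le> R" "2 * R \<le> ln x"
    and q: "2 / (ln x * mertens_prod Z) \<le> q" "q \<le> 1 / 2" and \<delta>: "\<delta> \<le> 1"
    and m: "\<And>p. prime p \<Longrightarrow> p \<le> N \<Longrightarrow> \<not> p dvd m"
    and sift: "real (sift_count {p. prime p \<and> p \<le> N} m y) \<le> (1 - \<delta>) * mertens_prod N * real y"
  shows "x / 2 * (1 / ln x * exp (- real N * ln (real N)) *
        exp (- ((1 + 2 * q) * (1 - \<delta>) * (yr / (ln x - 1)) * exp (4 * ln (real y) / real N))))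
      - sqrt x * (exp 1 * real y ^ K * (2 * R) ^ Suc K)
      - x * (real (Suc K)^2 / real Z * exp (2 * R / ln x * yr) + exp (- real K) * exp (exp 1 * (2 * R / ln x) * yr))
      - exp 1 * real y ^ K * Err \<le> real (M_count A x yr)"
proof -
  have y1: "1 \<le> y" using yr unfolding y by linarith
  have yyr: "real y \<le> yr" using yr unfolding y by linarith
  have M: "mertens_prod y > 0" "mertens_prod Z > 0" by (auto simp: mertens_prod_pos)
  have R1: "1 \<le> R"
  proof -
    have "1 \<le> 1 / mertens_prod y" using M mertens_prod_le_1[of y] by simp
    then show ?thesis using R by linarith
  qed
  have lx: "ln x \<ge> 2" using R R1 by linarith
  define l where "l = ln x"
  have l: "l \<ge> 2" using lx by (simp add: l_def)
  define f where "f = (\<lambda>t. trunc_series K y (1 / ln t))"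
  define E2 where "E2 = real (Suc K)^2 / real Z * exp (2 * R / l * yr) + exp (- real K) * exp (exp 1 * (2 * R / l) * yr)"
  define D where "D = 1 / l * exp (- real N * ln (real N)) *
        exp (- ((1 + 2 * q) * (1 - \<delta>) * (yr / (l - 1)) * exp (4 * ln (real y) / real N)))"
  have cont: "continuous_on {2..x} f" unfolding f_def by (rule continuous_on_trunc_series) auto
  have sx: "4 \<le> sqrt x" "sqrt x * sqrt x = x" using x by (auto intro: real_le_rsqrt)
  have sx2: "sqrt x \<le> x / 2"
  proof -
    have "2 * sqrt x \<le> sqrt x * sqrt x" using sx by (intro mult_right_mono) auto
    then show ?thesis using sx by simp
  qed
  have mid: "u / mertens_prod Z * sieve_sum {p. prime p \<and> p \<le> Z} (u / mertens_prod Z) {1..y} - E2 \<le> f t \<and> u / mertens_prod Z \<le> q"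
    if t: "sqrt x \<le> t" "u = 1 / ln t" for t u
  proof -
    \<comment> \<open>For \<open>t \<ge> sqrt x\<close> the weight \<open>1 / ln t\<close> is at
      most \<open>2 / ln x\<close>; hence the factors 2 in the hypotheses on \<open>R\<close> and
      \<open>q\<close>.\<close>
    have "ln (sqrt x) \<le> ln t" by (rule ln_mono) (use t sx x in simp_all)
    then have lt: "l / 2 \<le> ln t" using x by (simp add: ln_sqrt l_def)
    have u: "0 \<le> u" "u \<le> 2 / l"
    proof -
      have "1 / ln t \<le> 1 / (l / 2)" using lt l by (intro divide_left_mono) auto
      then show "u \<le> 2 / l" by (simp add: t(2))
      show "0 \<le> u" using lt l by (simp add: t(2))
    qed
    define w where "w = u / mertens_prod y"
    have "w = u * (1 / mertens_prod y)" by (simp add: w_def)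
    also have "\<dots> \<le> 2 / l * R" using u R M l by (intro mult_mono) auto
    finally have w: "w \<le> 2 * R / l" by simp
    have w0: "0 \<le> w" using u M by (simp add: w_def)
    have "2 * R / l \<le> 1" using R l by (simp add: l_def)
    then have w1: "w \<le> 1" using w by linarith
    have wy: "w * real y \<le> 2 * R / l * yr" using w yyr R1 l by (intro mult_mono) auto
    have "u / mertens_prod Z * sieve_sum {p. prime p \<and> p \<le> Z} (u / mertens_prod Z) {1..y}
     - (real (Suc K)^2 / real Z * exp (w * real y) + exp (- real K) * exp (exp 1 * w * real y)) \<le> f t"
      unfolding f_def t(2)[symmetric] by (rule trunc_series_lower[OF y1 yZ u(1) w_def w1])
    moreover have "real (Suc K)^2 / real Z * exp (w * real y) \<le> real (Suc K)^2 / real Z * exp (2 * R / l * yr)"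
      using wy by (intro mult_left_mono) auto
    moreover have "exp (- real K) * exp (exp 1 * w * real y) \<le> exp (- real K) * exp (exp 1 * (2 * R / l) * yr)"
      using mult_left_mono[OF wy, of "exp 1"] by (simp add: mult.assoc)
    moreover have "u / mertens_prod Z \<le> q"
    proof -
      have "u / mertens_prod Z \<le> 2 / l / mertens_prod Z" using u M by (intro divide_right_mono) auto
      then show ?thesis using q(1) by (simp add: l_def)
    qed
    ultimately show ?thesis unfolding E2_def by linarith
  qed
  have q0: "q \<ge> 0"
  proof -
    have "0 \<le> 2 / (ln x * mertens_prod Z)" using M lx by simp
    then show ?thesis using q by linarith
  qed
  have "(x - x / 2) * D - sqrt x * (exp 1 * real y ^ K * (2 * R) ^ Suc K) - x * E2 \<le> integral {2..x} f"
  proof (rule integral_ge_piecewise[OF cont _ sx2])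
    show "2 \<le> sqrt x" "x / 2 \<le> x" using sx x by auto
    show "0 \<le> exp 1 * real y ^ K * (2 * R) ^ Suc K" using R1 by simp
    show "0 \<le> E2" unfolding E2_def by simp
  next
    fix t assume t: "2 \<le> t" "t \<le> sqrt x"
    have "ln 2 \<le> ln t" using t by (intro ln_mono) auto
    then have "ln t \<ge> 1 / 2" using ln2_ge_two_thirds by linarith
    then have "1 / ln t \<le> 1 / (1 / 2)" by (intro divide_left_mono) auto
    then have u: "0 \<le> 1 / ln t" "1 / ln t \<le> 2" using \<open>ln t \<ge> 1 / 2\<close> by auto
    have "1 / ln t / mertens_prod y = 1 / ln t * (1 / mertens_prod y)" by simp
    also have "\<dots> \<le> 2 * R" using u R M by (intro mult_mono) auto
    finally have "\<bar>trunc_series K y (1 / ln t)\<bar> \<le> exp 1 * real y ^ K * (2 * R) ^ Suc K"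
      using R1 by (intro abs_trunc_series_le y1 u) auto
    then show "- (exp 1 * real y ^ K * (2 * R) ^ Suc K) \<le> f t" unfolding f_def by linarith
  next
    fix t assume t: "sqrt x \<le> t" "t \<le> x / 2"
    define u where "u = 1 / ln t"
    have "0 \<le> u" using t sx by (simp add: u_def)
    moreover have "u / mertens_prod Z \<le> 1" using mid[OF t(1) u_def] q by linarith
    then have "0 \<le> sieve_sum {p. prime p \<and> p \<le> Z} (u / mertens_prod Z) {1..y}"
      by (intro sieve_sum_nonneg) (auto dest: prime_gt_0_nat)
    ultimately have "0 \<le> u / mertens_prod Z * sieve_sum {p. prime p \<and> p \<le> Z} (u / mertens_prod Z) {1..y}"
      using M by (intro mult_nonneg_nonneg) auto
    then show "- E2 \<le> f t" using mid[OF t(1) u_def] by linarith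
  next
    fix t assume t: "x / 2 \<le> t" "t \<le> x"
    then have st: "sqrt x \<le> t" using sx2 by linarith
    define u where "u = 1 / ln t"
    have "ln (x / 2) \<le> ln t" using t x by (intro ln_mono) auto
    then have l1: "l - 1 \<le> ln t" using x ln_2_less_1 by (simp add: l_def ln_div)
    have l2: "ln t \<le> l" unfolding l_def using t x by (intro ln_mono) auto
    have lt0: "ln t > 0" using l1 l by linarith
    have u: "0 < u" "1 / l \<le> u" "u \<le> 1 / (l - 1)"
      using l1 l2 lt0 l by (auto simp: u_def intro!: divide_left_mono)
    have qu: "u / mertens_prod Z \<le> 1 / 2" "u / mertens_prod Z \<le> q" using mid[OF st u_def] q by linarith+
    have qu0: "0 \<le> u / mertens_prod Z" using u M by simp
    let ?e = "exp (4 * ln (real y) / real N)"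
    have "D \<le> u * exp (- real N * ln (real N)) *
      exp (- ((1 + 2 * (u / mertens_prod Z)) * (1 - \<delta>) * (u * real y) * ?e))"
      unfolding D_def
    proof (intro mult_mono)
      have "(1 + 2 * (u / mertens_prod Z)) * (1 - \<delta>) * (u * real y) * ?e \<le> (1 + 2 * q) * (1 - \<delta>) * (1 / (l - 1) * yr) * ?e"
        using qu u yyr \<delta> l q0 qu0 by (intro mult_right_mono mult_mono) (auto intro!: mult_nonneg_nonneg add_nonneg_nonneg)
      then show "exp (- ((1 + 2 * q) * (1 - \<delta>) * (yr / (l - 1)) * ?e)) \<le>
         exp (- ((1 + 2 * (u / mertens_prod Z)) * (1 - \<delta>) * (u * real y) * ?e))" by simp
    qed (use u in auto)
    also have "\<dots> \<le> u / mertens_prod Z * sieve_sum {p. prime p \<and> p \<le> Z} (u / mertens_prod Z) {1..y}"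
      by (rule sieve_sum_lower[OF N y1 u(1) refl qu(1) \<delta> m sift])
    finally show "D - E2 \<le> f t" using mid[OF st u_def] by linarith
  qed
  moreover have "integral {2..x} f - exp 1 * real y ^ K * Err \<le> real (M_count A x yr)"
    unfolding f_def by (rule M_count_ge_integral[OF HL yr K Err y])
  ultimately show ?thesis unfolding D_def E2_def l_def by simp
qed

section \<open>Asymptotics\<close>

lemma real_nat_ceiling_le: "0 \<le> a \<Longrightarrow> real (nat \<lceil>a\<rceil>) \<le> a + 1" for a :: real
  by linarith

text \<open>The asymptotics are isolated as inequalities in \<open>L\<close> and \<open>s\<close>,
  where \<open>s\<close> stands for \<open>sqlog L\<close>: \<open>b1\<close> keeps the growth per
  tuple element below \<open>lam / 100\<close>, \<open>b2\<close> makes \<open>4 ln y / N\<close>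
  small against \<open>\<delta>\<close>, \<open>b3\<close> pays for the prescribed classes,
  \<open>b5\<close> controls \<open>q\<close>, and \<open>b6\<close> the range
  \<open>t \<le> sqrt x\<close>.\<close>

lemma M_count_numeric:
  fixes A :: "nat set" and x lam l L s \<epsilon> c \<delta> \<Lambda> :: real and C :: nat
  assumes l: "l = ln x" and L: "L = ln l" "3 \<le> L" and s: "0 \<le> s" and \<Lambda>: "\<Lambda> = ln lam" and x: "16 \<le> x" and c: "0 < c"
    and HL: "\<And>H :: int set. finite H \<Longrightarrow> (\<forall>h\<in>H. 0 \<le> h \<and> real_of_int h \<le> l powr (1 + c)) \<Longrightarrow> real (card H) \<le> l powr c \<Longrightarrow>
      \<bar>real (card {n. 1 \<le> n \<and> real n \<le> x \<and> (\<forall>h\<in>H. int n + h \<in> int ` A)})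
           - singular_series H * integral {2..x} (\<lambda>t. 1 / ln t ^ card H)\<bar> \<le> x * exp (- (l powr c) * L)"
    and C: "\<And>n. n \<ge> 3 \<Longrightarrow> 1 / mertens_prod n \<le> real C * ln (real n) ^ C"
    and \<epsilon>: "0 < \<epsilon>" "\<epsilon> \<le> 1 / 100"
    and lam: "exp ((sqrt 2 + 51 * \<epsilon>) * s) \<le> lam" "\<Lambda> \<le> c * L / 4" "8 * (real C + 1) * \<Lambda> \<le> L"
    and \<delta>: "\<delta> = exp (- (1 / sqrt 2 + 24 * \<epsilon>) * s)"
    and N: "N = nat \<lfloor>exp ((1 / sqrt 2 + 25 * \<epsilon>) * s)\<rfloor>"
    and m: "\<And>p. prime p \<Longrightarrow> p \<le> N \<Longrightarrow> \<not> p dvd m"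
    and sift: "real (sift_count {p. prime p \<and> p \<le> N} m (nat \<lfloor>lam * l\<rfloor>)) \<le> (1 - \<delta>) * mertens_prod N * real (nat \<lfloor>lam * l\<rfloor>)"
    and b1: "100 * (real C + 1) * (2 * L) ^ C \<le> exp s"
    and b2: "192 * L \<le> exp (\<epsilon> * s)"
    and b3: "4 * (ln 4 + L + s) \<le> exp (2 * (\<epsilon> * s))"
    and b4: "s \<le> L / 8" "100 \<le> exp s" "2 * L \<le> exp s"
    and b5: "48 * (real C + 1) * 2 ^ C \<le> exp (L / 2)"
    and b6: "3 + 6 * exp (L / 4) * L + L + exp (L / 8) \<le> exp L / 2"
  shows "real (M_count A x (lam * l)) \<ge> x * exp (- lam) * exp (lam * \<delta> / 4)"
proof -
  have lx: "x > 0" "l > 0" and le: "l = exp L" and xe: "x = exp l"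
  proof -
    show "x > 0" using x by simp
    then show "x = exp l" by (simp add: l)
    have "ln x > 0" using x by simp
    then show "l > 0" by (simp add: l)
    then show "l = exp L" by (simp add: L)
  qed
  have sq: "sqrt 2 - 1 / sqrt 2 = 1 / sqrt (2::real)" "1 / sqrt 2 \<le> (71 / 100 :: real)" "1 \<le> sqrt (2::real)"
  proof -
    have "1 / sqrt 2 = sqrt 2 / (2::real)" by (simp add: field_simps)
    moreover have "sqrt 2 \<le> sqrt ((1.42)\<^sup>2)" by (intro real_sqrt_le_mono) (simp add: power2_eq_square)
    then have "sqrt 2 \<le> (1.42::real)" by simp
    ultimately show "sqrt 2 - 1 / sqrt 2 = 1 / sqrt (2::real)" "1 / sqrt 2 \<le> (71 / 100 :: real)" by auto
  qed simp
  have es: "exp s \<le> lam"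
  proof -
    have "1 \<le> sqrt 2 + 51 * \<epsilon>" using sq(3) \<epsilon> by linarith
    then have "1 * s \<le> (sqrt 2 + 51 * \<epsilon>) * s" using s by (rule mult_right_mono)
    then have "exp s \<le> exp ((sqrt 2 + 51 * \<epsilon>) * s)" by simp
    then show ?thesis using lam by linarith
  qed
  have lam100: "100 \<le> lam" "2 * L \<le> lam" using es b4 by auto
  have lam\<Lambda>: "lam = exp \<Lambda>" using lam100 by (simp add: \<Lambda>)
  have \<Lambda>0: "\<Lambda> \<ge> 0" using lam100 by (simp add: \<Lambda>)
  have "1 * \<Lambda> \<le> (real C + 1) * \<Lambda>" using \<Lambda>0 by (intro mult_right_mono) auto
  moreover have "8 * ((real C + 1) * \<Lambda>) \<le> L" using lam(3) by (simp only: mult.assoc)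
  ultimately have \<Lambda>8: "\<Lambda> \<le> L / 8" by linarith
  have lamsq: "100 * lam \<le> lam\<^sup>2"
    unfolding power2_eq_square using lam100 by (intro mult_right_mono) auto
  have lam2: "lam\<^sup>2 = exp (2 * \<Lambda>)" by (simp add: lam\<Lambda> exp_double)
  define y where "y = nat \<lfloor>lam * l\<rfloor>"
  have l20: "l \<ge> 20"
  proof -
    have "exp L \<ge> exp (L / 2)" using L by simp
    moreover have "48 * 1 * 1 \<le> 48 * (real C + 1) * 2 ^ C" by (intro mult_mono) auto
    ultimately show ?thesis using b5 le by linarith
  qed
  have ll: "4 \<le> lam * l" using mult_mono[of 4 lam 1 l] lam100 l20 by simp
  have "3 \<le> y" using ll unfolding y_def by (simp add: le_nat_iff le_floor_iff)
  moreover have "real y \<le> lam * l" unfolding y_def using ll by (intro of_nat_floor) linarith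
  ultimately have y3: "3 \<le> y" "real y \<le> lam * l" by auto
  have lny: "0 \<le> ln (real y)" "ln (real y) \<le> 2 * L"
  proof -
    have "ln (real y) \<le> ln (lam * l)" using y3 by (intro ln_mono) auto
    also have "\<dots> = \<Lambda> + L" using lam100 lx by (simp add: ln_mult \<Lambda> L)
    finally show "ln (real y) \<le> 2 * L" using \<Lambda>8 L by linarith
    show "0 \<le> ln (real y)" using y3 by simp
  qed
  define R where "R = (real C + 1) * (2 * L) ^ C"
  have R: "1 / mertens_prod y \<le> R" "100 * R \<le> lam"
  proof -
    have "1 / mertens_prod y \<le> real C * ln (real y) ^ C" by (rule C[OF y3(1)])
    also have "\<dots> \<le> R" unfolding R_def using lny by (intro mult_mono power_mono) auto
    finally show "1 / mertens_prod y \<le> R" .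
    show "100 * R \<le> lam" using b1 es by (simp only: R_def mult.assoc)
  qed
  have R1: "1 \<le> R" using R(1) mertens_prod_le_1[of y] mertens_prod_pos[of y]
    by (meson le_divide_eq_1_pos order_trans)
  have lamL: "lam \<le> exp (L / 8)" using \<Lambda>8 by (simp add: lam\<Lambda>)
  have laml: "lam \<le> l" unfolding lam\<Lambda> le using \<Lambda>8 L(2) by simp
  define z where "z = exp ((1 / sqrt 2 + 25 * \<epsilon>) * s)"
  have \<delta>z: "\<delta> * z = exp (\<epsilon> * s)" by (simp add: \<delta> z_def algebra_simps flip: exp_add)
  have z_s: "z \<le> exp s"
  proof -
    have "1 / sqrt 2 + 25 * \<epsilon> \<le> 1" using sq(2) \<epsilon> by linarith
    then have "(1 / sqrt 2 + 25 * \<epsilon>) * s \<le> 1 * s" using s by (rule mult_right_mono)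
    then show ?thesis by (simp add: z_def)
  qed
  have \<delta>01: "0 < \<delta>" "\<delta> \<le> 1" "exp (- s) \<le> \<delta>"
  proof -
    have "1 / sqrt 2 + 24 * \<epsilon> \<le> 1" using sq(2) \<epsilon> by linarith
    then have "(1 / sqrt 2 + 24 * \<epsilon>) * s \<le> 1 * s" using s by (rule mult_right_mono)
    moreover have "0 \<le> (1 / sqrt 2 + 24 * \<epsilon>) * s" using \<epsilon> s by (intro mult_nonneg_nonneg add_nonneg_nonneg) auto
    ultimately have "0 \<le> (1 / sqrt 2 + 24 * \<epsilon>) * s" "(1 / sqrt 2 + 24 * \<epsilon>) * s \<le> 1 * s" by auto
    then show "0 < \<delta>" "\<delta> \<le> 1" "exp (- s) \<le> \<delta>" by (auto simp: \<delta> algebra_simps)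
  qed
  have z4: "4 \<le> z"
  proof -
    have "\<delta> * z \<le> 1 * z" using \<delta>01 by (intro mult_right_mono) (auto simp: z_def)
    then show ?thesis using b2 L \<delta>z by linarith
  qed
  have Nz: "real N \<le> z" "z / 2 \<le> real N" "2 \<le> N" using z4 unfolding N z_def[symmetric] by linarith+
  \<comment> \<open>Large enough for \<open>1 / Z\<close> to push its error term below
    \<open>exp (- lam)\<close>; yet \<open>ln Z\<close> is about \<open>lam^2\<close>, so
    \<open>1 / mertens_prod Z\<close> is at most a constant times a power of \<open>lam\<close>,
    hence \<open>(ln x)^o(1)\<close>.\<close>
  define Z where "Z = nat \<lceil>exp (lam\<^sup>2)\<rceil>"
  have Zb: "exp (lam\<^sup>2) \<le> real Z" "real Z \<le> exp (lam\<^sup>2 + 1)"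
  proof -
    show "exp (lam\<^sup>2) \<le> real Z" unfolding Z_def by linarith
    have "real Z \<le> exp (lam\<^sup>2) + 1" unfolding Z_def by (rule real_nat_ceiling_le) simp
    also have "\<dots> \<le> exp (lam\<^sup>2) * 2" by simp
    also have "\<dots> \<le> exp (lam\<^sup>2) * exp 1" using exp_ge_add_one_self[of "1::real"] by (intro mult_left_mono) auto
    finally show "real Z \<le> exp (lam\<^sup>2 + 1)" by (simp add: exp_add)
  qed
  have lamZ: "lam * lam \<le> real Z"
  proof -
    have "lam * lam + 1 \<le> exp (lam\<^sup>2)" unfolding power2_eq_square using exp_ge_add_one_self[of "lam * lam"] by linarith
    then show ?thesis using Zb by linarith
  qed
  have "lam * 1 \<le> lam * lam" using lam100 by (intro mult_left_mono) auto
  then have "real N \<le> real Z" using Nz z_s es lamZ by linarith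
  then have NZ: "N \<le> Z" by simp
  have yZ: "y \<le> Z"
  proof -
    have "real y \<le> exp (\<Lambda> + L)" using y3 by (simp add: lam\<Lambda> le exp_add)
    also have "\<dots> \<le> exp (lam\<^sup>2)" using \<Lambda>8 lamsq lam100 L by simp
    finally have "real y \<le> real Z" using Zb by linarith
    then show ?thesis by simp
  qed
  define q where "q = 2 / (l * mertens_prod Z)"
  \<comment> \<open>\<open>q\<close> is a constant times a power of \<open>lam\<close> divided by
    \<open>l = exp L\<close>, while \<open>\<delta> \<ge> exp (- s)\<close> and
    \<open>s \<le> L / 8\<close>.\<close>
  have q24: "24 * q \<le> \<delta>"
  proof -
    have Z3: "3 \<le> Z" using y3 yZ by simp
    have "ln (real Z) \<le> ln (exp (lam\<^sup>2 + 1))" using Zb Z3 by (intro ln_mono) auto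
    then have lnZ: "ln (real Z) \<le> 2 * lam\<^sup>2" using lamsq lam100 by simp
    have "1 / mertens_prod Z \<le> real C * ln (real Z) ^ C" by (rule C[OF Z3])
    also have "\<dots> \<le> (real C + 1) * (2 * lam\<^sup>2) ^ C" using lnZ Z3 by (intro mult_mono power_mono) auto
    also have "\<dots> = (real C + 1) * 2 ^ C * exp (real C * (2 * \<Lambda>))" by (simp add: power_mult_distrib lam2 exp_of_nat_mult)
    also have "\<dots> \<le> (real C + 1) * 2 ^ C * exp (L / 4)"
    proof -
      have "real C * (2 * \<Lambda>) \<le> 2 * (real C + 1) * \<Lambda>" using \<Lambda>0 by (simp add: algebra_simps)
      then have "real C * (2 * \<Lambda>) \<le> L / 4" using lam(3) by linarith
      then show ?thesis by (intro mult_left_mono) auto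
    qed
    finally have MZ: "1 / mertens_prod Z \<le> (real C + 1) * 2 ^ C * exp (L / 4)" .
    have "24 * q = 48 * exp (- L) * (1 / mertens_prod Z)" by (simp add: q_def le exp_minus field_simps)
    also have "\<dots> \<le> 48 * exp (- L) * ((real C + 1) * 2 ^ C * exp (L / 4))" using MZ by (intro mult_left_mono) auto
    also have "\<dots> = 48 * (real C + 1) * 2 ^ C * (exp (- L) * exp (L / 4))" by simp
    also have "\<dots> \<le> exp (L / 2) * (exp (- L) * exp (L / 4))" using b5 by (intro mult_right_mono) auto
    also have "\<dots> = exp (- (L / 4))" by (simp flip: exp_add)
    also have "\<dots> \<le> exp (- s)" using b4 L by simp
    also have "\<dots> \<le> \<delta>" by (rule \<delta>01)
    finally show ?thesis .
  qed
  have q0: "0 \<le> q" using lx mertens_prod_pos[of Z] by (simp add: q_def)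
  \<comment> \<open>The order \<open>K\<close> has to exceed \<open>e w y\<close>, which is at most
    \<open>3 lam^2 / 50\<close>, by more than \<open>lam\<close>, and has to stay below
    \<open>l powr c\<close>; about \<open>lam^2\<close> meets both. The parity is adjusted for
    Bonferroni.\<close>
  define k where "k = nat \<lceil>lam\<^sup>2\<rceil>"
  define K where "K = (if odd k then k else Suc k)"
  have Ko: "odd K" by (simp add: K_def)
  have kb: "lam\<^sup>2 \<le> real k" "real k \<le> lam\<^sup>2 + 1"
    unfolding k_def by (linarith, rule real_nat_ceiling_le) simp
  have K: "lam\<^sup>2 \<le> real K" "real K + 1 \<le> 2 * lam\<^sup>2" using kb lamsq lam100 by (auto simp: K_def)
  have lpc: "l powr c = exp (c * L)" using lx by (simp add: powr_def L)
  \<comment> \<open>The square root of \<open>l powr c\<close>: it bounds \<open>lam^2\<close>,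
    hence \<open>K\<close> up to a factor 2, and leaves a whole factor \<open>v\<close> to
    spare.\<close>
  define v where "v = exp (c * L / 2)"
  have v: "lam\<^sup>2 \<le> v" "lam \<le> v" "v * v = l powr c" "10000 \<le> v"
  proof -
    show "lam\<^sup>2 \<le> v" using lam(2) by (simp add: lam2 v_def)
    then show "lam \<le> v" "10000 \<le> v" using lamsq lam100 by auto
    show "v * v = l powr c" by (simp add: v_def lpc flip: exp_add)
  qed
  have Kpsi: "real K + 1 \<le> l powr c"
  proof -
    have "2 * v \<le> v * v" using v by (intro mult_right_mono) auto
    then show ?thesis using K v by linarith
  qed
  have yphi: "lam * l \<le> l powr (1 + c)"
  proof -
    have "1 * v \<le> v * v" by (intro mult_right_mono) (use v in linarith)+
    then have "lam * l \<le> l powr c * l" using v lx by (intro mult_right_mono) auto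
    then show ?thesis using lx by (simp add: powr_add mult.commute)
  qed
  define Ex where "Ex = (1 + 2 * q) * (1 - \<delta>) * (lam * l / (l - 1)) * exp (4 * ln (real y) / real N)"
  \<comment> \<open>The three perturbing factors are at most \<open>exp (\<delta> / 12)\<close>
    each; together they consume half of the gain \<open>lam * \<delta>\<close>.\<close>
  have Ex: "Ex \<le> lam * (1 - \<delta> / 2)"
  proof -
    have e3: "4 * ln (real y) / real N \<le> \<delta> / 12"
    proof -
      have "4 * ln (real y) / real N \<le> 4 * (2 * L) / (z / 2)"
        using lny Nz z4 L by (intro frac_le) auto
      also have "\<dots> = 192 * L / (12 * z)" by simp
      also have "\<dots> \<le> (\<delta> * z) / (12 * z)" using b2 z4 \<delta>z by (intro divide_right_mono) auto
      also have "\<dots> = \<delta> / 12" using z4 by simp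
      finally show ?thesis .
    qed
    have e2: "2 / l \<le> \<delta> / 12"
    proof -
      have "48 * 1 * 1 \<le> 48 * (real C + 1) * 2 ^ C" by (intro mult_mono) auto
      then have "24 * exp (- L) \<le> exp (L / 2) * exp (- L)" using b5 by (intro mult_right_mono) auto
      also have "\<dots> = exp (- (L / 2))" by (simp flip: exp_add)
      also have "\<dots> \<le> exp (- s)" using b4 L by simp
      finally have "24 * exp (- L) \<le> \<delta>" using \<delta>01 by linarith
      then show ?thesis by (simp add: le exp_minus field_simps)
    qed
    have ll: "l / (l - 1) \<le> exp (2 / l)"
    proof -
      have "l / (l - 1) \<le> 1 + 2 / l" using l20 by (simp add: field_simps)
      also have "\<dots> \<le> exp (2 / l)" by (rule exp_ge_add_one_self)
      finally show ?thesis .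
    qed
    have "Ex = lam * (1 - \<delta>) * ((1 + 2 * q) * (l / (l - 1)) * exp (4 * ln (real y) / real N))"
      by (simp add: Ex_def)
    also have "\<dots> \<le> lam * (1 - \<delta>) * (exp (2 * q) * exp (2 / l) * exp (\<delta> / 12))"
      using ll e3 q0 l20 lam100 \<delta>01 by (intro mult_left_mono mult_mono) auto
    also have "exp (2 * q) * exp (2 / l) * exp (\<delta> / 12) = exp (2 * q + 2 / l + \<delta> / 12)" by (simp only: exp_add)
    also have "\<dots> \<le> exp (\<delta> / 4)" using q24 e2 by simp
    also have "exp (\<delta> / 4) \<le> 1 + \<delta> / 2"
    proof -
      have "exp (\<delta> / 4) \<le> 1 + \<delta> / 4 + (\<delta> / 4)\<^sup>2" using \<delta>01 by (intro exp_bound) auto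
      also have "(\<delta> / 4)\<^sup>2 \<le> \<delta> / 4 * 1" unfolding power2_eq_square using \<delta>01 by (intro mult_left_mono) auto
      finally show ?thesis by simp
    qed
    also have "lam * (1 - \<delta>) * (1 + \<delta> / 2) \<le> lam * (1 - \<delta> / 2)"
    proof -
      have "(1 - \<delta>) * (1 + \<delta> / 2) \<le> 1 - \<delta> / 2" using \<delta>01 by (simp add: algebra_simps)
      then show ?thesis unfolding mult.assoc using lam100 by (intro mult_left_mono) auto
    qed
    finally show ?thesis using lam100 \<delta>01 by (simp add: mult_left_mono)
  qed
  \<comment> \<open>Because \<open>sqrt 2 - 1 / sqrt 2 = 1 / sqrt 2\<close>, the product
    \<open>lam * \<delta>\<close> is at least \<open>exp ((1 / sqrt 2 + 27 \<epsilon>) s)\<close>,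
    which is \<open>z exp (2 \<epsilon> s)\<close>. By \<open>b3\<close> this pays for the
    prescribed classes, the factor \<open>1 / l\<close> and the constants.\<close>
  have gain: "ln 4 + L + z * s \<le> lam * \<delta> / 4"
  proof -
    have "z * exp (2 * (\<epsilon> * s)) = exp ((sqrt 2 + 51 * \<epsilon>) * s + (- (1 / sqrt 2 + 24 * \<epsilon>) * s))"
    proof -
      have "(1 / sqrt 2 + 25 * \<epsilon>) * s + 2 * (\<epsilon> * s) = (1 / sqrt 2 + 27 * \<epsilon>) * s" by (simp add: algebra_simps)
      also have "\<dots> = ((sqrt 2 - 1 / sqrt 2) + 27 * \<epsilon>) * s" by (simp only: sq(1))
      also have "\<dots> = (sqrt 2 + 51 * \<epsilon>) * s + (- (1 / sqrt 2 + 24 * \<epsilon>) * s)" proof -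
        have "((a - b) + 27 * e) * t = (a + 51 * e) * t + (- (b + 24 * e) * t)" for a b e t :: real
          by (simp add: algebra_simps)
        then show ?thesis .
      qed
      finally show ?thesis unfolding z_def exp_add[symmetric] by (simp only:)
    qed
    also have "\<dots> \<le> lam * \<delta>" unfolding exp_add \<delta> using lam(1) by (intro mult_right_mono) auto
    finally have 1: "z * exp (2 * (\<epsilon> * s)) \<le> lam * \<delta>" .
    have "4 * (ln 4 + L + z * s) \<le> z * (4 * (ln 4 + L + s))"
    proof -
      have "1 * ln 4 \<le> z * ln 4" "1 * L \<le> z * L" using z4 L(2) by (intro mult_right_mono; simp)+
      then have "1 * ln 4 + 1 * L + z * s \<le> z * ln 4 + z * L + z * s" by (intro add_mono order_refl)
      then have "ln 4 + L + z * s \<le> z * (ln 4 + L + s)" by (simp only: mult_1_left ring_distribs)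
      then have "4 * (ln 4 + L + z * s) \<le> 4 * (z * (ln 4 + L + s))" by (rule mult_left_mono) simp
      also have "\<dots> = z * (4 * (ln 4 + L + s))" by (rule mult.left_commute)
      finally show ?thesis .
    qed
    also have "\<dots> \<le> z * exp (2 * (\<epsilon> * s))" using b3 z4 by (intro mult_left_mono) auto
    finally show ?thesis using 1 by simp
  qed
  define G where "G = exp (- lam) * exp (lam * \<delta> / 4)"
  have G: "exp (- lam) \<le> G" unfolding G_def using lam100 \<delta>01 by simp
  have main: "x * (2 * G) \<le> x / 2 * (1 / l * exp (- real N * ln (real N)) * exp (- Ex))"
  proof -
    have "real N * ln (real N) \<le> z * s"
    proof (intro mult_mono)
      have "ln (real N) \<le> ln (exp s)" using Nz z_s by (intro ln_mono) auto
      then show "ln (real N) \<le> s" by simp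
    qed (use Nz z4 in auto)
    then have "ln 4 + L + real N * ln (real N) + Ex \<le> lam * \<delta> / 4 + lam * (1 - \<delta> / 2)" using gain Ex by linarith
    also have "\<dots> = lam - lam * \<delta> / 4" by (simp add: algebra_simps)
    finally have "exp (- lam + lam * \<delta> / 4) \<le> exp (- (ln 4 + L + real N * ln (real N) + Ex))" by simp
    also have "\<dots> = exp (- ln 4) * exp (- L) * exp (- real N * ln (real N)) * exp (- Ex)"
      by (simp flip: exp_add)
    also have "exp (- ln 4) = 1 / (4::real)" by (simp add: exp_minus)
    also have "exp (- L) = 1 / l" by (simp add: le exp_minus inverse_eq_divide)
    finally have "exp (- lam + lam * \<delta> / 4) \<le> 1 / 4 * (1 / l) * exp (- real N * ln (real N)) * exp (- Ex)" .
    moreover have "1 / 4 * (1 / l) * exp (- real N * ln (real N)) * exp (- Ex) =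
      (1 / l * exp (- real N * ln (real N)) * exp (- Ex)) / 4" by simp
    moreover have "G = exp (- lam + lam * \<delta> / 4)" by (simp only: G_def exp_add)
    ultimately have "4 * G \<le> 1 / l * exp (- real N * ln (real N)) * exp (- Ex)" by linarith
    then have "x / 2 * (4 * G) \<le> x / 2 * (1 / l * exp (- real N * ln (real N)) * exp (- Ex))"
      by (rule mult_left_mono) (use lx in simp)
    moreover have "x / 2 * (4 * G) = x * (2 * G)" by simp
    ultimately show ?thesis by (simp only:)
  qed
  have ln6: "exp 2 \<ge> (6::real)"
  proof -
    have "2 + 1 \<le> exp (2::real)" "exp (1::real) \<ge> 1 + 1 + 1 / 2" 
      using exp_ge_add_one_self[of "2::real"] exp_lower_Taylor_quadratic[of "1::real"] by auto
    then have "(2.5::real) * 2.5 \<le> exp 1 * exp 1" by (intro mult_mono) auto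
    then show ?thesis by (simp flip: exp_add)
  qed
  have six: "exp (a - lam - 2) \<le> exp a * exp (- lam) / 6" for a
  proof -
    have "exp (a - lam - 2) = exp a * exp (- lam) / exp 2" by (simp add: exp_diff exp_minus exp_add field_simps)
    also have "\<dots> \<le> exp a * exp (- lam) / 6" using ln6 by (intro divide_left_mono) auto
    finally show ?thesis .
  qed
  have ypow: "real y ^ K \<le> exp (real K * (2 * L))"
  proof -
    have "real y = exp (ln (real y))" using y3 by simp
    also have "\<dots> \<le> exp (2 * L)" using lny by simp
    finally have "real y ^ K \<le> exp (2 * L) ^ K" by (intro power_mono) auto
    then show ?thesis by (simp add: exp_of_nat_mult)
  qed
  \<comment> \<open>\<open>y^K\<close> and \<open>(2 R)^(K+1)\<close> are exponentials of
    \<open>O(K L)\<close>, and \<open>K \<le> 2 l^(1/4)\<close>, so \<open>K L\<close> is negligible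
    against the \<open>l / 2\<close> gained from \<open>sqrt x\<close>.\<close>
  have err1: "sqrt x * (exp 1 * real y ^ K * (2 * R) ^ Suc K) \<le> x * exp (- lam) / 6"
  proof -
    have "(2 * R) ^ Suc K \<le> exp L ^ Suc K" using R R1 laml le by (intro power_mono) linarith+
    also have "\<dots> = exp (real (Suc K) * L)" by (simp only: exp_of_nat_mult)
    finally have 1: "(2 * R) ^ Suc K \<le> exp (real (Suc K) * L)" .
    have sx: "sqrt x = exp (l / 2)" unfolding xe by (intro real_sqrt_unique) (auto simp: power2_eq_square simp flip: exp_add)
    have "sqrt x * (exp 1 * real y ^ K * (2 * R) ^ Suc K) \<le> exp (l / 2) * (exp 1 * exp (real K * (2 * L)) * exp (real (Suc K) * L))"
      unfolding sx using 1 ypow R1 by (intro mult_left_mono mult_mono) auto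
    also have "\<dots> = exp (l / 2 + 1 + 3 * (real K * L) + L)" by (simp add: algebra_simps flip: exp_add)
    also have "\<dots> \<le> exp (l - lam - 2)"
    proof -
      have "lam\<^sup>2 \<le> exp (L / 4)" using \<Lambda>8 by (simp add: lam2)
      then have "real K \<le> 2 * exp (L / 4)" using K by linarith
      then have "real K * L \<le> 2 * exp (L / 4) * L" using L by (intro mult_right_mono) auto
      then have "l / 2 + 1 + 3 * (real K * L) + L \<le> l - lam - 2" using b6 lamL unfolding le by linarith
      then show ?thesis by simp
    qed
    also have "\<dots> \<le> exp l * exp (- lam) / 6" by (rule six)
    finally show ?thesis by (simp add: xe)
  qed
  have err2: "real (Suc K)^2 / real Z * exp (2 * R / l * (lam * l)) + exp (- real K) * exp (exp 1 * (2 * R / l) * (lam * l)) \<le> exp (- lam) / 3"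
  proof -
    have Rl: "2 * R / l * (lam * l) \<le> lam\<^sup>2 / 50"
    proof -
      have "2 * R / l * (lam * l) = 2 * R * lam" using lx by simp
      also have "\<dots> \<le> lam / 50 * lam" using R lam100 by (intro mult_right_mono) auto
      finally show ?thesis by (simp add: power2_eq_square)
    qed
    have lq: "lam + 2 \<le> lam\<^sup>2 / 50" "4 * lam + 2 \<le> lam\<^sup>2 / 4" using lamsq lam100 by linarith+
    have "(real (Suc K))^2 \<le> (2 * lam\<^sup>2)^2" using K by (intro power_mono) auto
    also have "2 * lam\<^sup>2 \<le> exp 1 * exp (2 * lam)"
    proof (intro mult_mono)
      have "\<Lambda> \<le> lam" unfolding lam\<Lambda> using exp_ge_add_one_self[of \<Lambda>] by linarith
      then show "lam\<^sup>2 \<le> exp (2 * lam)" by (simp add: lam2)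
      show "2 \<le> exp (1::real)" using exp_ge_add_one_self[of "1::real"] by simp
    qed auto
    then have "(2 * lam\<^sup>2)^2 \<le> (exp 1 * exp (2 * lam))^2" by (intro power_mono) auto
    also have "(exp 1 * exp (2 * lam))^2 = exp (4 * lam + 2)" by (simp add: exp_add[symmetric] exp_double[symmetric])
    also have "\<dots> \<le> exp (lam\<^sup>2 / 4)" using lq by simp
    finally have "real (Suc K)^2 / real Z \<le> exp (lam\<^sup>2 / 4) / exp (lam\<^sup>2)"
      using Zb by (intro frac_le) auto
    then have "real (Suc K)^2 / real Z * exp (2 * R / l * (lam * l)) \<le> exp (lam\<^sup>2 / 4) / exp (lam\<^sup>2) * exp (lam\<^sup>2 / 50)"
      using Rl by (intro mult_mono) auto
    also have "\<dots> = exp (lam\<^sup>2 / 4 - lam\<^sup>2 + lam\<^sup>2 / 50)" by (simp only: exp_add exp_diff)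
    also have "\<dots> \<le> exp (0 - lam - 2)"
      unfolding exp_le_cancel_iff using lq zero_le_power2[of lam] by linarith
    also have "\<dots> \<le> exp 0 * exp (- lam) / 6" by (rule six)
    finally have 1: "real (Suc K)^2 / real Z * exp (2 * R / l * (lam * l)) \<le> exp (- lam) / 6" by simp
    have "exp 1 * (2 * R / l) * (lam * l) = exp 1 * (2 * R / l * (lam * l))" by simp
    also have "\<dots> \<le> 3 * (lam\<^sup>2 / 50)" using Rl exp_le lam100 R1 lx by (intro mult_mono) auto
    finally have "exp (- real K) * exp (exp 1 * (2 * R / l) * (lam * l)) \<le> exp (- (lam\<^sup>2)) * exp (3 * (lam\<^sup>2 / 50))"
      using K by (intro mult_mono) auto
    also have "\<dots> = exp (- (lam\<^sup>2) + 3 * (lam\<^sup>2 / 50))" by (simp only: exp_add)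
    also have "\<dots> \<le> exp (0 - lam - 2)"
      unfolding exp_le_cancel_iff using lq zero_le_power2[of lam] by linarith
    also have "\<dots> \<le> exp 0 * exp (- lam) / 6" by (rule six)
    finally have "exp (- real K) * exp (exp 1 * (2 * R / l) * (lam * l)) \<le> exp (- lam) / 6" by simp
    then show ?thesis using 1 by linarith
  qed
  \<comment> \<open>\<open>y^K \<le> exp (2 K L)\<close> with \<open>K\<close> far below
    \<open>l powr c\<close>, so the error term of the tuple hypothesis absorbs the number of
    tuples.\<close>
  have err3: "exp 1 * real y ^ K * (x * exp (- (l powr c) * L)) \<le> x * exp (- lam) / 6"
  proof -
    have "exp 1 * real y ^ K * (x * exp (- (l powr c) * L)) \<le> exp 1 * exp (real K * (2 * L)) * (x * exp (- (l powr c) * L))"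
      using ypow lx by (intro mult_right_mono mult_left_mono) auto
    also have "\<dots> = x * exp (1 + real K * (2 * L) - l powr c * L)" by (simp add: exp_add exp_diff exp_minus field_simps)
    also have "\<dots> \<le> x * exp (0 - lam - 2)"
    proof -
      have "real K * (2 * L) \<le> (2 * v) * (2 * L)" by (intro mult_right_mono) (use K v L in linarith)+
      moreover have "v * 1 \<le> v * L" by (intro mult_left_mono) (use v L in linarith)+
      moreover have "3 \<le> L" by (rule L)
      moreover have "(5 * v + 1) * L \<le> (v * v) * L"
      proof (intro mult_right_mono)
        have "6 * v \<le> v * v" using v by (intro mult_right_mono) auto
        then show "5 * v + 1 \<le> v * v" using v by linarith
      qed (use L in simp)
      moreover have "(2 * v) * (2 * L) = 4 * (v * L)" "(5 * v + 1) * L = 5 * (v * L) + L" by (simp_all add: algebra_simps)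
      ultimately have "1 + real K * (2 * L) - l powr c * L \<le> 0 - lam - 2" unfolding v(3)[symmetric]
        using v(2) by linarith
      then show ?thesis using lx by (intro mult_left_mono) auto
    qed
    also have "\<dots> \<le> x * (exp 0 * exp (- lam) / 6)" using lx by (intro mult_left_mono six) auto
    finally show ?thesis by simp
  qed
  have "x / 2 * (1 / ln x * exp (- real N * ln (real N)) *
        exp (- ((1 + 2 * q) * (1 - \<delta>) * (lam * l / (ln x - 1)) * exp (4 * ln (real y) / real N))))
      - sqrt x * (exp 1 * real y ^ K * (2 * R) ^ Suc K)
      - x * (real (Suc K)^2 / real Z * exp (2 * R / ln x * (lam * l)) + exp (- real K) * exp (exp 1 * (2 * R / ln x) * (lam * l)))
      - exp 1 * real y ^ K * (x * exp (- (l powr c) * L)) \<le> real (M_count A x (lam * l))"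
  proof (rule M_count_core[OF HL _ yphi Ko Kpsi _ y_def x Nz(3) NZ yZ R(1) _ _ _ \<delta>01(2) m])
    show "1 \<le> lam * l" using ll by simp
    show "0 \<le> x * exp (- (l powr c) * L)" using lx by simp
    show "2 * R \<le> ln x" using R R1 laml l by linarith
    show "2 / (ln x * mertens_prod Z) \<le> q" by (simp add: q_def l)
    show "q \<le> 1 / 2" using q24 \<delta>01 by linarith
    show "real (sift_count {p. prime p \<and> p \<le> N} m y) \<le> (1 - \<delta>) * mertens_prod N * real y"
      using sift by (simp only: y_def)
  qed
  then have fin: "x / 2 * (1 / l * exp (- real N * ln (real N)) * exp (- Ex))
      - sqrt x * (exp 1 * real y ^ K * (2 * R) ^ Suc K)
      - x * (real (Suc K)^2 / real Z * exp (2 * R / l * (lam * l)) + exp (- real K) * exp (exp 1 * (2 * R / l) * (lam * l)))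
      - exp 1 * real y ^ K * (x * exp (- (l powr c) * L)) \<le> real (M_count A x (lam * l))"
    unfolding Ex_def l .
  have "x * (real (Suc K)^2 / real Z * exp (2 * R / l * (lam * l)) + exp (- real K) * exp (exp 1 * (2 * R / l) * (lam * l))) \<le> x * (exp (- lam) / 3)"
    using err2 lx by (intro mult_left_mono) auto
  moreover have "x * exp (- lam) \<le> x * G" using G lx by (intro mult_left_mono) auto
  moreover have "0 \<le> x * exp (- lam)" using lx by simp
  ultimately have "x * G \<le> real (M_count A x (lam * l))" using fin main err1 err3 by linarith
  then show ?thesis by (simp add: G_def mult.assoc)
qed

section \<open>From fixed \<open>\<epsilon>\<close> to \<open>o(1)\<close>\<close>

text \<open>\<open>f x\<close> is the largest \<open>k\<close> such that \<open>x\<close> has passed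
  the thresholds of \<open>P 0\<close>, ..., \<open>P (k - 1)\<close>; capping \<open>k\<close> by
  \<open>x\<close> keeps the maximum finite.\<close>

lemma eventually_diagonal:
  fixes P :: "nat \<Rightarrow> real \<Rightarrow> bool"
  assumes "\<And>n. \<forall>\<^sub>F x in at_top. P n x"
  shows "\<exists>f :: real \<Rightarrow> nat. filterlim f at_top at_top \<and> (\<forall>x n. n < f x \<longrightarrow> P n x)"
proof -
  obtain X where X: "\<And>n x. X n \<le> x \<Longrightarrow> P n x"
    using assms unfolding eventually_at_top_linorder by metis
  define S where "S = (\<lambda>x::real. {k. k \<le> nat \<lfloor>x\<rfloor> \<and> (\<forall>n<k. X n \<le> x)})"
  define f where "f = (\<lambda>x. Max (S x))"
  have S: "finite (S x)" "S x \<noteq> {}" for x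
  proof -
    show "finite (S x)" by (rule finite_subset[of _ "{..nat \<lfloor>x\<rfloor>}"]) (auto simp: S_def)
    have "0 \<in> S x" by (simp add: S_def)
    then show "S x \<noteq> {}" by blast
  qed
  have lim: "filterlim f at_top at_top"
    unfolding filterlim_at_top
  proof
    fix k :: nat
    define B where "B = Max (insert (real k) (X ` {..<k}))"
    have "k \<le> f x" if "B \<le> x" for x
    proof -
      have B: "b \<le> x" if "b \<in> insert (real k) (X ` {..<k})" for b
      proof -
        have "b \<le> B" unfolding B_def using that by (intro Max_ge) auto
        then show ?thesis using \<open>B \<le> x\<close> by linarith
      qed
      have "real k \<le> x" by (rule B) simp
      then have "k \<le> nat \<lfloor>x\<rfloor>" by (simp add: le_nat_iff le_floor_iff)
      then have "k \<in> S x" using B by (auto simp: S_def)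
      then show ?thesis unfolding f_def by (rule Max_ge[OF S(1)])
    qed
    then show "\<forall>\<^sub>F x in at_top. k \<le> f x" unfolding eventually_at_top_linorder by blast
  qed
  have P: "P n x" if "n < f x" for n x
  proof -
    have "f x \<in> S x" unfolding f_def using S by (rule Max_in)
    then show ?thesis using that X by (simp add: S_def)
  qed
  show ?thesis using lim P by blast
qed

lemma filterlim_nat_floor:
  assumes "filterlim g at_top F"
  shows "filterlim (\<lambda>x. nat \<lfloor>g x :: real\<rfloor>) at_top F"
  unfolding filterlim_at_top
proof
  fix k :: nat
  have "\<forall>\<^sub>F x in F. real k \<le> g x" using assms unfolding filterlim_at_top by blast
  then show "\<forall>\<^sub>F x in F. k \<le> nat \<lfloor>g x\<rfloor>"
    by eventually_elim (simp add: le_nat_iff le_floor_iff)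
qed

lemma filterlim_min_at_top:
  fixes f g :: "'a \<Rightarrow> nat"
  assumes "filterlim f at_top F" "filterlim g at_top F"
  shows "filterlim (\<lambda>x. min (f x) (g x)) at_top F"
  unfolding filterlim_at_top
proof
  fix k :: nat
  have "\<forall>\<^sub>F x in F. k \<le> f x" "\<forall>\<^sub>F x in F. k \<le> g x" using assms unfolding filterlim_at_top by blast+
  then show "\<forall>\<^sub>F x in F. k \<le> min (f x) (g x)" by eventually_elim simp
qed

lemma tendsto_const_divide_nat:
  assumes "filterlim f at_top F"
  shows "((\<lambda>x. a / real (f x)) \<longlongrightarrow> 0) F"
  by (rule tendsto_divide_0[OF tendsto_const])
     (intro filterlim_at_top_imp_at_infinity filterlim_compose[OF filterlim_real_sequentially assms])

text \<open>Tailored to \<open>\<epsilon> = 1 / n\<close> with \<open>n \<le> L powr (1/4)\<close>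
  and to \<open>k = real C + 1\<close>. As \<open>sqlog L\<close> exceeds \<open>sqrt L\<close>, one
  then has \<open>\<epsilon> s \<ge> L powr (1/4)\<close>, whose exponential still dominates every
  power of \<open>L\<close>.\<close>

lemma eventually_growth:
  fixes k :: real
  assumes k: "k \<ge> 1"
  shows "\<forall>\<^sub>F L in at_top. 3 \<le> L \<and> ln (100 * k) + k * ln (2 * L) \<le> sqlog L \<and>
    192 * L \<le> exp (L powr (1/4)) \<and> 4 * (ln 4 + L + sqlog L) \<le> exp (2 * L powr (1/4)) \<and>
    sqlog L \<le> L / 8 \<and> 100 \<le> exp (sqlog L) \<and> 2 * L \<le> exp (sqlog L) \<and>
    48 * k * 2 powr k \<le> exp (L / 2) \<and> 3 + 6 * exp (L / 4) * L + L + exp (L / 8) \<le> exp L / 2 \<and>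
    L powr (1/4) * (20 * sqlog L) \<le> L \<and> L powr (1/4) * L powr (1/4) \<le> sqlog L"
proof -
  have kp: "k > 0" using k by simp
  have "\<forall>\<^sub>F L::real in at_top. 3 \<le> L" by (rule eventually_ge_at_top)
  moreover have "\<forall>\<^sub>F L in at_top. ln (100 * k) + k * ln (2 * L) \<le> sqlog L" unfolding sqlog_def using kp by real_asymp
  moreover have "\<forall>\<^sub>F L::real in at_top. 192 * L \<le> exp (L powr (1/4))" by real_asymp
  moreover have "\<forall>\<^sub>F L in at_top. 4 * (ln 4 + L + sqlog L) \<le> exp (2 * L powr (1/4))" unfolding sqlog_def by real_asymp
  moreover have "\<forall>\<^sub>F L in at_top. sqlog L \<le> L / 8" unfolding sqlog_def by real_asymp
  moreover have "\<forall>\<^sub>F L in at_top. 100 \<le> exp (sqlog L)" unfolding sqlog_def by real_asymp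
  moreover have "\<forall>\<^sub>F L in at_top. 2 * L \<le> exp (sqlog L)" unfolding sqlog_def by real_asymp
  moreover have "\<forall>\<^sub>F L::real in at_top. 48 * k * 2 powr k \<le> exp (L / 2)" by real_asymp
  moreover have "\<forall>\<^sub>F L::real in at_top. 3 + 6 * exp (L / 4) * L + L + exp (L / 8) \<le> exp L / 2" by real_asymp
  moreover have "\<forall>\<^sub>F L in at_top. L powr (1/4) * (20 * sqlog L) \<le> L" unfolding sqlog_def by real_asymp
  moreover have "\<forall>\<^sub>F L in at_top. L powr (1/4) * L powr (1/4) \<le> sqlog L" unfolding sqlog_def by real_asymp
  ultimately show ?thesis by eventually_elim blast
qed

text \<open>The fixed precision is replaced by \<open>\<epsilon> = 1 / n x\<close> with
  \<open>n x\<close> tending to infinity, so that \<open>24 \<epsilon>\<close> becomes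
  \<open>o(1)\<close>. The hypothesis on \<open>\<eta>\<close> provides the
  \<open>51 \<epsilon>\<close> in the lower bound for \<open>lam\<close> when \<open>n x\<close>
  equals \<open>n0\<close>.\<close>

lemma gap_count_lower:
  fixes A :: "nat set" and c :: real and lam \<eta> e :: "real \<Rightarrow> real" and n0 :: "real \<Rightarrow> nat"
  assumes n0: "filterlim n0 at_top at_top" "\<And>L. real (n0 L) \<le> L powr (1/4)"
      "\<And>L n. 100 \<le> n \<Longrightarrow> n \<le> n0 L \<Longrightarrow> sieve_config (1 / real n) L"
    and \<eta>: "\<forall>\<^sub>F x in at_top. 51 / real (n0 (ln (ln x))) \<le> \<eta> x"
    and c: "0 < c"
    and HL: "HL (\<lambda>x. ln x powr (1 + c)) (\<lambda>x. ln x powr c) A"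
    and lam: "\<forall>\<^sub>F x in at_top. exp ((sqrt 2 + \<eta> x) * sqlog (ln (ln x))) \<le> lam x"
    and e: "(e \<longlongrightarrow> 0) at_top" "\<forall>\<^sub>F x in at_top. lam x = ln x powr e x"
  shows "\<exists>\<delta>. (\<delta> \<longlongrightarrow> 0) at_top \<and> (\<forall>\<^sub>F x in at_top.
    x * exp (- lam x) * exp (lam x * exp (- (1 / sqrt 2 + \<delta> x) * sqlog (ln (ln x)))) \<le> real (M_count A x (lam x * ln x)))"
proof -
  obtain C :: nat where C: "\<And>n. n \<ge> 3 \<Longrightarrow> 1 / mertens_prod n \<le> real C * ln (real n) ^ C"
    using mertens_prod_ge by blast
  define k where "k = real C + 1"
  have k: "k \<ge> 1" by (simp add: k_def)
  from HL[unfolded HL_def] obtain x0 where x0': "\<forall>x\<ge>x0. \<forall>H :: int set.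
      finite H \<and> (\<forall>h\<in>H. 0 \<le> h \<and> real_of_int h \<le> ln x powr (1 + c)) \<and> real (card H) \<le> ln x powr c \<longrightarrow>
      \<bar>real (card {n. 1 \<le> n \<and> real n \<le> x \<and> (\<forall>h\<in>H. int n + h \<in> int ` A)})
           - singular_series H * integral {2..x} (\<lambda>t. 1 / ln t ^ card H)\<bar>
          \<le> x * exp (- (ln x powr c) * iter_log 2 x)" by (rule exE)
  define LL where "LL = (\<lambda>x::real. ln (ln x))"
  have LL: "filterlim LL at_top at_top" unfolding LL_def by real_asymp
  note growth = eventually_compose_filterlim[OF eventually_growth[OF k] LL]
  \<comment> \<open>The lower bound on \<open>lam\<close> forces its exponent \<open>e x\<close> to
    be positive, so that \<open>1 / e x\<close> can serve as a cap.\<close>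
  have lam1: "\<forall>\<^sub>F x in at_top. e x > 0 \<and> ln (lam x) = e x * LL x"
    using lam e(2) growth \<eta>
  proof eventually_elim
    case (elim x)
    have "0 < sqlog (LL x)" 
    proof -
      have "ln 100 \<le> ln (exp (sqlog (LL x)))" using elim(3) by (intro ln_mono) auto
      moreover have "ln (100::real) > 0" by simp
      ultimately show ?thesis unfolding ln_exp by linarith
    qed
    moreover have "0 \<le> \<eta> x"
    proof -
      have "0 \<le> 51 / real (n0 (ln (ln x)))" by simp
      then show ?thesis using elim(4) by linarith
    qed
    ultimately have "0 < (sqrt 2 + \<eta> x) * sqlog (LL x)" by (intro mult_pos_pos add_pos_nonneg) auto
    then have "1 < exp ((sqrt 2 + \<eta> x) * sqlog (LL x))" by simp
    then have gt: "1 < lam x" using elim(1) unfolding LL_def by linarith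
    have l0: "ln x \<noteq> 0"
    proof
      assume "ln x = 0"
      then have "LL x = 0" by (simp add: LL_def)
      then show False using elim(3) by simp
    qed
    have "ln (lam x) = e x * LL x" unfolding elim(2) LL_def using l0 by (simp add: ln_powr)
    moreover have "0 < ln (lam x)" using gt by simp
    ultimately show ?case using elim(3) by (auto simp: zero_less_mult_iff)
  qed
  \<comment> \<open>\<open>1 / n x\<close> must bound \<open>e x\<close>, so that \<open>ln y \<le> (1 + 1 / n x) L\<close>; when \<open>n x < n0\<close>, this makes \<open>lam x\<close> so large
    that its lower bound in terms of \<open>1 / n x\<close> holds without using \<open>\<eta>\<close>.\<close>
  define n where "n = (\<lambda>x. min (n0 (LL x)) (nat \<lfloor>1 / e x\<rfloor>))"
  have "filterlim e (at_right 0) at_top"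
    unfolding at_within_def filterlim_inf
    using e(1) lam1 by (auto simp: filterlim_principal elim: eventually_mono)
  then have "filterlim (\<lambda>x. inverse (e x)) at_top at_top"
    by (rule filterlim_compose[OF filterlim_inverse_at_top_right])
  then have n: "filterlim n at_top at_top"
    unfolding n_def by (intro filterlim_min_at_top filterlim_nat_floor filterlim_compose[OF n0(1) LL])
      (simp add: inverse_eq_divide)
  \<comment> \<open>The second term turns the factor \<open>1/4\<close> in the bound of
    \<open>M_count_numeric\<close> into part of the \<open>o(1)\<close>.\<close>
  define \<delta> where "\<delta> = (\<lambda>x. 24 / real (n x) + ln 4 / sqlog (LL x))"
  have "((\<lambda>x. ln 4 / sqlog (LL x)) \<longlongrightarrow> 0) at_top" unfolding sqlog_def LL_def by real_asymp
  from tendsto_add[OF tendsto_const_divide_nat[OF n, of 24] this]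
  have \<delta>0: "(\<delta> \<longlongrightarrow> 0) at_top" by (simp add: \<delta>_def)
  have "\<forall>\<^sub>F x in at_top. 100 \<le> n x" using n unfolding filterlim_at_top by blast
  moreover have "\<forall>\<^sub>F x in at_top. e x < min (c / 4) (1 / (8 * k))"
    using e(1) c k by (intro order_tendstoD) auto
  moreover have "\<forall>\<^sub>F x::real in at_top. 16 \<le> x" "\<forall>\<^sub>F x in at_top. x0 \<le> x" by (rule eventually_ge_at_top)+
  ultimately have "\<forall>\<^sub>F x in at_top.
    x * exp (- lam x) * exp (lam x * exp (- (1 / sqrt 2 + \<delta> x) * sqlog (ln (ln x)))) \<le> real (M_count A x (lam x * ln x))"
    using growth lam1 lam \<eta>
  proof eventually_elim
    case (elim x)
    define L where "L = LL x"
    define s where "s = sqlog L"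
    define \<epsilon> where "\<epsilon> = 1 / real (n x)"
    define \<Lambda> where "\<Lambda> = ln (lam x)"
    note gr = elim(5)[folded L_def, folded s_def]
    have L3: "3 \<le> L" using gr by simp
    have s0: "0 < s"
    proof -
      have "ln 100 \<le> ln (exp s)" using gr by (intro ln_mono) auto
      moreover have "ln (100::real) > 0" by simp
      ultimately show ?thesis unfolding ln_exp by linarith
    qed
    have lx: "ln x > 1"
    proof -
      have "ln x > 0" using elim(3) by simp
      moreover have "0 < ln (ln x)" using L3 by (simp add: L_def LL_def)
      ultimately show ?thesis by simp
    qed
    have it2: "iter_log 2 x = L"
      using L3 lx by (simp add: numeral_2_eq_2 L_def LL_def)
    have \<epsilon>: "0 < \<epsilon>" "\<epsilon> \<le> 1 / 100" using elim(1) by (auto simp: \<epsilon>_def field_simps)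
    have e0: "e x > 0" and \<Lambda>: "\<Lambda> = e x * L" using elim(6) by (auto simp: \<Lambda>_def L_def)
    have n_n0: "n x \<le> n0 L" and n_e: "real (n x) \<le> 1 / e x"
    proof -
      show "n x \<le> n0 L" by (simp add: n_def L_def)
      have "real (n x) \<le> real (nat \<lfloor>1 / e x\<rfloor>)" by (simp only: n_def of_nat_le_iff min.cobounded2)
      also have "\<dots> \<le> 1 / e x" using e0 by (intro of_nat_floor) simp
      finally show "real (n x) \<le> 1 / e x" .
    qed
    have npos: "real (n x) \<ge> 100" using elim(1) by simp
    have nL: "real (n x) \<le> L powr (1/4)" using n_n0 n0(2)[of L] by (meson of_nat_mono order_trans)
    have lamge: "exp ((sqrt 2 + 51 * \<epsilon>) * s) \<le> lam x"
    proof (cases "n x = n0 L")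
      case True
      have "51 * \<epsilon> \<le> \<eta> x" using elim(8) by (simp add: \<epsilon>_def True L_def LL_def)
      then have "(sqrt 2 + 51 * \<epsilon>) * s \<le> (sqrt 2 + \<eta> x) * s" using s0 by (intro mult_right_mono) auto
      then have "exp ((sqrt 2 + 51 * \<epsilon>) * s) \<le> exp ((sqrt 2 + \<eta> x) * s)" by simp
      also have "\<dots> \<le> lam x" using elim(7) by (simp add: s_def L_def LL_def)
      finally show ?thesis .
    next
      case False
      \<comment> \<open>Here \<open>e x\<close> is at least \<open>1 / (2 n)\<close>, so
        \<open>\<Lambda> \<ge> L / (2 n) \<ge> 10 s\<close> because
        \<open>n \<le> L powr (1/4)\<close>; and 10 exceeds
        \<open>sqrt 2 + 51 \<epsilon>\<close>.\<close>
      then have "n x = nat \<lfloor>1 / e x\<rfloor>" using n_n0 by (auto simp: n_def L_def min_def split: if_splits)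
      then have "1 / e x \<le> real (n x) + 1" by linarith
      then have "1 / e x \<le> 2 * real (n x)" using npos by linarith
      then have "1 \<le> 2 * real (n x) * e x" using e0 by (simp add: field_simps)
      then have "L * 1 \<le> L * (2 * real (n x) * e x)" using L3 by (intro mult_left_mono) auto
      then have 1: "L \<le> real (n x) * (2 * \<Lambda>)" by (simp add: \<Lambda> mult_ac)
      have "real (n x) * (20 * s) \<le> L powr (1/4) * (20 * s)" using nL s0 by (intro mult_right_mono) auto
      also have "\<dots> \<le> L" using gr by simp
      finally have "real (n x) * (20 * s) \<le> real (n x) * (2 * \<Lambda>)" using 1 by linarith
      then have "20 * s \<le> 2 * \<Lambda>" by (rule mult_left_le_imp_le) (use npos in linarith)
      moreover have "(sqrt 2 + 51 * \<epsilon>) * s \<le> 10 * s"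
      proof (intro mult_right_mono)
        have "sqrt 2 \<le> (2::real)" by (intro real_le_lsqrt) auto
        then show "sqrt 2 + 51 * \<epsilon> \<le> 10" using \<epsilon> by linarith
      qed (use s0 in simp)
      ultimately have "(sqrt 2 + 51 * \<epsilon>) * s \<le> \<Lambda>" by linarith
      then have "exp ((sqrt 2 + 51 * \<epsilon>) * s) \<le> exp \<Lambda>" by simp
      also have "exp \<Lambda> = lam x"
      proof -
        have "0 < exp ((sqrt 2 + \<eta> x) * sqlog (ln (ln x)))" by simp
        then have "0 < lam x" using elim(7) by linarith
        then show ?thesis by (simp add: \<Lambda>_def)
      qed
      finally show ?thesis .
    qed
    have lampos: "1 < lam x"
    proof -
      have "0 < (sqrt 2 + 51 * \<epsilon>) * s" using s0 \<epsilon> by (intro mult_pos_pos add_pos_pos) auto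
      then have "1 < exp ((sqrt 2 + 51 * \<epsilon>) * s)" by simp
      then show ?thesis using lamge by linarith
    qed
    have y1: "1 \<le> nat \<lfloor>lam x * ln x\<rfloor>"
    proof -
      have "1 * 1 \<le> lam x * ln x" using lampos lx by (intro mult_mono) auto
      then show ?thesis by (simp add: le_nat_iff le_floor_iff)
    qed
    have lny: "ln (real (nat \<lfloor>lam x * ln x\<rfloor>)) \<le> (1 + \<epsilon>) * L"
    proof -
      have "real (nat \<lfloor>lam x * ln x\<rfloor>) \<le> lam x * ln x" using lampos lx by (intro of_nat_floor) auto
      then have "ln (real (nat \<lfloor>lam x * ln x\<rfloor>)) \<le> ln (lam x * ln x)" using y1 by (intro ln_mono) auto
      also have "\<dots> = \<Lambda> + L" using lampos lx by (simp add: ln_mult \<Lambda>_def L_def LL_def)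
      also have "\<Lambda> \<le> \<epsilon> * L"
      proof -
        have "e x \<le> \<epsilon>" using n_e e0 npos by (simp add: \<epsilon>_def field_simps)
        then show ?thesis unfolding \<Lambda> using L3 by (intro mult_right_mono) auto
      qed
      finally show ?thesis by (simp add: algebra_simps)
    qed
    define N where "N = nat \<lfloor>exp ((1 / sqrt 2 + 25 * \<epsilon>) * s)\<rfloor>"
    have cfg: "sieve_config \<epsilon> L" unfolding \<epsilon>_def using elim(1) n_n0 by (rule n0(3))
    from cfg[unfolded sieve_config_def, THEN spec, THEN spec, THEN mp, OF y1, THEN mp, OF lny, THEN mp, OF N_def[unfolded s_def]]
    obtain m where "(\<forall>p. prime p \<and> p \<le> N \<longrightarrow> \<not> p dvd m) \<and>
      real (sift_count {p. prime p \<and> p \<le> N} m (nat \<lfloor>lam x * ln x\<rfloor>)) \<le>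
          (1 - exp (- (1 / sqrt 2 + 24 * \<epsilon>) * sqlog L)) * mertens_prod N * real (nat \<lfloor>lam x * ln x\<rfloor>)"
      by (rule exE)
    then have m: "\<And>p. prime p \<Longrightarrow> p \<le> N \<Longrightarrow> \<not> p dvd m"
      "real (sift_count {p. prime p \<and> p \<le> N} m (nat \<lfloor>lam x * ln x\<rfloor>)) \<le>
          (1 - exp (- (1 / sqrt 2 + 24 * \<epsilon>) * s)) * mertens_prod N * real (nat \<lfloor>lam x * ln x\<rfloor>)"
      unfolding s_def by blast+
    have \<epsilon>s: "L powr (1/4) \<le> \<epsilon> * s"
    proof -
      have "L powr (1/4) * real (n x) \<le> L powr (1/4) * L powr (1/4)" using nL by (intro mult_left_mono) auto
      also have "\<dots> \<le> s" using gr by simp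
      finally show ?thesis using npos by (simp add: \<epsilon>_def field_simps)
    qed
    have "x * exp (- lam x) * exp (lam x * exp (- (1 / sqrt 2 + 24 * \<epsilon>) * s) / 4) \<le> real (M_count A x (lam x * ln x))"
    proof (rule M_count_numeric[where l = "ln x" and C = C and c = c and s = s and \<epsilon> = \<epsilon> and L = L and \<Lambda> = \<Lambda> and m = m])
      show "L = ln (ln x)" by (simp add: L_def LL_def)
      fix H :: "int set"
      assume "finite H" "\<forall>h\<in>H. 0 \<le> h \<and> real_of_int h \<le> ln x powr (1 + c)" "real (card H) \<le> ln x powr c"
      then have "finite H \<and> (\<forall>h\<in>H. 0 \<le> h \<and> real_of_int h \<le> ln x powr (1 + c)) \<and> real (card H) \<le> ln x powr c"
        by (intro conjI)
      from x0'[THEN spec, THEN mp, OF elim(4), THEN spec, THEN mp, OF this]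
      show "\<bar>real (card {n. 1 \<le> n \<and> real n \<le> x \<and> (\<forall>h\<in>H. int n + h \<in> int ` A)})
           - singular_series H * integral {2..x} (\<lambda>t. 1 / ln t ^ card H)\<bar> \<le> x * exp (- (ln x powr c) * L)"
        unfolding it2 .
    next
      have "e x \<le> c / 4" using elim(2) by simp
      then have "e x * L \<le> c / 4 * L" using L3 by (intro mult_right_mono) auto
      then show "\<Lambda> \<le> c * L / 4" by (simp add: \<Lambda>)
      have "e x \<le> 1 / (8 * k)" using elim(2) by simp
      then have "8 * k * e x \<le> 1" using k by (simp add: field_simps)
      then have "8 * k * e x * L \<le> 1 * L" using L3 by (intro mult_right_mono) auto
      then show "8 * (real C + 1) * \<Lambda> \<le> L" by (simp add: \<Lambda> k_def mult.assoc)
      show "100 * (real C + 1) * (2 * L) ^ C \<le> exp s"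
      proof -
        have "(2 * L) ^ C = (2 * L) powr real C" using L3 by (simp add: powr_realpow)
        also have "\<dots> \<le> (2 * L) powr k" using L3 by (intro powr_mono) (auto simp: k_def)
        also have "\<dots> = exp (k * ln (2 * L))" using L3 by (simp add: powr_def)
        finally have "100 * (real C + 1) * (2 * L) ^ C \<le> exp (ln (100 * k)) * exp (k * ln (2 * L))"
          using k L3 by (intro mult_mono) (auto simp: k_def)
        also have "\<dots> = exp (ln (100 * k) + k * ln (2 * L))" by (simp only: exp_add)
        also have "\<dots> \<le> exp s" using gr by simp
        finally show ?thesis .
      qed
      have "192 * L \<le> exp (L powr (1/4))" using gr by simp
      also have "\<dots> \<le> exp (\<epsilon> * s)" using \<epsilon>s by simp
      finally show "192 * L \<le> exp (\<epsilon> * s)" .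
      have "4 * (ln 4 + L + s) \<le> exp (2 * L powr (1/4))" using gr by simp
      also have "\<dots> \<le> exp (2 * (\<epsilon> * s))" using \<epsilon>s by simp
      finally show "4 * (ln 4 + L + s) \<le> exp (2 * (\<epsilon> * s))" .
      have "48 * (real C + 1) * 2 ^ C \<le> 48 * k * 2 powr k"
      proof (intro mult_mono)
        have "(2::real) ^ C = 2 powr real C" by (simp add: powr_realpow)
        also have "\<dots> \<le> 2 powr k" by (intro powr_mono) (auto simp: k_def)
        finally show "(2::real) ^ C \<le> 2 powr k" .
      qed (use k in \<open>auto simp: k_def\<close>)
      also have "\<dots> \<le> exp (L / 2)" using gr by simp
      finally show "48 * (real C + 1) * 2 ^ C \<le> exp (L / 2)" .
    qed (use gr L3 s0 c C \<epsilon> lamge elim(3) m N_def in \<open>simp_all add: \<Lambda>_def\<close>)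
    moreover have "exp (- (1 / sqrt 2 + 24 * \<epsilon>) * s) / 4 = exp (- (1 / sqrt 2 + \<delta> x) * sqlog (ln (ln x)))"
    proof -
      have "- (1 / sqrt 2 + \<delta> x) * s = - (1 / sqrt 2 + 24 * \<epsilon>) * s - ln 4"
        using s0 by (simp add: \<delta>_def \<epsilon>_def s_def L_def field_simps)
      then have "exp (- (1 / sqrt 2 + \<delta> x) * s) = exp (- (1 / sqrt 2 + 24 * \<epsilon>) * s) / 4"
        by (simp only: exp_diff) simp
      then show ?thesis by (simp add: s_def L_def LL_def)
    qed
    ultimately show ?case by (metis times_divide_eq_right)
  qed
  then show ?thesis using \<delta>0 by blast
qed

text \<open>\<open>\<eta>0\<close> is built from thresholds of the sieve alone, so it can precede
  \<open>A\<close>, \<open>c\<close>, \<open>\<eta>\<close> and \<open>lam\<close>;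
  \<open>\<delta>\<close> comes last and may depend on all of them.\<close>

theorem theorem1p13:
  shows "\<exists>\<eta>0 :: real \<Rightarrow> real.
    (\<forall>x. \<eta>0 x > 0) \<and> (\<eta>0 \<longlongrightarrow> 0) at_top \<and>
    (\<forall>(\<eta> :: real \<Rightarrow> real) (c :: real) (A :: nat set) (lam :: real \<Rightarrow> real).
       (\<forall>x. \<eta> x > 0) \<longrightarrow> (\<eta> \<longlongrightarrow> 0) at_top \<longrightarrow> (\<forall>\<^sub>F x in at_top. \<eta> x \<ge> \<eta>0 x) \<longrightarrow>
       0 < c \<longrightarrow> c < 1 \<longrightarrow>
       0 \<notin> A \<longrightarrow>
       HL (\<lambda>x. ln x powr (1 + c)) (\<lambda>x. ln x powr c) A \<longrightarrow>
       (\<forall>\<^sub>F x in at_top.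
          lam x \<ge> exp ((sqrt 2 + \<eta> x) * sqrt (iter_log 2 x * iter_log 3 x))) \<longrightarrow>
       (\<exists>\<epsilon> :: real \<Rightarrow> real. (\<epsilon> \<longlongrightarrow> 0) at_top \<and> (\<forall>\<^sub>F x in at_top. lam x = ln x powr \<epsilon> x)) \<longrightarrow>
       (\<exists>\<delta> :: real \<Rightarrow> real. (\<delta> \<longlongrightarrow> 0) at_top \<and>
          (\<forall>\<^sub>F x in at_top.
             real (M_count A x (lam x * ln x))
               \<ge> x * exp (- lam x)
                   * exp (lam x * exp (- (1 / sqrt 2 + \<delta> x) * sqrt (iter_log 2 x * iter_log 3 x)))
           \<and> real (N_count A x (lam x * ln x) 0)
               \<ge> x * exp (- lam x)
                   * exp (lam x * exp (- (1 / sqrt 2 + \<delta> x) * sqrt (iter_log 2 x * iter_log 3 x))))))"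
proof -
  have "\<forall>\<^sub>F L in at_top. 100 \<le> n \<longrightarrow> sieve_config (1 / real n) L" for n :: nat
  proof (cases "100 \<le> n")
    case True
    then have "0 < 1 / real n" "1 / real n \<le> 1 / 100" by (auto simp: field_simps)
    from short_interval_sieve[OF this] show ?thesis
      by (rule eventually_mono) blast
  qed simp
  from eventually_diagonal[of "\<lambda>n L. 100 \<le> n \<longrightarrow> sieve_config (1 / real n) L", OF this]
  obtain f :: "real \<Rightarrow> nat" where
    f': "filterlim f at_top at_top \<and> (\<forall>L n. n < f L \<longrightarrow> 100 \<le> n \<longrightarrow> sieve_config (1 / real n) L)"
    by (rule exE)
  then have f: "filterlim f at_top at_top" "\<And>L n. n < f L \<Longrightarrow> 100 \<le> n \<Longrightarrow> sieve_config (1 / real n) L"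
    by simp_all
  \<comment> \<open>The decrement turns the strict \<open>n < f L\<close> of the diagonal into
    \<open>n \<le> n0 L\<close>; the cap keeps \<open>1 / n\<close> from shrinking too fast for
    \<open>eventually_growth\<close>.\<close>
  define n0 where "n0 = (\<lambda>L. min (f L - 1) (nat \<lfloor>L powr (1/4)\<rfloor>))"
  have fm: "filterlim (\<lambda>L. f L - 1) at_top at_top"
    by (rule filterlim_compose[OF filterlim_minus_const_nat_at_top f(1)])
  have "filterlim (\<lambda>L::real. L powr (1/4)) at_top at_top" by real_asymp
  then have n0_lim: "filterlim n0 at_top at_top"
    unfolding n0_def by (intro filterlim_min_at_top fm filterlim_nat_floor)
  have n0_le: "real (n0 L) \<le> L powr (1/4)" for L
  proof -
    have "real (n0 L) \<le> real (nat \<lfloor>L powr (1/4)\<rfloor>)" by (simp only: n0_def of_nat_le_iff min.cobounded2)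
    also have "\<dots> \<le> L powr (1/4)" by (rule of_nat_floor) simp
    finally show ?thesis .
  qed
  have n0_config: "sieve_config (1 / real n) L" if "100 \<le> n" "n \<le> n0 L" for n L
  proof -
    have "n \<le> f L - 1" using that(2) by (simp add: n0_def)
    then have "n < f L" using that(1) by linarith
    then show ?thesis using that(1) by (rule f(2))
  qed
  have LL: "filterlim (\<lambda>x::real. ln (ln x)) at_top at_top" by real_asymp
  have n0LL: "filterlim (\<lambda>x. n0 (ln (ln x))) at_top at_top" by (rule filterlim_compose[OF n0_lim LL])
  \<comment> \<open>Division by 0 yields 0, so the value 1 is put where \<open>n0\<close> vanishes,
    to keep \<open>\<eta>0\<close> positive everywhere.\<close>
  define \<eta>0 where "\<eta>0 = (\<lambda>x. if n0 (ln (ln x)) = 0 then 1 else 51 / real (n0 (ln (ln x))))"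
  have \<eta>0_pos: "\<eta>0 x > 0" for x by (simp add: \<eta>0_def)
  have n0_ev: "\<forall>\<^sub>F x in at_top. 1 \<le> n0 (ln (ln x))" using n0LL unfolding filterlim_at_top by blast
  then have "\<forall>\<^sub>F x in at_top. 51 / real (n0 (ln (ln x))) = \<eta>0 x"
    by eventually_elim (simp add: \<eta>0_def)
  then have \<eta>0_lim: "(\<eta>0 \<longlongrightarrow> 0) at_top"
    by (rule Lim_transform_eventually[OF tendsto_const_divide_nat[OF n0LL]])
  have iter: "\<forall>\<^sub>F x in at_top. sqrt (iter_log 2 x * iter_log 3 x) = sqlog (ln (ln x))"
  proof -
    have "\<forall>\<^sub>F x::real in at_top. ln x \<ge> 0 \<and> ln (ln x) \<ge> 0 \<and> ln (ln (ln x)) \<ge> 0"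
      by (intro eventually_conj) real_asymp+
    then show ?thesis
      by eventually_elim (simp add: numeral_2_eq_2 numeral_3_eq_3 sqlog_def)
  qed
  show ?thesis
  proof (rule exI[of _ \<eta>0], intro conjI allI impI \<eta>0_pos \<eta>0_lim)
    fix \<eta> lam :: "real \<Rightarrow> real" and c :: real and A :: "nat set"
    assume \<eta>: "\<forall>\<^sub>F x in at_top. \<eta> x \<ge> \<eta>0 x" and c: "0 < c"
      and HL: "HL (\<lambda>x. ln x powr (1 + c)) (\<lambda>x. ln x powr c) A"
      and lam: "\<forall>\<^sub>F x in at_top. lam x \<ge> exp ((sqrt 2 + \<eta> x) * sqrt (iter_log 2 x * iter_log 3 x))"
      and "\<exists>\<epsilon> :: real \<Rightarrow> real. (\<epsilon> \<longlongrightarrow> 0) at_top \<and> (\<forall>\<^sub>F x in at_top. lam x = ln x powr \<epsilon> x)"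
    then obtain e :: "real \<Rightarrow> real" where e: "(e \<longlongrightarrow> 0) at_top" "\<forall>\<^sub>F x in at_top. lam x = ln x powr e x" by blast
    have "\<forall>\<^sub>F x in at_top. 51 / real (n0 (ln (ln x))) \<le> \<eta> x"
      using \<eta> n0_ev by eventually_elim (simp add: \<eta>0_def)
    moreover have "\<forall>\<^sub>F x in at_top. exp ((sqrt 2 + \<eta> x) * sqlog (ln (ln x))) \<le> lam x"
      using lam iter by eventually_elim simp
    ultimately obtain \<delta> where \<delta>: "(\<delta> \<longlongrightarrow> 0) at_top" "\<forall>\<^sub>F x in at_top.
      x * exp (- lam x) * exp (lam x * exp (- (1 / sqrt 2 + \<delta> x) * sqlog (ln (ln x)))) \<le> real (M_count A x (lam x * ln x))"
      using gap_count_lower[OF n0_lim n0_le n0_config _ c HL _ e] by blast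
    have "\<forall>\<^sub>F x in at_top.
             real (M_count A x (lam x * ln x))
               \<ge> x * exp (- lam x)
                   * exp (lam x * exp (- (1 / sqrt 2 + \<delta> x) * sqrt (iter_log 2 x * iter_log 3 x)))
           \<and> real (N_count A x (lam x * ln x) 0)
               \<ge> x * exp (- lam x)
                   * exp (lam x * exp (- (1 / sqrt 2 + \<delta> x) * sqrt (iter_log 2 x * iter_log 3 x)))"
      using \<delta>(2) iter
    proof eventually_elim
      case (elim x)
      have "real (M_count A x (lam x * ln x)) \<le> real (N_count A x (lam x * ln x) 0)"
        by (simp add: M_count_le_N_count)
      then show ?case unfolding elim(2) using elim(1) by linarith
    qed
    then show "\<exists>\<delta> :: real \<Rightarrow> real. (\<delta> \<longlongrightarrow> 0) at_top \<and>
          (\<forall>\<^sub>F x in at_top.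
             real (M_count A x (lam x * ln x))
               \<ge> x * exp (- lam x)
                   * exp (lam x * exp (- (1 / sqrt 2 + \<delta> x) * sqrt (iter_log 2 x * iter_log 3 x)))
           \<and> real (N_count A x (lam x * ln x) 0)
               \<ge> x * exp (- lam x)
                   * exp (lam x * exp (- (1 / sqrt 2 + \<delta> x) * sqrt (iter_log 2 x * iter_log 3 x))))"
      using \<delta>(1) by blast
  qed
qed

end
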